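(* Let $G$ be a finite primitive permutation group on a set $\Omega$ and let $p$ be a prime dividing $|\Omega|$. Then one of the following holds: (i) $G$ has a subdegree divisible by $p$; (ii) $G$ is almost simple or affine; (iii) $G\le H\wr K$ acting in product action on $\Omega=\Delta^k$ (with $k\ge 2$) with primitive component $H$, where $H$ is almost simple, $H$ has no subdegree divisible by $p$ (in its action on $\Delta$), and for each $r\le k$, each orbit of $K$ on the set of $r$-subsets of $\{1,\dots,k\}$ has size coprime to $p$.
   Context: A subdegree is the size of an orbit of a point stabiliser. Product action: $\mathrm{Sym}(\Delta)\wr S_k$ acts on $\Delta^k$ with the base group acting coordinatewise and $S_k$ permuting coordinates. If $G\le\mathrm{Sym}(\Delta)\wr S_k$ is primitive in this action, $K\le S_k$ denotes the image of $G$ under the natural map to $S_k$; if $G_1$ is the stabiliser in $G$ of the coordinate $1$ and $\pi_1$ the projection onto the first coordinate factor $\mathrm{Sym}(\Delta)$, the primitive component of $G$ (relative to $\Omega=\Delta^k$) is $H=\pi_1(G_1)\le\mathrm{Sym}(\Delta)$, which is primitive on $\Delta$; up to conjugation $G\le H\wr K$. Affine means a unique minimal normal subgroup that is elementary abelian and regular; almost simple means $T\le G\le\mathrm{Aut}(T)$ for a nonabelian simple $T$. *)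

theory Defs
  imports "HOL-Algebra.SimpleGroups" "HOL-Combinatorics.Permutations"
begin

definition pgrp :: "('a \<Rightarrow> 'a) set \<Rightarrow> ('a \<Rightarrow> 'a) monoid" where
  "pgrp G = \<lparr>carrier = G, monoid.mult = (\<circ>), one = id\<rparr>"

(* G is a permutation group on Omega: a group (under composition) of permutations of Omega
   (each fixing every point outside Omega, so the action is faithful) *)
definition perm_group :: "'a set \<Rightarrow> ('a \<Rightarrow> 'a) set \<Rightarrow> bool" where
  "perm_group \<Omega> G \<longleftrightarrow> (\<forall>g\<in>G. g permutes \<Omega>) \<and> group (pgrp G)"

definition transitive_on :: "'a set \<Rightarrow> ('a \<Rightarrow> 'a) set \<Rightarrow> bool" where
  "transitive_on \<Omega> G \<longleftrightarrow> \<Omega> \<noteq> {} \<and> (\<forall>x\<in>\<Omega>. \<forall>y\<in>\<Omega>. \<exists>g\<in>G. g x = y)"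

definition is_block :: "'a set \<Rightarrow> ('a \<Rightarrow> 'a) set \<Rightarrow> 'a set \<Rightarrow> bool" where
  "is_block \<Omega> G B \<longleftrightarrow> B \<subseteq> \<Omega> \<and> (\<forall>g\<in>G. g ` B = B \<or> g ` B \<inter> B = {})"

definition primitive :: "'a set \<Rightarrow> ('a \<Rightarrow> 'a) set \<Rightarrow> bool" where
  "primitive \<Omega> G \<longleftrightarrow> perm_group \<Omega> G \<and> transitive_on \<Omega> G \<and>
     (\<forall>B. is_block \<Omega> G B \<longrightarrow> B = {} \<or> card B = 1 \<or> B = \<Omega>)"

definition stab_orbit :: "('a \<Rightarrow> 'a) set \<Rightarrow> 'a \<Rightarrow> 'a \<Rightarrow> 'a set" where
  "stab_orbit G a x = {g x | g. g \<in> G \<and> g a = a}"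

definition has_subdegree_div :: "'a set \<Rightarrow> ('a \<Rightarrow> 'a) set \<Rightarrow> nat \<Rightarrow> bool" where
  "has_subdegree_div \<Omega> G p \<longleftrightarrow> (\<exists>a\<in>\<Omega>. \<exists>x\<in>\<Omega>. p dvd card (stab_orbit G a x))"

(* T <= G <= Aut(T) for a nonabelian simple group T: T is a nonabelian simple normal
   subgroup of G with trivial centraliser in G (so conjugation embeds G into Aut T) *)
definition almost_simple :: "('a \<Rightarrow> 'a) set \<Rightarrow> bool" where
  "almost_simple G \<longleftrightarrow> group (pgrp G) \<and>
     (\<exists>T. T \<lhd> pgrp G \<and> simple_group (pgrp T) \<and> \<not> comm_group (pgrp T) \<and>
          (\<forall>g\<in>G. (\<forall>t\<in>T. g \<circ> t = t \<circ> g) \<longrightarrow> g = id))"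

definition minimal_normal :: "('a \<Rightarrow> 'a) set \<Rightarrow> ('a \<Rightarrow> 'a) set \<Rightarrow> bool" where
  "minimal_normal G N \<longleftrightarrow> N \<lhd> pgrp G \<and> N \<noteq> {id} \<and>
     (\<forall>M. M \<lhd> pgrp G \<longrightarrow> M \<subseteq> N \<longrightarrow> M = {id} \<or> M = N)"

definition elementary_abelian :: "('a \<Rightarrow> 'a) set \<Rightarrow> bool" where
  "elementary_abelian N \<longleftrightarrow> comm_group (pgrp N) \<and>
     (\<exists>q. prime (q::nat) \<and> (\<forall>n\<in>N. n ^^ q = id))"

definition regular_on :: "'a set \<Rightarrow> ('a \<Rightarrow> 'a) set \<Rightarrow> bool" where
  "regular_on \<Omega> N \<longleftrightarrow> transitive_on \<Omega> N \<and> (\<forall>n\<in>N. \<forall>x\<in>\<Omega>. n x = x \<longrightarrow> n = id)"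

definition affine :: "'a set \<Rightarrow> ('a \<Rightarrow> 'a) set \<Rightarrow> bool" where
  "affine \<Omega> G \<longleftrightarrow> (\<exists>N. (\<forall>M. minimal_normal G M \<longleftrightarrow> M = N) \<and>
      elementary_abelian N \<and> regular_on \<Omega> N)"

(* Delta^k, coordinates indexed by 0..k-1 (coordinate "1" of the paper is index 0) *)
definition cube :: "'b set \<Rightarrow> nat \<Rightarrow> 'b list set" where
  "cube \<Delta> k = {xs. length xs = k \<and> set xs \<subseteq> \<Delta>}"

(* product action of (h_0,...,h_{k-1}; sigma) in Sym(Delta) wr S_k on Delta^k:
   the entry x_i is moved to position sigma i and h_i is applied to it *)
definition prod_act :: "nat \<Rightarrow> (nat \<Rightarrow> 'b \<Rightarrow> 'b) \<Rightarrow> (nat \<Rightarrow> nat) \<Rightarrow> 'b list \<Rightarrow> 'b list" where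
  "prod_act k h \<sigma> xs = map (\<lambda>j. h (Hilbert_Choice.inv \<sigma> j) (xs ! Hilbert_Choice.inv \<sigma> j)) [0..<k]"

definition wr_elt :: "'b set \<Rightarrow> nat \<Rightarrow> (nat \<Rightarrow> 'b \<Rightarrow> 'b) \<Rightarrow> (nat \<Rightarrow> nat) \<Rightarrow> bool" where
  "wr_elt \<Delta> k h \<sigma> \<longleftrightarrow> (\<forall>i<k. h i permutes \<Delta>) \<and> \<sigma> permutes {..<k}"

definition represents :: "'a set \<Rightarrow> 'b set \<Rightarrow> nat \<Rightarrow> ('a \<Rightarrow> 'b list) \<Rightarrow> ('a \<Rightarrow> 'a)
     \<Rightarrow> (nat \<Rightarrow> 'b \<Rightarrow> 'b) \<Rightarrow> (nat \<Rightarrow> nat) \<Rightarrow> bool" where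
  "represents \<Omega> \<Delta> k \<phi> g h \<sigma> \<longleftrightarrow> wr_elt \<Delta> k h \<sigma> \<and> (\<forall>x\<in>\<Omega>. \<phi> (g x) = prod_act k h \<sigma> (\<phi> x))"

definition in_product_action :: "'a set \<Rightarrow> ('a \<Rightarrow> 'a) set \<Rightarrow> 'b set \<Rightarrow> nat \<Rightarrow> ('a \<Rightarrow> 'b list) \<Rightarrow> bool" where
  "in_product_action \<Omega> G \<Delta> k \<phi> \<longleftrightarrow> bij_betw \<phi> \<Omega> (cube \<Delta> k) \<and>
     (\<forall>g\<in>G. \<exists>h \<sigma>. represents \<Omega> \<Delta> k \<phi> g h \<sigma>)"

definition top_group :: "'a set \<Rightarrow> ('a \<Rightarrow> 'a) set \<Rightarrow> 'b set \<Rightarrow> nat \<Rightarrow> ('a \<Rightarrow> 'b list) \<Rightarrow> (nat \<Rightarrow> nat) set" where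
  "top_group \<Omega> G \<Delta> k \<phi> = {\<sigma>. \<exists>g\<in>G. \<exists>h. represents \<Omega> \<Delta> k \<phi> g h \<sigma>}"

definition prim_component :: "'a set \<Rightarrow> ('a \<Rightarrow> 'a) set \<Rightarrow> 'b set \<Rightarrow> nat \<Rightarrow> ('a \<Rightarrow> 'b list) \<Rightarrow> ('b \<Rightarrow> 'b) set" where
  "prim_component \<Omega> G \<Delta> k \<phi> = {h 0 | h. \<exists>g\<in>G. \<exists>\<sigma>. represents \<Omega> \<Delta> k \<phi> g h \<sigma> \<and> \<sigma> 0 = 0}"

end

theory Submission
  imports Defs "HOL-Combinatorics.Perm" "HOL-Algebra.Sylow"
begin

text \<open>
  Suppose that \<open>G\<close> has no subdegree divisible by \<open>p\<close> and let \<open>N\<close> be a minimal normal subgroup. If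
  \<open>N\<close> is abelian, \<open>G\<close> is affine. The recurring contradiction in the other case is that a finite group
  all of whose conjugacy classes have size prime to \<open>p\<close> has central Sylow \<open>p\<close>-subgroups: otherwise it
  would be the union of the conjugates of a proper subgroup. It rules out a nontrivial centraliser of
  \<open>N\<close>, where the point stabiliser \<open>G\<^sub>a\<close> induces all of \<open>Inn N\<close> on the regular normal subgroup \<open>N\<close>.

  Otherwise \<open>N\<close> is the direct product of the \<open>G\<close>-conjugates of a nonabelian simple group \<open>T\<close>, and by
  maximality of \<open>G\<^sub>a\<close> the projection of \<open>N\<^sub>a\<close> to \<open>T\<close> is either \<open>T\<close> or \<open>N\<^sub>a \<inter> T\<close>. In the first case
  the \<open>N\<^sub>a\<close>-orbits on the points \<open>t a\<close> have the sizes of the conjugacy classes of \<open>T\<close>, a contradiction.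
  In the second case \<open>N\<^sub>a\<close> is the product of its intersections with the factors, which gives the
  product action. The orbit under \<open>G\<^sub>a\<close> of a point with prescribed support (the coordinates in which
  it differs from \<open>a\<close>) controls the top group and the subdegrees of the component \<open>H\<close>. If \<open>H\<close> were
  not almost simple, \<open>G\<^sub>a\<close> would again induce all of \<open>Inn T\<close>. The Schreier conjecture is not needed,
  because a component with a regular simple normal subgroup still counts as almost simple.
\<close>

section \<open>Groups of finitely supported permutations\<close>

text \<open>The work is done in the type of finitely supported permutations, where the group laws
  can be used for rewriting and subgroups are plain sets. Groups of functions are reached only as
  homomorphic images: of \<open>G\<close> itself, and of the normaliser of \<open>T\<close>, whose
  action on \<open>\<Delta>\<close> may have a kernel.

  \<open>N\<close> is not constructed as a product. An element of \<open>N\<close> induces on a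
  factor \<open>U\<close> an inner automorphism of \<open>U\<close>; since \<open>U\<close> has
  trivial centre, this singles out one element of \<open>U\<close>, the projection. Projections
  separate elements and can be prescribed at will.

  All coordinates need the same \<open>\<Delta>\<close>. The first coordinate of a point is its
  orbit under the centraliser of \<open>T\<close> in \<open>N\<close>; the others are pulled back to
  it by elements of the stabiliser of \<open>a\<close> carrying \<open>T\<close> to the other
  factors. As these fix \<open>a\<close>, all coordinates of \<open>a\<close> agree, which makes
  supports equivariant.

  Maximality is used as a dichotomy for families of subgroups \<open>X U\<close> of the factors,
  permuted by the stabiliser and containing the projections of \<open>N_stab\<close>. It is applied
  to these projections, to the subgroups \<open>U \<inter> N_stab\<close>, and to the inner
  automorphisms induced by the stabiliser.\<close>

unbundle permutation_syntax

declare perm.left_cancel [simp] perm.right_cancel [simp]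

lemma inverse_mult_cancel [simp]:
  fixes f g :: "'a perm"
  shows "inverse f * (f * g) = g" "f * (inverse f * g) = g"
  by (simp_all flip: mult.assoc)

lemma apply_inverse_cancel [simp]:
  fixes f :: "'a perm"
  shows "inverse f \<langle>$\<rangle> (f \<langle>$\<rangle> x) = x" "f \<langle>$\<rangle> (inverse f \<langle>$\<rangle> x) = x"
  by (simp_all add: apply_sequence)

lemma apply_mult [simp]: "(f * g) \<langle>$\<rangle> x = f \<langle>$\<rangle> (g \<langle>$\<rangle> x)"
  by (simp add: apply_times)

lemma apply_eq_id_iff [simp]: "apply x = id \<longleftrightarrow> x = 1"
  by (metis apply_one apply_inject)

definition subgrp :: "'a perm set \<Rightarrow> bool" where
  "subgrp H \<longleftrightarrow> 1 \<in> H \<and> (\<forall>x\<in>H. \<forall>y\<in>H. x * y \<in> H) \<and> (\<forall>x\<in>H. inverse x \<in> H)"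

lemma subgrpI:
  assumes "1 \<in> H" "\<And>x y. x \<in> H \<Longrightarrow> y \<in> H \<Longrightarrow> x * y \<in> H" "\<And>x. x \<in> H \<Longrightarrow> inverse x \<in> H"
  shows "subgrp H"
  using assms by (auto simp: subgrp_def)

lemma subgrp_one: "subgrp H \<Longrightarrow> 1 \<in> H"
  and subgrp_mult: "subgrp H \<Longrightarrow> x \<in> H \<Longrightarrow> y \<in> H \<Longrightarrow> x * y \<in> H"
  and subgrp_inverse: "subgrp H \<Longrightarrow> x \<in> H \<Longrightarrow> inverse x \<in> H"
  by (auto simp: subgrp_def)

section \<open>Conjugation, centralisers and normal subgroups\<close>

definition conj_by :: "'a perm \<Rightarrow> 'a perm \<Rightarrow> 'a perm" where
  "conj_by g x = g * x * inverse g"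

lemma conj_by_mult: "conj_by g (x * y) = conj_by g x * conj_by g y"
  and conj_by_inverse: "conj_by g (inverse x) = inverse (conj_by g x)"
  and conj_by_by_mult: "conj_by (g * h) x = conj_by g (conj_by h x)"
  by (simp_all add: conj_by_def mult.assoc)

lemma conj_by_one [simp]: "conj_by g 1 = 1" "conj_by 1 x = x"
  by (simp_all add: conj_by_def)

lemma conj_by_cancel [simp]:
  "conj_by (inverse g) (conj_by g x) = x" "conj_by g (conj_by (inverse g) x) = x"
  by (simp_all flip: conj_by_by_mult)

lemma conj_by_eq_iff [simp]: "conj_by g x = conj_by g y \<longleftrightarrow> x = y"
  by (metis conj_by_cancel(1))

lemma conj_by_eq_one_iff [simp]: "conj_by g x = 1 \<longleftrightarrow> x = 1"
  by (metis conj_by_cancel(1) conj_by_one(1))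

lemma conj_by_eq_self_iff: "conj_by g x = x \<longleftrightarrow> g * x = x * g"
  unfolding conj_by_def by (metis inverse_mult_cancel(2) mult.assoc perm.inverse_inverse perm.left_inverse mult_1_right)

lemma conj_by_apply [simp]: "conj_by g x \<langle>$\<rangle> (g \<langle>$\<rangle> a) = g \<langle>$\<rangle> (x \<langle>$\<rangle> a)"
  by (simp add: conj_by_def)

lemma conj_by_mult_self: "conj_by g x * g = g * x"
  by (simp add: conj_by_def mult.assoc)

lemma conj_by_in: "subgrp H \<Longrightarrow> g \<in> H \<Longrightarrow> x \<in> H \<Longrightarrow> conj_by g x \<in> H"
  by (simp add: conj_by_def subgrp_mult subgrp_inverse)

lemma conj_by_image_mult: "conj_by (g * h) ` A = conj_by g ` (conj_by h ` A)"
  by (simp add: image_image conj_by_by_mult)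

lemma conj_by_image_cancel [simp]:
  "conj_by (inverse g) ` (conj_by g ` A) = A" "conj_by g ` (conj_by (inverse g) ` A) = A"
  by (simp_all add: image_image)

lemma subgrp_conj_image: "subgrp H \<Longrightarrow> subgrp (conj_by g ` H)"
  by (rule subgrpI) (auto simp: subgrp_one image_iff subgrp_mult subgrp_inverse
      simp flip: conj_by_mult conj_by_inverse intro: bexI[of _ 1])

definition centraliser :: "'a perm set \<Rightarrow> 'a perm set" where
  "centraliser A = {g. \<forall>x\<in>A. conj_by g x = x}"

lemma centraliserD: "g \<in> centraliser A \<Longrightarrow> x \<in> A \<Longrightarrow> conj_by g x = x"
  by (simp add: centraliser_def)

lemma conj_by_sym: "conj_by g x = x \<longleftrightarrow> conj_by x g = g"
  by (auto simp: conj_by_eq_self_iff)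

lemma subgrp_centraliser: "subgrp (centraliser A)"
proof (rule subgrpI)
  fix x assume "x \<in> centraliser A"
  then show "inverse x \<in> centraliser A"
    unfolding centraliser_def by (auto dest!: bspec) (metis conj_by_cancel(1))
qed (auto simp: centraliser_def conj_by_by_mult)

lemma conj_by_centraliser: "x \<in> centraliser A \<Longrightarrow> conj_by g x \<in> centraliser (conj_by g ` A)"
  by (auto simp: centraliser_def conj_by_def mult.assoc dest!: bspec)
    (metis inverse_mult_cancel(1) mult.assoc)

lemma subgrp_Int: "subgrp A \<Longrightarrow> subgrp B \<Longrightarrow> subgrp (A \<inter> B)"
  by (auto simp: subgrp_def)

definition normal_sub :: "'a perm set \<Rightarrow> 'a perm set \<Rightarrow> bool" where
  "normal_sub M H \<longleftrightarrow> subgrp M \<and> M \<subseteq> H \<and> (\<forall>g\<in>H. \<forall>m\<in>M. conj_by g m \<in> M)"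

lemma normal_subI:
  "subgrp M \<Longrightarrow> M \<subseteq> H \<Longrightarrow> (\<And>g m. g \<in> H \<Longrightarrow> m \<in> M \<Longrightarrow> conj_by g m \<in> M) \<Longrightarrow> normal_sub M H"
  by (auto simp: normal_sub_def)

lemma normal_sub_conj: "normal_sub M H \<Longrightarrow> g \<in> H \<Longrightarrow> m \<in> M \<Longrightarrow> conj_by g m \<in> M"
  by (auto simp: normal_sub_def)

lemma normal_sub_conj_image:
  assumes "normal_sub M H" "subgrp H" "g \<in> H"
  shows "conj_by g ` M = M"
proof -
  have "x \<in> conj_by g ` M" if "x \<in> M" for x
    using normal_sub_conj[OF assms(1) subgrp_inverse[OF assms(2,3)] that]
    by (metis conj_by_cancel(2) imageI)
  then show ?thesis using assms by (auto simp: normal_sub_def)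
qed

text \<open>The commutator of \<open>x\<close> and \<open>y\<close> can be bracketed so as to lie in
  \<open>A\<close> or in \<open>B\<close>, hence it is trivial.\<close>

lemma normal_sub_Int_commute:
  assumes "normal_sub A H" "normal_sub B H" "A \<inter> B = {1}" "x \<in> A" "y \<in> B"
  shows "conj_by x y = y"
proof -
  have "conj_by x y * inverse y \<in> B"
    using assms by (auto simp: normal_sub_def intro!: subgrp_mult subgrp_inverse)
  moreover have "x * conj_by y (inverse x) \<in> A"
    using assms unfolding normal_sub_def by (meson in_mono subgrp_inverse subgrp_mult)
  moreover have "conj_by x y * inverse y = x * conj_by y (inverse x)"
    by (simp add: conj_by_def mult.assoc)
  ultimately have "conj_by x y * inverse y = 1" using assms(3) by auto
  then show ?thesis by (metis inverse_mult_cancel(2) mult.assoc mult_1_right perm.left_inverse mult_1)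
qed

section \<open>Counting\<close>

lemma card_uniform_fibres:
  assumes "finite X" "\<And>x. x \<in> X \<Longrightarrow> card {y \<in> X. f y = f x} = m"
  shows "card X = card (f ` X) * m"
proof -
  have "card X = (\<Sum>z\<in>f ` X. card {y \<in> X. f y = z})"
    using sum.image_gen[OF assms(1), of "\<lambda>_. 1 :: nat" f] by simp
  also have "\<dots> = (\<Sum>z\<in>f ` X. m)"
    by (rule sum.cong) (auto simp: assms(2))
  finally show ?thesis by simp
qed

section \<open>Orbits and their invariant partitions\<close>

definition orb :: "'a perm set \<Rightarrow> 'a \<Rightarrow> 'a set" where
  "orb Q x = (\<lambda>q. q \<langle>$\<rangle> x) ` Q"

lemma orb_self: "subgrp Q \<Longrightarrow> x \<in> orb Q x"
  by (auto simp: orb_def image_iff intro!: bexI[of _ 1] subgrp_one)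

lemma orb_apply: "subgrp Q \<Longrightarrow> y \<in> orb Q x \<Longrightarrow> q \<in> Q \<Longrightarrow> q \<langle>$\<rangle> y \<in> orb Q x"
  by (auto simp: orb_def image_iff) (metis apply_mult subgrp_mult)

lemma orb_eq:
  assumes "subgrp Q" "y \<in> orb Q x"
  shows "orb Q y = orb Q x"
proof -
  obtain q where q: "q \<in> Q" "y = q \<langle>$\<rangle> x" using assms by (auto simp: orb_def)
  have "r \<langle>$\<rangle> x \<in> orb Q y" if "r \<in> Q" for r
    unfolding orb_def using q assms(1) that
    by (intro image_eqI[of _ _ "r * inverse q"]) (auto intro: subgrp_mult subgrp_inverse)
  moreover have "r \<langle>$\<rangle> y \<in> orb Q x" if "r \<in> Q" for r
    unfolding orb_def using q assms(1) that
    by (intro image_eqI[of _ _ "r * q"]) (auto intro: subgrp_mult)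
  ultimately show ?thesis by (auto simp: orb_def)
qed

text \<open>The hypothesis makes the fibres of \<open>f\<close> an invariant partition of the orbit,
  so \<open>Q\<close> permutes them transitively and they have equal size. It is used with
  \<open>f\<close> an orbit of a normal subgroup, a support, or a single coordinate.\<close>

lemma card_orb_fibres:
  assumes Q: "subgrp Q" "finite Q"
    and f: "\<And>q y z. q \<in> Q \<Longrightarrow> y \<in> orb Q x \<Longrightarrow> z \<in> orb Q x \<Longrightarrow> f y = f z \<Longrightarrow> f (q \<langle>$\<rangle> y) = f (q \<langle>$\<rangle> z)"
  shows "card (orb Q x) = card (f ` orb Q x) * card {y \<in> orb Q x. f y = f x}"
proof (rule card_uniform_fibres)
  show "finite (orb Q x)" using Q by (simp add: orb_def)
  fix z assume "z \<in> orb Q x"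
  then obtain q where q: "q \<in> Q" "z = q \<langle>$\<rangle> x" by (auto simp: orb_def)
  have x: "x \<in> orb Q x" using Q(1) by (rule orb_self)
  have iq: "inverse q \<in> Q" using Q(1) q(1) by (rule subgrp_inverse)
  have "{y \<in> orb Q x. f y = f z} = apply q ` {y \<in> orb Q x. f y = f x}"
  proof (intro equalityI subsetI)
    fix y assume y: "y \<in> {y \<in> orb Q x. f y = f z}"
    then have "inverse q \<langle>$\<rangle> y \<in> orb Q x" using orb_apply[OF Q(1) _ iq] by blast
    moreover have "f (inverse q \<langle>$\<rangle> y) = f (inverse q \<langle>$\<rangle> z)"
      using y \<open>z \<in> orb Q x\<close> iq by (intro f) auto
    ultimately show "y \<in> apply q ` {y \<in> orb Q x. f y = f x}"
      using q(2) by (intro image_eqI[of _ _ "inverse q \<langle>$\<rangle> y"]) auto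
  next
    fix y assume "y \<in> apply q ` {y \<in> orb Q x. f y = f x}"
    then obtain w where w: "w \<in> orb Q x" "f w = f x" "y = q \<langle>$\<rangle> w" by auto
    then show "y \<in> {y \<in> orb Q x. f y = f z}"
      using f[OF q(1) w(1) x w(2)] orb_apply[OF Q(1) w(1) q(1)] q(2) by simp
  qed
  then show "card {y \<in> orb Q x. f y = f z} = card {y \<in> orb Q x. f y = f x}"
    by (simp add: card_image inj_on_def apply_inj)
qed

text \<open>The \<open>D\<close>-orbits form an invariant partition of a \<open>Q\<close>-orbit.
  This passes "size prime to \<open>p\<close>" from suborbits down to orbits of normal subgroups of
  the stabiliser.\<close>

lemma card_orb_normal_dvd:
  assumes "normal_sub D Q" "subgrp Q" "finite Q"
  shows "card (orb D x) dvd card (orb Q x)"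
proof -
  have D: "subgrp D" "D \<subseteq> Q" using assms by (auto simp: normal_sub_def)
  have im: "orb D (q \<langle>$\<rangle> y) = apply q ` orb D y" if "q \<in> Q" for q y
  proof -
    have "orb D (q \<langle>$\<rangle> y) = orb (conj_by q ` D) (q \<langle>$\<rangle> y)"
      using normal_sub_conj_image[OF assms(1,2) that] by simp
    then show ?thesis by (simp add: orb_def image_image)
  qed
  have "card (orb Q x) = card (orb D ` orb Q x) * card {y \<in> orb Q x. orb D y = orb D x}"
    using assms(2,3) by (rule card_orb_fibres) (simp add: im)
  moreover have "{y \<in> orb Q x. orb D y = orb D x} = orb D x"
  proof -
    have "orb D x \<subseteq> orb Q x" using D(2) by (auto simp: orb_def)
    then show ?thesis using orb_eq[OF D(1)] orb_self[OF D(1)] by blast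
  qed
  ultimately show ?thesis by simp
qed

text \<open>Double counting of the pairs \<open>(e, c)\<close> with \<open>c \<noteq> 1\<close> in \<open>C\<close>: every nontrivial element of \<open>E\<close>
  is \<open>conj_by e c\<close> for at least \<open>card C\<close> of them.\<close>

lemma conjugates_cover_imp_eq:
  assumes E: "subgrp E" "finite E" and C: "subgrp C" "C \<subseteq> E"
    and cover: "\<And>x. x \<in> E \<Longrightarrow> \<exists>e\<in>E. \<exists>c\<in>C. x = conj_by e c"
  shows "C = E"
proof -
  have finC: "finite C" using E(2) C(2) by (rule finite_subset[rotated])
  define X where "X = E \<times> (C - {1})"
  define f where "f = (\<lambda>(e, c). conj_by e c :: 'a perm)"
  have finX: "finite X" using E(2) finC by (simp add: X_def)
  have im: "f ` X = E - {1}"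
  proof
    show "f ` X \<subseteq> E - {1}" using conj_by_in[OF E(1)] C(2) by (auto simp: X_def f_def)
    show "E - {1} \<subseteq> f ` X"
    proof
      fix x assume x: "x \<in> E - {1}"
      then obtain e c where "e \<in> E" "c \<in> C" "x = conj_by e c" using cover by blast
      then show "x \<in> f ` X" using x by (intro image_eqI[of _ _ "(e, c)"]) (auto simp: X_def f_def)
    qed
  qed
  have fib: "card C \<le> card {y \<in> X. f y = z}" if z: "z \<in> f ` X" for z
  proof -
    obtain e c where ec: "e \<in> E" "c \<in> C" "c \<noteq> 1" "z = conj_by e c"
      using z by (auto simp: X_def f_def)
    have "(\<lambda>d. (e * d, conj_by (inverse d) c)) ` C \<subseteq> {y \<in> X. f y = z}"
    proof (rule image_subsetI)
      fix d assume d: "d \<in> C"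
      then have "e * d \<in> E" "conj_by (inverse d) c \<in> C"
        using ec C E by (blast intro: subgrp_mult conj_by_in subgrp_inverse)+
      then show "(e * d, conj_by (inverse d) c) \<in> {y \<in> X. f y = z}"
        using ec by (simp add: X_def f_def conj_by_by_mult)
    qed
    moreover have "inj_on (\<lambda>d. (e * d, conj_by (inverse d) c)) C"
      by (auto simp: inj_on_def)
    ultimately show ?thesis
      using finX by (intro card_inj_on_le) auto
  qed
  have "card X = (\<Sum>z\<in>f ` X. card {y \<in> X. f y = z})"
    using sum.image_gen[OF finX, of "\<lambda>_. 1 :: nat" f] by simp
  also have "\<dots> \<ge> (\<Sum>z\<in>f ` X. card C)" using fib by (rule sum_mono)
  finally have "card (f ` X) * card C \<le> card X" by simp
  then have "(card E - 1) * card C \<le> card E * (card C - 1)"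
    using im subgrp_one[OF E(1)] subgrp_one[OF C(1)] by (simp add: X_def card_cartesian_product)
  \<comment> \<open>The subtractions are truncated; with both cardinalities positive the inequality
    cancels to \<open>card E \<le> card C\<close>.\<close>
  moreover have "card E > 0" "card C > 0"
    using subgrp_one[OF E(1)] subgrp_one[OF C(1)] E(2) finC by (auto simp: card_gt_0_iff)
  ultimately have "card E \<le> card C"
    by (cases "card E"; cases "card C") (auto simp: algebra_simps)
  then show ?thesis using C(2) E(2) by (metis card_seteq)
qed

text \<open>The fixed point principle for \<open>p\<close>-groups: an orbit without fixed point has
  size a proper power of \<open>p\<close>, so without fixed points \<open>p\<close> would divide
  \<open>card A\<close>. Orbits are written out here because \<open>orb\<close> concerns the action
  on points, not conjugation.\<close>

lemma prime_power_group_fixes: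
  fixes A :: "'a perm set"
  assumes P: "subgrp P" "card P = p ^ b" "prime p" and A: "finite A" "\<not> p dvd card A"
    and inv: "\<And>g x. g \<in> P \<Longrightarrow> x \<in> A \<Longrightarrow> conj_by g x \<in> A"
  shows "\<exists>x\<in>A. \<forall>g\<in>P. conj_by g x = x"
proof (rule ccontr)
  assume no: "\<not> ?thesis"
  have finP: "finite P" using P(2,3) by (metis card.infinite not_prime_0 power_not_zero)
  define f where "f = (\<lambda>x. (\<lambda>g. conj_by g x) ` P)"
  have mem: "x \<in> f x" for x
    using subgrp_one[OF P(1)] by (auto simp: f_def image_iff intro!: bexI[of _ 1])
  have eq: "f y = f x" if y: "y \<in> f x" for x y
  proof -
    obtain q where q: "q \<in> P" "y = conj_by q x" using y by (auto simp: f_def)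
    have "conj_by r x \<in> f y" if "r \<in> P" for r
      unfolding f_def using q P(1) that
      by (intro image_eqI[of _ _ "r * inverse q"])
        (auto simp: conj_by_by_mult intro: subgrp_mult subgrp_inverse)
    moreover have "conj_by r y \<in> f x" if "r \<in> P" for r
      unfolding f_def using q P(1) that
      by (intro image_eqI[of _ _ "r * q"]) (auto simp: conj_by_by_mult intro: subgrp_mult)
    ultimately show ?thesis by (auto simp: f_def)
  qed
  have sub: "f x \<subseteq> A" if "x \<in> A" for x using that inv by (auto simp: f_def)
  have dvd: "p dvd card (f x)" if x: "x \<in> A" for x
  proof -
    have "card P = card (f x) * card {g \<in> P. conj_by g x = x}"
      unfolding f_def
    proof (rule card_uniform_fibres[OF finP])
      fix h assume h: "h \<in> P"
      have "{g \<in> P. conj_by g x = conj_by h x} = (*) h ` {g \<in> P. conj_by g x = x}"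
      proof (intro equalityI subsetI)
        fix g assume "g \<in> {g \<in> P. conj_by g x = conj_by h x}"
        then show "g \<in> (*) h ` {g \<in> P. conj_by g x = x}"
          using h P(1) by (intro image_eqI[of _ _ "inverse h * g"])
            (auto simp: conj_by_by_mult subgrp_mult subgrp_inverse)
      qed (use h P(1) in \<open>auto simp: conj_by_by_mult subgrp_mult\<close>)
      then show "card {g \<in> P. conj_by g x = conj_by h x} = card {g \<in> P. conj_by g x = x}"
        by (simp add: card_image inj_on_def)
    qed
    then have "card (f x) dvd p ^ b" using P(2) by simp
    moreover have "card (f x) \<noteq> 1"
    proof
      assume "card (f x) = 1"
      then have "f x = {x}" using mem[of x] by (auto simp: card_1_singleton_iff)
      then show False using no x by (auto simp: f_def)
    qed
    ultimately show ?thesis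
      using P(3) by (metis divides_primepow_nat dvd_power gr0I power_0)
  qed
  have "card A = (\<Sum>z\<in>f ` A. card {y \<in> A. f y = z})"
    using sum.image_gen[OF A(1), of "\<lambda>_. 1 :: nat" f] by simp
  moreover have "{y \<in> A. f y = f x} = f x" if "x \<in> A" for x
    using that mem eq sub by blast
  ultimately have "p dvd card A" using dvd by (auto intro!: dvd_sum)
  then show False using A(2) by simp
qed

text \<open>If \<open>P\<close> were not central, then \<open>E\<close> would be covered by the conjugates of the proper subgroup
  of elements of \<open>E\<close> commuting with \<open>P\<close>.\<close>

lemma prime_power_subgrp_central:
  assumes E: "subgrp E" "finite E" and P: "subgrp P" "P \<subseteq> E" "card P = p ^ b" "prime p"
    and cls: "\<And>x. x \<in> E \<Longrightarrow> \<not> p dvd card ((\<lambda>s. conj_by s x) ` E)"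
    and "g \<in> P" "x \<in> E"
  shows "conj_by g x = x"
proof -
  define C where "C = E \<inter> centraliser P"
  have "C = E"
  proof (rule conjugates_cover_imp_eq[OF E])
    show "subgrp C" unfolding C_def using E(1) subgrp_centraliser by (rule subgrp_Int)
    show "C \<subseteq> E" by (auto simp: C_def)
    fix x assume x: "x \<in> E"
    \<comment> \<open>\<open>P\<close> acts by conjugation on the class of \<open>x\<close>, whose
      size is prime to \<open>p\<close>, so it fixes some conjugate of \<open>x\<close>. That
      conjugate lies in \<open>C\<close>.\<close>
    have "\<exists>y\<in>(\<lambda>s. conj_by s x) ` E. \<forall>g\<in>P. conj_by g y = y"
    proof (rule prime_power_group_fixes[OF P(1,3,4) _ cls[OF x]])
      show "finite ((\<lambda>s. conj_by s x) ` E)" using E(2) by simp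
      fix g y assume "g \<in> P" "y \<in> (\<lambda>s. conj_by s x) ` E"
      then show "conj_by g y \<in> (\<lambda>s. conj_by s x) ` E"
        using P(2) E(1) by (auto simp flip: conj_by_by_mult intro!: imageI subgrp_mult)
    qed
    then obtain e where e: "e \<in> E" "\<forall>g\<in>P. conj_by g (conj_by e x) = conj_by e x" by auto
    then have "conj_by e x \<in> C" using E(1) x
      by (auto simp: C_def centraliser_def conj_by_in conj_by_sym)
    moreover have "x = conj_by (inverse e) (conj_by e x)" by simp
    ultimately show "\<exists>e\<in>E. \<exists>c\<in>C. x = conj_by e c" using e(1) E(1) subgrp_inverse by blast
  qed
  then have "x \<in> centraliser P" using assms by (auto simp: C_def)
  then show ?thesis using \<open>g \<in> P\<close> by (simp add: centraliser_def conj_by_sym)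
qed

lemma exists_prime_power_subgrp:
  fixes E :: "'a perm set"
  assumes E: "subgrp E" "finite E" and p: "prime p" "p dvd card E"
  obtains P b where "subgrp P" "P \<subseteq> E" "card P = p ^ b" "P \<noteq> {1}"
proof -
  define M where "M = \<lparr>carrier = E, monoid.mult = (*), one = 1 :: 'a perm\<rparr>"
  have M: "group M"
  proof (rule groupI)
    fix x assume "x \<in> carrier M"
    then show "\<exists>y\<in>carrier M. y \<otimes>\<^bsub>M\<^esub> x = \<one>\<^bsub>M\<^esub>"
      using subgrp_inverse[OF E(1)] by (auto simp: M_def intro!: bexI[of _ "inverse x"])
  qed (use E in \<open>simp_all add: M_def mult.assoc subgrp_one subgrp_mult\<close>)
  \<comment> \<open>Sylow's theorem with exponent 1, where the cofactor \<open>m\<close> may again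
    be divisible by \<open>p\<close>; this is Cauchy's theorem.\<close>
  obtain m where "card E = p ^ 1 * m" using p(2) by (auto elim: dvdE)
  then obtain P where P: "subgroup P M" "card P = p ^ 1"
    using sylow_thm[OF p(1) M, of 1 m] E(2) by (auto simp: Coset.order_def M_def)
  have inv: "inv\<^bsub>M\<^esub> x = inverse x" if "x \<in> E" for x
    by (rule group.inv_equality[OF M]) (use that E in \<open>auto simp: M_def subgrp_inverse\<close>)
  show thesis
  proof
    show "P \<subseteq> E" using subgroup.subset[OF P(1)] by (simp add: M_def)
    show "subgrp P"
    proof (rule subgrpI)
      show "1 \<in> P" using subgroup.one_closed[OF P(1)] by (simp add: M_def)
      fix x assume x: "x \<in> P"
      show "inverse x \<in> P" using subgroup.m_inv_closed[OF P(1) x] inv x \<open>P \<subseteq> E\<close> by auto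
      fix y assume "y \<in> P"
      then show "x * y \<in> P" using subgroup.m_closed[OF P(1) x] by (simp add: M_def)
    qed
    show "card P = p ^ 1" by (fact P(2))
    show "P \<noteq> {1}" using P(2) p(1) by auto
  qed
qed

lemma orbit_stabiliser:
  assumes Q: "subgrp Q" "finite Q"
  shows "card Q = card (orb Q x) * card {q \<in> Q. q \<langle>$\<rangle> x = x}"
  unfolding orb_def
proof (rule card_uniform_fibres[OF Q(2)])
  fix h assume h: "h \<in> Q"
  have "{g \<in> Q. g \<langle>$\<rangle> x = h \<langle>$\<rangle> x} = (*) h ` {g \<in> Q. g \<langle>$\<rangle> x = x}"
  proof (intro equalityI subsetI)
    fix g assume "g \<in> {g \<in> Q. g \<langle>$\<rangle> x = h \<langle>$\<rangle> x}"
    then show "g \<in> (*) h ` {g \<in> Q. g \<langle>$\<rangle> x = x}"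
      using h Q(1) by (intro image_eqI[of _ _ "inverse h * g"]) (auto simp: subgrp_mult subgrp_inverse)
  qed (use h Q(1) in \<open>auto simp: subgrp_mult\<close>)
  then show "card {g \<in> Q. g \<langle>$\<rangle> x = h \<langle>$\<rangle> x} = card {g \<in> Q. g \<langle>$\<rangle> x = x}"
    by (simp add: card_image inj_on_def)
qed

section \<open>Homomorphisms between permutation groups\<close>

lemma hom_one_inverse:
  fixes h :: "'a perm \<Rightarrow> 'b perm"
  assumes P: "subgrp P" and h: "\<And>x y. x \<in> P \<Longrightarrow> y \<in> P \<Longrightarrow> h (x * y) = h x * h y"
  shows "h 1 = 1" and "x \<in> P \<Longrightarrow> h (inverse x) = inverse (h x)"
proof -
  have "h 1 * h 1 = h 1 * 1" using h[of 1 1] subgrp_one[OF P] by simp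
  then show one: "h 1 = 1" by (simp only: perm.left_cancel)
  assume x: "x \<in> P"
  have "h x * h (inverse x) = h x * inverse (h x)"
    using h[OF x subgrp_inverse[OF P x]] one by simp
  then show "h (inverse x) = inverse (h x)" by (simp only: perm.left_cancel)
qed

lemma subgrp_hom_image:
  fixes h :: "'a perm \<Rightarrow> 'b perm"
  assumes P: "subgrp P" and h: "\<And>x y. x \<in> P \<Longrightarrow> y \<in> P \<Longrightarrow> h (x * y) = h x * h y"
  shows "subgrp (h ` P)"
proof (rule subgrpI)
  note hom = hom_one_inverse[OF P h]
  show "1 \<in> h ` P" using hom(1) subgrp_one[OF P] by (metis imageI)
next
  fix x y assume "x \<in> h ` P" "y \<in> h ` P"
  then obtain m n where mn: "m \<in> P" "n \<in> P" "x = h m" "y = h n" by auto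
  then show "x * y \<in> h ` P" using subgrp_mult[OF P mn(1,2)] by (simp flip: h)
next
  fix x assume "x \<in> h ` P"
  then obtain m where m: "m \<in> P" "x = h m" by auto
  then show "inverse x \<in> h ` P"
    using hom_one_inverse(2)[OF P h m(1)] subgrp_inverse[OF P m(1)] by (metis imageI)
qed

text \<open>All fibres are cosets of the kernel. The purpose is to keep the order a power of
  \<open>p\<close> when a \<open>p\<close>-subgroup of \<open>N\<close> is projected to a
  factor.\<close>

lemma card_hom_image_dvd:
  fixes h :: "'a perm \<Rightarrow> 'b perm"
  assumes P: "subgrp P" "finite P" and h: "\<And>x y. x \<in> P \<Longrightarrow> y \<in> P \<Longrightarrow> h (x * y) = h x * h y"
  shows "card (h ` P) dvd card P"
proof -
  have "card P = card (h ` P) * card {n \<in> P. h n = 1}"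
  proof (rule card_uniform_fibres[OF P(2)])
    fix m assume m: "m \<in> P"
    have "{n \<in> P. h n = h m} = (*) m ` {n \<in> P. h n = 1}"
    proof (intro equalityI subsetI)
      fix n assume n: "n \<in> {n \<in> P. h n = h m}"
      then have "h (inverse m * n) = 1"
        using m h[of "inverse m" n] hom_one_inverse(2)[OF P(1) h m] subgrp_inverse[OF P(1) m] by simp
      then show "n \<in> (*) m ` {n \<in> P. h n = 1}"
        using m n P(1) by (intro image_eqI[of _ _ "inverse m * n"]) (auto simp: subgrp_mult subgrp_inverse)
    next
      fix n assume "n \<in> (*) m ` {n \<in> P. h n = 1}"
      then obtain l where l: "l \<in> P" "h l = 1" "n = m * l" by auto
      then show "n \<in> {n \<in> P. h n = h m}" using m h[of m l] subgrp_mult[OF P(1) m l(1)] by simp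
    qed
    then show "card {n \<in> P. h n = h m} = card {n \<in> P. h n = 1}" by (simp add: card_image inj_on_def)
  qed
  then show ?thesis by simp
qed

section \<open>Images in groups of functions\<close>

text \<open>The bridge to the groups of functions in the theorem, instantiated by
  \<open>apply\<close> on the whole group and by \<open>bar\<close> on the normaliser of
  \<open>T\<close>. Composition of functions is only a monoid, so \<open>f 1 = id\<close> does not
  follow from multiplicativity. Injectivity is not assumed because \<open>bar\<close> may have a
  kernel.\<close>

locale perm_hom =
  fixes \<Gamma> :: "'a perm set" and f :: "'a perm \<Rightarrow> 'b \<Rightarrow> 'b"
  assumes subgrp: "subgrp \<Gamma>"
    and hom: "x \<in> \<Gamma> \<Longrightarrow> y \<in> \<Gamma> \<Longrightarrow> f (x * y) = f x \<circ> f y"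
    and hom_one: "f 1 = id"
begin

lemma hom_inverse: "x \<in> \<Gamma> \<Longrightarrow> f (inverse x) \<circ> f x = id" "x \<in> \<Gamma> \<Longrightarrow> f x \<circ> f (inverse x) = id"
  using hom[of "inverse x" x] hom[of x "inverse x"] hom_one subgrp_inverse[OF subgrp, of x] by auto

lemma group_image:
  assumes S: "subgrp S" "S \<subseteq> \<Gamma>"
  shows "group (pgrp (f ` S))"
proof (rule groupI)
  fix x assume "x \<in> carrier (pgrp (f ` S))"
  then obtain s where s: "s \<in> S" "x = f s" by (auto simp: pgrp_def)
  then have "f (inverse s) \<circ> f s = id"
    using hom_inverse S by auto
  then show "\<exists>y\<in>carrier (pgrp (f ` S)). y \<otimes>\<^bsub>pgrp (f ` S)\<^esub> x = \<one>\<^bsub>pgrp (f ` S)\<^esub>"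
    using s subgrp_inverse[OF S(1)] by (auto simp: pgrp_def)
next
  fix x y assume "x \<in> carrier (pgrp (f ` S))" "y \<in> carrier (pgrp (f ` S))"
  then obtain s t where "s \<in> S" "x = f s" "t \<in> S" "y = f t" by (auto simp: pgrp_def)
  then show "x \<otimes>\<^bsub>pgrp (f ` S)\<^esub> y \<in> carrier (pgrp (f ` S))"
    using S subgrp_mult[OF S(1), of s t] subsetD[OF S(2), of s] subsetD[OF S(2), of t]
    by (auto simp: pgrp_def simp flip: hom)
next
  show "\<one>\<^bsub>pgrp (f ` S)\<^esub> \<in> carrier (pgrp (f ` S))"
    using hom_one subgrp_one[OF S(1)] by (force simp: pgrp_def)
qed (auto simp: pgrp_def)

lemma inv_image:
  assumes S: "subgrp S" "S \<subseteq> \<Gamma>" and s: "s \<in> S"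
  shows "inv\<^bsub>pgrp (f ` S)\<^esub> (f s) = f (inverse s)"
proof (rule group.inv_equality[OF group_image[OF S]])
  show "f (inverse s) \<otimes>\<^bsub>pgrp (f ` S)\<^esub> f s = \<one>\<^bsub>pgrp (f ` S)\<^esub>"
    using hom_inverse S s by (auto simp: pgrp_def)
qed (use S s subgrp_inverse in \<open>auto simp: pgrp_def\<close>)

lemma conj_image:
  assumes "g \<in> \<Gamma>" "x \<in> \<Gamma>"
  shows "f g \<circ> f x \<circ> f (inverse g) = f (conj_by g x)"
  using assms subgrp by (simp add: conj_by_def hom subgrp_mult subgrp_inverse)

lemma normal_image:
  assumes S: "subgrp S" "S \<subseteq> \<Gamma>" and M: "normal_sub M S"
  shows "f ` M \<lhd> pgrp (f ` S)"
proof -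
  interpret group "pgrp (f ` S)" using S by (rule group_image)
  have M': "subgrp M" "M \<subseteq> S" using M by (auto simp: normal_sub_def)
  show ?thesis
  proof (rule normal_invI)
    show "subgroup (f ` M) (pgrp (f ` S))"
    proof (rule subgroupI)
      show "f ` M \<subseteq> carrier (pgrp (f ` S))" using M' by (auto simp: pgrp_def)
      show "f ` M \<noteq> {}" using subgrp_one[OF M'(1)] by auto
      fix x assume "x \<in> f ` M"
      then obtain m where m: "m \<in> M" "x = f m" by auto
      then show "inv\<^bsub>pgrp (f ` S)\<^esub> x \<in> f ` M"
        using inv_image[OF S, of m] M' subgrp_inverse[OF M'(1)] by auto
      fix y assume "y \<in> f ` M"
      then obtain n where n: "n \<in> M" "y = f n" by auto
      then have "f (m * n) = f m \<circ> f n" using m n M' S by (intro hom) auto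
      then show "x \<otimes>\<^bsub>pgrp (f ` S)\<^esub> y \<in> f ` M"
        using m n subgrp_mult[OF M'(1), of m n] by (auto simp: pgrp_def simp flip: \<open>f (m * n) = f m \<circ> f n\<close>)
    qed
    fix x h assume "x \<in> carrier (pgrp (f ` S))" "h \<in> f ` M"
    then obtain s m where sm: "s \<in> S" "x = f s" "m \<in> M" "h = f m" by (auto simp: pgrp_def)
    have "f s \<circ> f m \<circ> f (inverse s) = f (conj_by s m)"
      using sm M' S by (intro conj_image) auto
    then show "x \<otimes>\<^bsub>pgrp (f ` S)\<^esub> h \<otimes>\<^bsub>pgrp (f ` S)\<^esub> inv\<^bsub>pgrp (f ` S)\<^esub> x \<in> f ` M"
      using sm inv_image[OF S, of s] normal_sub_conj[OF M, of s m] by (auto simp: pgrp_def)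
  qed
qed

lemma normal_preimage:
  assumes S: "subgrp S" "S \<subseteq> \<Gamma>" and M: "M \<lhd> pgrp (f ` S)"
  shows "normal_sub {x \<in> S. f x \<in> M} S" and "f ` {x \<in> S. f x \<in> M} = M"
proof -
  interpret group "pgrp (f ` S)" using S by (rule group_image)
  have sub: "subgroup M (pgrp (f ` S))" using M by (rule normal_imp_subgroup)
  show "f ` {x \<in> S. f x \<in> M} = M" using subgroup.subset[OF sub] by (auto simp: pgrp_def)
  show "normal_sub {x \<in> S. f x \<in> M} S"
  proof (intro normal_subI subgrpI)
    show "1 \<in> {x \<in> S. f x \<in> M}"
      using subgroup.one_closed[OF sub] S by (simp add: pgrp_def hom_one subgrp_one)
  next
    fix x y assume "x \<in> {x \<in> S. f x \<in> M}" "y \<in> {x \<in> S. f x \<in> M}"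
    then show "x * y \<in> {x \<in> S. f x \<in> M}"
      using subgroup.m_closed[OF sub, of "f x" "f y"] S(1) subsetD[OF S(2), of x] subsetD[OF S(2), of y]
      by (auto simp: pgrp_def subgrp_mult hom)
  next
    fix x assume "x \<in> {x \<in> S. f x \<in> M}"
    then show "inverse x \<in> {x \<in> S. f x \<in> M}"
      using subgroup.m_inv_closed[OF sub, of "f x"] S inv_image[OF S, of x]
      by (auto simp: subgrp_inverse)
  next
    fix g m assume gm: "g \<in> S" "m \<in> {x \<in> S. f x \<in> M}"
    have "f (conj_by g m) = f g \<circ> f m \<circ> f (inverse g)"
      using gm S by (intro conj_image[symmetric]) auto
    then show "conj_by g m \<in> {x \<in> S. f x \<in> M}"
      using normal_invE(2)[OF M, of "f g" "f m"] gm S inv_image[OF S, of g] conj_by_in[of S g m]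
      by (auto simp: pgrp_def)
  qed auto
qed

lemma almost_simple_image:
  assumes T: "normal_sub T \<Gamma>" "finite T"
    and inj: "\<And>t. t \<in> T \<Longrightarrow> f t = id \<Longrightarrow> t = 1"
    and nonab: "\<not> T \<subseteq> centraliser T"
    and simple: "\<And>M. normal_sub M T \<Longrightarrow> M = {1} \<or> M = T"
    and cent: "\<And>u. u \<in> \<Gamma> \<Longrightarrow> u \<in> centraliser T \<Longrightarrow> f u = id"
  shows "almost_simple (f ` \<Gamma>)"
proof -
  have sub: "subgrp T" "T \<subseteq> \<Gamma>" using T by (auto simp: normal_sub_def)
  have commute: "conj_by u t = t" if ut: "u \<in> \<Gamma>" "t \<in> T" "f u \<circ> f t = f t \<circ> f u" for u t
  proof -
    have t: "t \<in> \<Gamma>" using ut(2) sub(2) by auto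
    have mem: "conj_by u t * inverse t \<in> T"
      using normal_sub_conj[OF T(1) ut(1,2)] ut sub by (auto intro: subgrp_mult subgrp_inverse)
    have c\<Gamma>: "conj_by u t \<in> \<Gamma>" using subgrp ut(1) t by (rule conj_by_in)
    have it: "inverse t \<in> \<Gamma>" and iu: "inverse u \<in> \<Gamma>" using subgrp t ut(1) by (auto intro: subgrp_inverse)
    have "f (conj_by u t * inverse t) = f (conj_by u t) \<circ> f (inverse t)"
      using c\<Gamma> it by (rule hom)
    also have "f (conj_by u t) = f t \<circ> f u \<circ> f (inverse u)"
      using conj_image[OF ut(1) t] ut(3) by simp
    also have "\<dots> = f t" using hom[OF ut(1) iu] by (simp add: hom_one comp_assoc)
    also have "f t \<circ> f (inverse t) = id" using hom[OF t it] by (simp add: hom_one)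
    finally have "conj_by u t * inverse t = 1" using inj mem by blast
    then show ?thesis by (metis conj_by_mult_self conj_by_def inverse_mult_cancel(2) mult.assoc mult_1_right perm.left_inverse mult_1)
  qed
  have inj': "inj_on f T"
  proof (rule inj_onI)
    fix s t assume st: "s \<in> T" "t \<in> T" "f s = f t"
    have "f (inverse s * t) = f (inverse s) \<circ> f s"
      using st sub subgrp_inverse[OF sub(1), of s] by (subst hom) auto
    also have "\<dots> = id" using hom_inverse(1)[of s] st sub by auto
    finally have "inverse s * t = 1" using inj st sub by (metis subgrp_inverse subgrp_mult)
    then show "s = t" by (metis inverse_mult_cancel(2) mult_1_right)
  qed
  obtain s t where st: "s \<in> T" "t \<in> T" "conj_by s t \<noteq> t" using nonab by (auto simp: centraliser_def)
  interpret T: group "pgrp (f ` T)" using sub by (rule group_image)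
  have "simple_group (pgrp (f ` T))"
  proof
    have "s \<noteq> t" using st(3) by (auto simp: conj_by_def mult.assoc)
    then have "card {s, t} = 2" by simp
    moreover have "card {s, t} \<le> card T" using st T(2) by (intro card_mono) auto
    ultimately show "1 < Coset.order (pgrp (f ` T))"
      using card_image[OF inj'] by (simp add: pgrp_def Coset.order_def)
    fix H assume "H \<lhd> pgrp (f ` T)"
    note pre = normal_preimage[OF sub this]
    have "f ` {x \<in> T. f x \<in> H} = f ` {1} \<or> f ` {x \<in> T. f x \<in> H} = f ` T"
      using simple[OF pre(1)] by (auto simp only: simp_thms)
    then have "H = f ` {1} \<or> H = f ` T" by (simp only: pre(2))
    then show "H = carrier (pgrp (f ` T)) \<or> H = {\<one>\<^bsub>pgrp (f ` T)\<^esub>}"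
      by (auto simp: pgrp_def hom_one)
  qed
  moreover have "\<not> comm_group (pgrp (f ` T))"
  proof
    assume "comm_group (pgrp (f ` T))"
    then have "f s \<circ> f t = f t \<circ> f s"
      using comm_groupE(4)[of "pgrp (f ` T)" "f s" "f t"] st by (simp add: pgrp_def)
    then show False using commute[of s t] st sub by auto
  qed
  moreover have "\<forall>g\<in>f ` \<Gamma>. (\<forall>t\<in>f ` T. g \<circ> t = t \<circ> g) \<longrightarrow> g = id"
    using commute cent by (auto simp: centraliser_def)
  ultimately show ?thesis unfolding almost_simple_def
    using group_image[OF subgrp] normal_image[OF subgrp _ T(1)] by blast
qed

end

section \<open>Minimal normal subgroups\<close>

definition min_normal :: "'a perm set \<Rightarrow> 'a perm set \<Rightarrow> bool" where
  "min_normal N H \<longleftrightarrow> normal_sub N H \<and> N \<noteq> {1} \<and>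
     (\<forall>M. normal_sub M H \<longrightarrow> M \<subseteq> N \<longrightarrow> M = {1} \<or> M = N)"

lemma min_normalD:
  assumes "min_normal N H"
  shows "normal_sub N H" "N \<noteq> {1}" "subgrp N" "N \<subseteq> H"
    and "\<And>M. normal_sub M H \<Longrightarrow> M \<subseteq> N \<Longrightarrow> M \<noteq> {1} \<Longrightarrow> M = N"
  using assms by (auto simp: min_normal_def normal_sub_def)

lemma exists_min_normal:
  assumes "subgrp H" "finite H" "H \<noteq> {1}"
  obtains N where "min_normal N H"
proof -
  define F where "F = {N. normal_sub N H \<and> N \<noteq> {1}}"
  have "F \<subseteq> Pow H" by (auto simp: F_def normal_sub_def)
  then have "finite F" using assms(2) by (meson finite_Pow_iff finite_subset)
  moreover have "H \<in> F" using assms by (auto simp: F_def normal_sub_def intro: conj_by_in)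
  ultimately obtain N where "N \<in> F" and min: "\<And>M. M \<in> F \<Longrightarrow> M \<subseteq> N \<Longrightarrow> N = M"
    using finite_has_minimal[of F] by blast
  then have "min_normal N H" unfolding min_normal_def F_def by blast
  then show thesis by (rule that)
qed

lemma normal_sub_centraliser:
  assumes "normal_sub N H" "subgrp H"
  shows "normal_sub (H \<inter> centraliser N) H"
proof (rule normal_subI)
  show "subgrp (H \<inter> centraliser N)" using assms(2) subgrp_centraliser by (rule subgrp_Int)
  fix g m assume g: "g \<in> H" and m: "m \<in> H \<inter> centraliser N"
  then show "conj_by g m \<in> H \<inter> centraliser N"
    using conj_by_centraliser[of m N g] normal_sub_conj_image[OF assms g] conj_by_in[OF assms(2)] by auto
qed auto

lemma normal_sub_Int: "normal_sub A H \<Longrightarrow> normal_sub B H \<Longrightarrow> normal_sub (A \<inter> B) H"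
  by (auto simp: normal_sub_def intro: subgrp_Int)

lemma normal_sub_conj_sub:
  assumes "normal_sub M H"
  shows "normal_sub (conj_by g ` M) (conj_by g ` H)"
proof (rule normal_subI)
  show "subgrp (conj_by g ` M)" "conj_by g ` M \<subseteq> conj_by g ` H"
    using assms by (auto simp: normal_sub_def intro: subgrp_conj_image)
  fix x m assume "x \<in> conj_by g ` H" "m \<in> conj_by g ` M"
  then obtain h n where hn: "h \<in> H" "x = conj_by g h" "n \<in> M" "m = conj_by g n" by auto
  have "conj_by x m = conj_by g (conj_by h n)"
    unfolding hn by (simp add: conj_by_def mult.assoc)
  then show "conj_by x m \<in> conj_by g ` M" using normal_sub_conj[OF assms hn(1,3)] by simp
qed

lemma min_normal_conj:
  assumes "min_normal M H"
  shows "min_normal (conj_by g ` M) (conj_by g ` H)"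
proof -
  note M = min_normalD[OF assms]
  have "K = {1} \<or> K = conj_by g ` M"
    if K: "normal_sub K (conj_by g ` H)" "K \<subseteq> conj_by g ` M" for K
  proof -
    have "normal_sub (conj_by (inverse g) ` K) H"
      using normal_sub_conj_sub[OF K(1), of "inverse g"] by simp
    moreover have "conj_by (inverse g) ` K \<subseteq> M" using K(2) by auto
    ultimately have "conj_by (inverse g) ` K = {1} \<or> conj_by (inverse g) ` K = M" using M(5) by blast
    then have "conj_by g ` conj_by (inverse g) ` K = conj_by g ` {1} \<or>
        conj_by g ` conj_by (inverse g) ` K = conj_by g ` M" by (auto simp only: simp_thms)
    then show ?thesis by simp
  qed
  moreover have "conj_by g ` M \<noteq> {1}"
  proof
    assume "conj_by g ` M = {1}"
    then have "conj_by (inverse g) ` conj_by g ` M = conj_by (inverse g) ` {1}" by simp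
    then show False using M(2) by simp
  qed
  ultimately show ?thesis using normal_sub_conj_sub[OF M(1)] by (auto simp: min_normal_def)
qed

lemma power_mult_commuting:
  fixes x y :: "'a::monoid_mult"
  assumes "x * y = y * x"
  shows "(x * y) ^ n = x ^ n * y ^ n"
proof (induction n)
  case (Suc n)
  have "y * x ^ n = x ^ n * y"
    using power_commuting_commutes[of x y n] assms by simp
  then show ?case using Suc by (simp add: mult.assoc) (metis mult.assoc)
qed simp

lemma conj_by_power: "conj_by g x ^ n = conj_by g (x ^ n)"
  by (induction n) (simp_all add: conj_by_mult)

lemma exists_prime_order:
  fixes x :: "'a perm"
  assumes "subgrp H" "finite H" "x \<in> H" "x \<noteq> 1"
  obtains q y where "prime (q::nat)" "y \<in> H" "y \<noteq> 1" "y ^ q = 1"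
proof -
  have pow: "x ^ n \<in> H" for n using assms by (induction n) (auto intro: subgrp_one subgrp_mult)
  then have "\<not> inj (\<lambda>n. x ^ n)" using assms(2) by (meson finite_imageD finite_subset image_subsetI infinite_UNIV_nat)
  then obtain i j where ij: "i < j" "x ^ i = x ^ j"
    unfolding inj_on_def by (metis UNIV_I linorder_neqE_nat)
  have "x ^ j = x ^ i * x ^ (j - i)" using ij(1) by (simp flip: power_add)
  then have "x ^ i * x ^ (j - i) = x ^ i * 1" using ij(2) by simp
  then have "x ^ (j - i) = 1" by (simp only: perm.left_cancel)
  then have ex: "\<exists>m. m > 0 \<and> x ^ m = 1" using ij(1) by (intro exI[of _ "j - i"]) auto
  define m where "m = (LEAST m. m > 0 \<and> x ^ m = 1)"
  have m: "m > 0" "x ^ m = 1" using LeastI_ex[OF ex] by (auto simp: m_def)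
  have least: "x ^ l \<noteq> 1" if "0 < l" "l < m" for l
    using not_less_Least[of l "\<lambda>m. m > 0 \<and> x ^ m = 1"] that by (auto simp: m_def)
  have "m \<noteq> 1" using m(2) assms(4) by auto
  then obtain q where q: "prime q" "q dvd m" using prime_factor_nat by blast
  then obtain l where l: "m = q * l" by (auto elim: dvdE)
  have "l < m" "l > 0" using l m(1) prime_gt_1_nat[OF q(1)] by auto
  then have "x ^ l \<noteq> 1" using least by blast
  moreover have "(x ^ l) ^ q = 1" using m(2) l by (simp add: mult.commute flip: power_mult)
  ultimately show thesis using that q(1) pow by blast
qed

section \<open>Primitive groups\<close>

locale prim_group =
  fixes \<Omega> :: "'a set" and G :: "'a perm set"
  assumes finite_space: "finite \<Omega>"
    and subgrp_G: "subgrp G"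
    and affected_sub: "g \<in> G \<Longrightarrow> affected g \<subseteq> \<Omega>"
    and transitive: "x \<in> \<Omega> \<Longrightarrow> y \<in> \<Omega> \<Longrightarrow> \<exists>g\<in>G. g \<langle>$\<rangle> x = y"
    and block: "B \<subseteq> \<Omega> \<Longrightarrow> (\<And>g. g \<in> G \<Longrightarrow> apply g ` B = B \<or> apply g ` B \<inter> B = {})
                  \<Longrightarrow> B = {} \<or> card B = 1 \<or> B = \<Omega>"
begin

lemma apply_in: "g \<in> G \<Longrightarrow> x \<in> \<Omega> \<Longrightarrow> g \<langle>$\<rangle> x \<in> \<Omega>"
  by (metis affected_sub apply_affected in_affected subsetD)

lemma eq_oneI: "g \<in> G \<Longrightarrow> (\<And>x. x \<in> \<Omega> \<Longrightarrow> g \<langle>$\<rangle> x = x) \<Longrightarrow> g = 1"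
  by (metis affected_sub affected_empty_iff in_affected subsetD subset_empty subsetI)

lemma finite_G: "finite G"
proof -
  have "apply ` G \<subseteq> {f. f permutes \<Omega>}"
    using affected_sub by (auto simp: permutes_def in_affected) (metis in_affected subsetD, metis apply_inverse_cancel(2), metis apply_inj)
  then have "finite (apply ` G)" using finite_permutations[OF finite_space] by (rule finite_subset)
  then show ?thesis by (rule finite_imageD) (simp add: apply_inject inj_on_def)
qed

lemma finite_sub: "H \<subseteq> G \<Longrightarrow> finite H"
  using finite_G finite_subset by blast

lemma orb_normal_image:
  assumes "normal_sub N G" "g \<in> G"
  shows "apply g ` orb N x = orb N (g \<langle>$\<rangle> x)"
proof -
  have "orb N (g \<langle>$\<rangle> x) = orb (conj_by g ` N) (g \<langle>$\<rangle> x)"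
    using normal_sub_conj_image[OF assms(1) subgrp_G assms(2)] by simp
  then show ?thesis by (simp add: orb_def image_image)
qed

text \<open>The orbits of a normal subgroup are blocks. They cannot all be singletons, since the
  action is faithful and \<open>N \<noteq> {1}\<close>, so one of them is all of
  \<open>\<Omega>\<close>.\<close>

lemma normal_transitive:
  assumes N: "normal_sub N G" "N \<noteq> {1}" and "x \<in> \<Omega>" "y \<in> \<Omega>"
  shows "\<exists>n\<in>N. n \<langle>$\<rangle> x = y"
proof -
  have sub: "subgrp N" "N \<subseteq> G" using N by (auto simp: normal_sub_def)
  have "card (orb N z) = 1 \<or> orb N z = \<Omega>" if z: "z \<in> \<Omega>" for z
  proof -
    have "orb N z = {} \<or> card (orb N z) = 1 \<or> orb N z = \<Omega>"
    proof (rule block)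
      show "orb N z \<subseteq> \<Omega>" using sub apply_in z by (auto simp: orb_def)
      fix g assume g: "g \<in> G"
      show "apply g ` orb N z = orb N z \<or> apply g ` orb N z \<inter> orb N z = {}"
        using orb_eq[OF sub(1)] unfolding orb_normal_image[OF N(1) g] by blast
    qed
    then show ?thesis using orb_self[OF sub(1)] by auto
  qed
  moreover have "\<exists>z\<in>\<Omega>. card (orb N z) \<noteq> 1"
  proof (rule ccontr)
    assume *: "\<not> ?thesis"
    have "n \<langle>$\<rangle> z = z" if n: "n \<in> N" "z \<in> \<Omega>" for n z
    proof -
      have "n \<langle>$\<rangle> z \<in> orb N z" "z \<in> orb N z" using n orb_self[OF sub(1)] by (auto simp: orb_def)
      moreover have "card (orb N z) = 1" using * n by auto
      ultimately show ?thesis by (auto simp: card_1_singleton_iff)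
    qed
    then have "N \<subseteq> {1}" using eq_oneI sub by blast
    then show False using N(2) subgrp_one[OF sub(1)] by auto
  qed
  ultimately obtain z where "orb N z = \<Omega>" by auto
  then have "orb N x = \<Omega>" using orb_eq[OF sub(1), of x z] assms by auto
  then show ?thesis using assms by (auto simp: orb_def image_iff)
qed

text \<open>The centraliser of a transitive group is semiregular (the fact \<open>regular\<close>).
  As \<open>N\<close> is abelian it lies in its own centraliser, which gives regularity. An element
  \<open>g\<close> centralising \<open>N\<close> agrees with some \<open>n \<in> N\<close> at one
  point, so \<open>g = n\<close>; hence no other minimal normal subgroup can meet \<open>N\<close>
  trivially.\<close>

lemma abelian_affine:
  assumes min: "min_normal N G" and ab: "N \<subseteq> centraliser N" and ne: "\<Omega> \<noteq> {}"
  shows "affine \<Omega> (apply ` G)"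
proof -
  interpret perm_hom G "apply"
    by unfold_locales (auto simp: subgrp_G apply_times)
  note N = min_normalD[OF min]
  have comm: "x * y = y * x" if "x \<in> N" "y \<in> N" for x y
    using that ab by (auto simp: centraliser_def conj_by_eq_self_iff)
  have regular: "g = 1" if g: "g \<in> G" "g \<in> centraliser N" "x \<in> \<Omega>" "g \<langle>$\<rangle> x = x" for g x
  proof (rule eq_oneI[OF g(1)])
    fix y assume "y \<in> \<Omega>"
    then obtain n where n: "n \<in> N" "n \<langle>$\<rangle> x = y" using normal_transitive[OF N(1,2) g(3)] by blast
    then have "g * n = n * g" using g(2) by (auto simp: centraliser_def conj_by_eq_self_iff)
    then have "g \<langle>$\<rangle> (n \<langle>$\<rangle> x) = n \<langle>$\<rangle> (g \<langle>$\<rangle> x)" by (metis apply_mult)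
    then show "g \<langle>$\<rangle> y = y" using n g(4) by simp
  qed
  obtain x where x: "x \<in> N" "x \<noteq> 1" using N(2) subgrp_one[OF N(3)] by blast
  have Nid: "apply ` N \<noteq> {id}"
  proof
    assume "apply ` N = {id}"
    then have "apply x = id" using x(1) by blast
    then show False using x(2) by simp
  qed
  obtain q y where q: "prime (q::nat)" "y \<in> N" "y \<noteq> 1" "y ^ q = 1"
    using exists_prime_order[OF N(3) finite_sub[OF N(4)] x] by blast
  \<comment> \<open>Commutativity makes this a subgroup and conjugation preserves it. The choice of
    \<open>q\<close> makes it nontrivial, so minimality forces \<open>N\<close> to have exponent
    \<open>q\<close>.\<close>
  define M where "M = {x \<in> N. x ^ q = 1}"
  have "normal_sub M G"
  proof (intro normal_subI subgrpI)
    fix x y assume "x \<in> M" "y \<in> M"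
    then show "x * y \<in> M"
      using subgrp_mult[OF N(3), of x y] power_mult_commuting[OF comm, of x y q] by (simp add: M_def)
  next
    fix g m assume "g \<in> G" "m \<in> M"
    then show "conj_by g m \<in> M" using normal_sub_conj[OF N(1)] by (simp add: M_def conj_by_power)
  qed (use N(3,4) in \<open>auto simp: M_def subgrp_one subgrp_inverse perm_power_inverse\<close>)
  moreover have "M \<subseteq> N" "M \<noteq> {1}" using q by (auto simp: M_def)
  ultimately have M: "M = N" using N(5) by blast
  have "comm_group (pgrp (apply ` N))"
  proof (rule group.group_comm_groupI[OF group_image[OF N(3,4)]])
    fix x y assume "x \<in> carrier (pgrp (apply ` N))" "y \<in> carrier (pgrp (apply ` N))"
    then obtain m n where mn: "m \<in> N" "x = apply m" "n \<in> N" "y = apply n" by (auto simp: pgrp_def)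
    then have "apply m \<circ> apply n = apply n \<circ> apply m" using comm[of m n] by (metis apply_times)
    then show "x \<otimes>\<^bsub>pgrp (apply ` N)\<^esub> y = y \<otimes>\<^bsub>pgrp (apply ` N)\<^esub> x"
      using mn by (simp add: pgrp_def)
  qed
  moreover have "apply n ^^ q = id" if "n \<in> N" for n
  proof -
    have "n \<in> M" using that M by simp
    then show ?thesis by (simp add: M_def flip: apply_power)
  qed
  ultimately have "elementary_abelian (apply ` N)"
    using q(1) unfolding elementary_abelian_def by blast
  moreover have "regular_on \<Omega> (apply ` N)"
    unfolding regular_on_def transitive_on_def
  proof (intro conjI ballI impI)
    show "\<Omega> \<noteq> {}" by (fact ne)
    show "\<exists>g\<in>apply ` N. g x = y" if "x \<in> \<Omega>" "y \<in> \<Omega>" for x y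
      using normal_transitive[OF N(1,2) that] by blast
    fix n x assume "n \<in> apply ` N" "x \<in> \<Omega>" "n x = x"
    then obtain m where m: "m \<in> N" "n = apply m" "m \<langle>$\<rangle> x = x" by blast
    then have "m = 1" using N(4) ab \<open>x \<in> \<Omega>\<close> by (intro regular[of m x]) blast+
    then show "n = id" using m(2) by simp
  qed
  moreover have "minimal_normal (apply ` G) K \<longleftrightarrow> K = apply ` N" for K
  proof
    assume K: "minimal_normal (apply ` G) K"
    define L where "L = {x \<in> G. apply x \<in> K}"
    have L: "normal_sub L G" "apply ` L = K"
      unfolding L_def using normal_preimage[OF subgrp_G subset_refl, of K] K
      by (simp_all add: minimal_normal_def)
    have "L \<noteq> {1}" using L(2) K by (auto simp: minimal_normal_def)
    have "L \<inter> N \<noteq> {1}"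
    proof
      assume triv: "L \<inter> N = {1}"
      have "L \<subseteq> N"
      proof
        fix g assume g: "g \<in> L"
        then have gc: "g \<in> centraliser N"
          using normal_sub_Int_commute[OF L(1) N(1) triv] by (auto simp: centraliser_def)
        have gG: "g \<in> G" using g by (simp add: L_def)
        obtain a where a: "a \<in> \<Omega>" using ne by blast
        then obtain n where n: "n \<in> N" "n \<langle>$\<rangle> a = g \<langle>$\<rangle> a"
          using normal_transitive[OF N(1,2) a apply_in[OF gG a]] by blast
        have "inverse n * g = 1"
        proof (rule regular[OF _ _ a])
          show "inverse n * g \<in> G" using n gG N(4) subgrp_G by (auto intro!: subgrp_mult subgrp_inverse)
          show "inverse n * g \<in> centraliser N"
            using subgrp_centraliser gc n ab by (auto intro!: subgrp_mult subgrp_inverse)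
          show "(inverse n * g) \<langle>$\<rangle> a = a" using n by (simp flip: n(2))
        qed
        then have "g = n" by (metis inverse_mult_cancel(2) mult_1_right)
        then show "g \<in> N" using n by simp
      qed
      then show False using triv \<open>L \<noteq> {1}\<close> by auto
    qed
    then have "L \<inter> N = N" using N(5)[OF normal_sub_Int[OF L(1) N(1)]] by auto
    then have "apply ` N \<subseteq> K" using L(2) by blast
    moreover have "apply ` N \<lhd> pgrp (apply ` G)" using normal_image[OF subgrp_G subset_refl N(1)] .
    ultimately show "K = apply ` N" using K Nid unfolding minimal_normal_def by blast
  next
    assume K: "K = apply ` N"
    have "L = {id} \<or> L = K" if L: "L \<lhd> pgrp (apply ` G)" "L \<subseteq> K" for L
    proof -
      define L' where "L' = {x \<in> G. apply x \<in> L}"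
      have L': "normal_sub L' G" "apply ` L' = L"
        unfolding L'_def using normal_preimage[OF subgrp_G subset_refl L(1)] by simp_all
      have "L' \<subseteq> N"
      proof
        fix x assume "x \<in> L'"
        then have "apply x \<in> apply ` N" using L(2) K by (auto simp: L'_def)
        then show "x \<in> N" by (auto simp: apply_inject)
      qed
      then have "L' = {1} \<or> L' = N" using N(5)[OF L'(1)] by blast
      then show ?thesis
      proof
        assume "L' = {1}"
        then show ?thesis using L'(2) by simp
      next
        assume "L' = N"
        then show ?thesis using L'(2) K by simp
      qed
    qed
    moreover have "K \<lhd> pgrp (apply ` G)" using normal_image[OF subgrp_G subset_refl N(1)] K by simp
    moreover have "K \<noteq> {id}" using Nid K by simp
    ultimately show "minimal_normal (apply ` G) K"
      unfolding minimal_normal_def by simp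
  qed
  ultimately show ?thesis unfolding affine_def by blast
qed

section \<open>Point stabilisers and the centraliser of a minimal normal subgroup\<close>

definition stab :: "'a \<Rightarrow> 'a perm set" where
  "stab a = {g \<in> G. g \<langle>$\<rangle> a = a}"

lemma subgrp_stab: "subgrp (stab a)"
proof (rule subgrpI)
  fix x assume "x \<in> stab a"
  then show "inverse x \<in> stab a"
    using subgrp_inverse[OF subgrp_G, of x] by (auto simp: stab_def) (metis apply_inverse_cancel(1))
qed (auto simp: stab_def subgrp_one[OF subgrp_G] subgrp_mult[OF subgrp_G])

lemma stab_sub: "stab a \<subseteq> G"
  by (auto simp: stab_def)

text \<open>If the centraliser is nontrivial, then \<open>N\<close> is regular and the point stabiliser induces every
  inner automorphism of \<open>N\<close>, so that suborbits correspond to unions of conjugacy classes of \<open>N\<close>.\<close>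

lemma centraliser_trivial:
  assumes min: "min_normal N G" and nonab: "\<not> N \<subseteq> centraliser N"
    and a: "a \<in> \<Omega>" and p: "prime p" "p dvd card \<Omega>"
    and sub: "\<And>x. x \<in> \<Omega> \<Longrightarrow> \<not> p dvd card (orb (stab a) x)"
  shows "G \<inter> centraliser N = {1}"
proof (rule ccontr)
  assume nontriv: "G \<inter> centraliser N \<noteq> {1}"
  note N = min_normalD[OF min]
  define C where "C = G \<inter> centraliser N"
  have C: "normal_sub C G" unfolding C_def using N(1) subgrp_G by (rule normal_sub_centraliser)
  have subC: "subgrp C" using C by (simp add: normal_sub_def)
  have comm: "c * n = n * c" if "c \<in> C" "n \<in> N" for c n
    using that by (auto simp: C_def centraliser_def conj_by_eq_self_iff)
  have Ctrans: "\<exists>c\<in>C. c \<langle>$\<rangle> x = y" if "x \<in> \<Omega>" "y \<in> \<Omega>" for x y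
    using normal_transitive[OF C _ that] nontriv by (simp add: C_def)
  \<comment> \<open>\<open>C\<close> is a nontrivial normal subgroup, hence transitive, and it
    commutes with \<open>N\<close>; so an element of \<open>N\<close> that fixes \<open>a\<close>
    fixes every point.\<close>
  have semireg: "n = 1" if n: "n \<in> N" "n \<langle>$\<rangle> a = a" for n
  proof (rule eq_oneI)
    show "n \<in> G" using n N(4) by auto
    fix x assume "x \<in> \<Omega>"
    then obtain c where c: "c \<in> C" "c \<langle>$\<rangle> a = x" using Ctrans[OF a] by blast
    have "n \<langle>$\<rangle> (c \<langle>$\<rangle> a) = c \<langle>$\<rangle> (n \<langle>$\<rangle> a)" using comm[OF c(1) n(1)] by (metis apply_mult)
    then show "n \<langle>$\<rangle> x = x" using c n by simp
  qed
  have inj: "inj_on (\<lambda>n. n \<langle>$\<rangle> a) N"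
  proof (rule inj_onI)
    fix m n assume mn: "m \<in> N" "n \<in> N" "m \<langle>$\<rangle> a = n \<langle>$\<rangle> a"
    then have "inverse m * n = 1"
      using semireg[of "inverse m * n"] N(3) by (simp add: subgrp_mult subgrp_inverse flip: mn(3))
    then show "m = n" by (metis inverse_mult_cancel(2) mult_1_right)
  qed
  \<comment> \<open>The part of the stabiliser inside the product of \<open>N\<close> and
    \<open>C\<close>. An element \<open>n * c\<close> acts on \<open>N\<close> by conjugation like
    \<open>n\<close>, and each \<open>n\<close> occurs, with \<open>c\<close> chosen to send
    \<open>a\<close> to the image of \<open>a\<close> under \<open>inverse n\<close>.\<close>
  define D where "D = {d \<in> stab a. \<exists>n\<in>N. \<exists>c\<in>C. d = n * c}"
  have D: "normal_sub D (stab a)"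
  proof (intro normal_subI subgrpI)
    show "1 \<in> D" using subgrp_one[OF subgrp_stab] subgrp_one[OF N(3)] subgrp_one[OF subC]
      by (auto simp: D_def intro!: bexI[of _ 1])
  next
    fix x y assume "x \<in> D" "y \<in> D"
    then obtain n c m d where xy: "x \<in> stab a" "y \<in> stab a" "n \<in> N" "c \<in> C" "x = n * c" "m \<in> N" "d \<in> C" "y = m * d"
      by (auto simp: D_def)
    have "x * y = (n * m) * (c * d)" using comm[of c m] xy by (simp add: mult.assoc) (simp flip: mult.assoc)
    then show "x * y \<in> D" using xy subgrp_mult[OF subgrp_stab] subgrp_mult[OF N(3)] subgrp_mult[OF subC]
      unfolding D_def by blast
  next
    fix x assume "x \<in> D"
    then obtain n c where x: "x \<in> stab a" "n \<in> N" "c \<in> C" "x = n * c" by (auto simp: D_def)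
    then have "inverse x = inverse n * inverse c"
      using comm[OF x(3,2)] by (metis perm.inverse_distrib_swap)
    then show "inverse x \<in> D" using x subgrp_inverse[OF subgrp_stab] subgrp_inverse[OF N(3)] subgrp_inverse[OF subC]
      unfolding D_def by blast
  next
    fix g x assume g: "g \<in> stab a" and "x \<in> D"
    then obtain n c where x: "x \<in> stab a" "n \<in> N" "c \<in> C" "x = n * c" by (auto simp: D_def)
    have "conj_by g n \<in> N" "conj_by g c \<in> C"
      using normal_sub_conj[OF N(1)] normal_sub_conj[OF C] x g stab_sub by blast+
    then show "conj_by g x \<in> D" unfolding D_def
      using conj_by_in[OF subgrp_stab g x(1)] x(4) conj_by_mult by blast
  qed (auto simp: D_def)
  \<comment> \<open>Regularity identifies \<open>\<Omega>\<close> with \<open>N\<close>, the point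
    \<open>a\<close> corresponding to \<open>1\<close>. Under this identification \<open>D\<close>
    acts as the inner automorphism group, so its orbits are conjugacy classes of
    \<open>N\<close>.\<close>
  have orbD: "orb D (m \<langle>$\<rangle> a) = (\<lambda>n. n \<langle>$\<rangle> a) ` ((\<lambda>s. conj_by s m) ` N)" if m: "m \<in> N" for m
  proof -
    have act: "(n * c) \<langle>$\<rangle> (m \<langle>$\<rangle> a) = conj_by n m \<langle>$\<rangle> a"
      if "n \<in> N" "c \<in> C" "(n * c) \<langle>$\<rangle> a = a" for n c
    proof -
      have "(n * c) * m = conj_by n m * (n * c)"
        using comm[OF that(2) m] by (simp add: conj_by_def mult.assoc)
      then show ?thesis using that(3) by (metis apply_mult)
    qed
    have "\<exists>d\<in>D. d \<langle>$\<rangle> (m \<langle>$\<rangle> a) = conj_by n m \<langle>$\<rangle> a" if n: "n \<in> N" for n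
    proof -
      have "inverse n \<in> G" using n N(3,4) subgrp_inverse by blast
      then obtain c where c: "c \<in> C" "c \<langle>$\<rangle> a = inverse n \<langle>$\<rangle> a" using Ctrans[OF a apply_in[OF _ a]] by blast
      have fix_a: "(n * c) \<langle>$\<rangle> a = a" using c by simp
      have "n * c \<in> G" using n c N(4) by (auto simp: C_def intro: subgrp_mult[OF subgrp_G])
      then have "n * c \<in> D" using n c(1) fix_a unfolding D_def stab_def by blast
      then show ?thesis using act[OF n c(1) fix_a] by blast
    qed
    moreover have "d \<langle>$\<rangle> (m \<langle>$\<rangle> a) \<in> (\<lambda>s. conj_by s m \<langle>$\<rangle> a) ` N" if "d \<in> D" for d
      using that act by (auto simp: D_def stab_def simp del: apply_mult)
    ultimately show ?thesis by (auto simp: orb_def image_image) (metis image_eqI)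
  qed
  have cls: "\<not> p dvd card ((\<lambda>s. conj_by s m) ` N)" if m: "m \<in> N" for m
  proof -
    have "(\<lambda>s. conj_by s m) ` N \<subseteq> N" using m N(3) by (auto intro: conj_by_in)
    then have "card (orb D (m \<langle>$\<rangle> a)) = card ((\<lambda>s. conj_by s m) ` N)"
      unfolding orbD[OF m] using inj by (intro card_image) (rule inj_on_subset)
    moreover have "card (orb D (m \<langle>$\<rangle> a)) dvd card (orb (stab a) (m \<langle>$\<rangle> a))"
      by (rule card_orb_normal_dvd[OF D subgrp_stab finite_sub[OF stab_sub]])
    moreover have "m \<langle>$\<rangle> a \<in> \<Omega>" using m N(4) a apply_in by auto
    ultimately show ?thesis using sub dvd_trans by metis
  qed
  have "(\<lambda>n. n \<langle>$\<rangle> a) ` N = \<Omega>" using normal_transitive[OF N(1,2) a] apply_in a N(4) by auto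
  \<comment> \<open>Now \<open>p\<close> divides \<open>card N\<close>, while all class sizes of
    \<open>N\<close> are prime to \<open>p\<close>. A nontrivial \<open>p\<close>-subgroup is
    therefore central, so \<open>N \<inter> C\<close> is nontrivial and by minimality
    \<open>N\<close> is abelian.\<close>
  then have "card N = card \<Omega>" using card_image[OF inj] by simp
  then obtain P b where P: "subgrp P" "P \<subseteq> N" "card P = p ^ b" "P \<noteq> {1}"
    using exists_prime_power_subgrp[OF N(3) finite_sub[OF N(4)] p(1)] p(2) by metis
  then obtain g where g: "g \<in> P" "g \<noteq> 1" using subgrp_one by blast
  have "g \<in> N \<inter> centraliser N"
    using prime_power_subgrp_central[OF N(3) finite_sub[OF N(4)] P(1-3) p(1) cls g(1)] g P(2)
    by (auto simp: centraliser_def)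
  then have "g \<in> N \<inter> C" using N(4) by (auto simp: C_def)
  then have "N \<inter> C = N" using N(5)[OF normal_sub_Int[OF N(1) C]] g(2) by blast
  then show False using nonab by (auto simp: C_def)
qed

end

section \<open>The socle as a product of simple groups\<close>

text \<open>\<open>T\<close> is only required to be minimal normal in \<open>N\<close>. That it is
  nonabelian and simple is derived from the minimality of \<open>N\<close>, the trivial centraliser,
  and the fact that \<open>N\<close> induces only inner automorphisms on \<open>T\<close>.\<close>

locale nonabelian_socle = prim_group +
  fixes N T :: "'a perm set" and a :: 'a and p :: nat
  assumes min_N: "min_normal N G" and min_T: "min_normal T N"
    and cent_N: "G \<inter> centraliser N = {1}"
    and a: "a \<in> \<Omega>" and p: "prime p" "p dvd card \<Omega>"
    and subdegree: "x \<in> \<Omega> \<Longrightarrow> \<not> p dvd card (orb (stab a) x)"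
begin

section \<open>Commuting factors and projections\<close>

definition factors :: "'a perm set set" where
  "factors = (\<lambda>g. conj_by g ` T) ` G"

lemmas N = min_normalD[OF min_N] and T = min_normalD[OF min_T]

lemma T_sub: "T \<subseteq> G" using N(4) T(4) by blast

lemma finite_factors: "finite factors"
  using finite_G by (simp add: factors_def)

lemma T_factor: "T \<in> factors"
  using subgrp_one[OF subgrp_G] by (auto simp: factors_def image_iff intro!: bexI[of _ 1])

lemma conj_factor: "g \<in> G \<Longrightarrow> U \<in> factors \<Longrightarrow> conj_by g ` U \<in> factors"
  by (auto simp: factors_def image_image simp flip: conj_by_by_mult intro!: imageI subgrp_mult[OF subgrp_G])

lemma factor_min: "U \<in> factors \<Longrightarrow> min_normal U N"
  using min_normal_conj[OF min_T] normal_sub_conj_image[OF N(1) subgrp_G] by (auto simp: factors_def) metis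

lemma factor_normal: "U \<in> factors \<Longrightarrow> normal_sub U N"
  and factor_subgrp: "U \<in> factors \<Longrightarrow> subgrp U"
  and factor_sub: "U \<in> factors \<Longrightarrow> U \<subseteq> N"
  using factor_min min_normalD by blast+

text \<open>Distinct minimal normal subgroups of \<open>N\<close> meet trivially, since their
  intersection is normal in \<open>N\<close>.\<close>

lemma factors_commute:
  assumes "U \<in> factors" "V \<in> factors" "U \<noteq> V"
  shows "V \<subseteq> centraliser U"
proof -
  note U = min_normalD[OF factor_min[OF assms(1)]] and V = min_normalD[OF factor_min[OF assms(2)]]
  have "U \<inter> V = {1}"
  proof (rule ccontr)
    assume *: "U \<inter> V \<noteq> {1}"
    have "normal_sub (U \<inter> V) N" using U(1) V(1) by (rule normal_sub_Int)
    then have "U \<inter> V = U" "U \<inter> V = V" using * U(5)[of "U \<inter> V"] V(5)[of "U \<inter> V"] by auto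
    then show False using assms(3) by auto
  qed
  then show ?thesis
    using normal_sub_Int_commute[OF V(1) U(1)] by (auto simp: centraliser_def Int_commute)
qed

text \<open>\<open>G\<close> permutes the factors and hence their centralisers. By minimality of
  \<open>N\<close> the subgroup is \<open>{1}\<close> or \<open>N\<close>; this choice yields both
  \<open>T_nonabelian\<close> and \<open>centralising_factors_eq_one\<close>.\<close>

lemma normal_Int_centralisers: "normal_sub {n \<in> N. \<forall>U\<in>factors. n \<in> centraliser U} G"
proof (intro normal_subI subgrpI)
  fix g n assume g: "g \<in> G" and n: "n \<in> {n \<in> N. \<forall>U\<in>factors. n \<in> centraliser U}"
  have "conj_by g n \<in> centraliser U" if U: "U \<in> factors" for U
  proof -
    have "conj_by (inverse g) ` U \<in> factors" using U g subgrp_inverse[OF subgrp_G] conj_factor by blast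
    then have "n \<in> centraliser (conj_by (inverse g) ` U)" using n by blast
    from conj_by_centraliser[OF this, of g] show ?thesis by simp
  qed
  then show "conj_by g n \<in> {n \<in> N. \<forall>U\<in>factors. n \<in> centraliser U}"
    using normal_sub_conj[OF N(1) g] n by blast
qed (use N(4) in \<open>auto simp: subgrp_one[OF N(3)] subgrp_one[OF subgrp_centraliser] subgrp_mult[OF N(3)]
    subgrp_mult[OF subgrp_centraliser] subgrp_inverse[OF N(3)] subgrp_inverse[OF subgrp_centraliser]\<close>)

text \<open>An abelian \<open>T\<close> would centralise every factor. The common centraliser would
  then be all of \<open>N\<close>, so \<open>T\<close> would centralise \<open>N\<close>, against
  \<open>cent_N\<close>.\<close>

lemma T_nonabelian: "\<not> T \<subseteq> centraliser T"
proof
  assume ab: "T \<subseteq> centraliser T"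
  let ?K = "{n \<in> N. \<forall>U\<in>factors. n \<in> centraliser U}"
  have "T \<subseteq> ?K"
    using ab T(4) factors_commute[OF _ T_factor] by blast
  moreover have "T \<noteq> {1}" "1 \<in> T" using T(2,3) subgrp_one by auto
  ultimately have "?K \<noteq> {1}" by blast
  moreover have "?K \<subseteq> N" by blast
  ultimately have "?K = N" using N(5)[OF normal_Int_centralisers] by blast
  then have "N \<subseteq> centraliser T" using T_factor by blast
  then have "T \<subseteq> centraliser N" unfolding centraliser_def using conj_by_sym by blast
  then have "T \<subseteq> {1}" using cent_N T_sub by blast
  then show False using \<open>T \<noteq> {1}\<close> \<open>1 \<in> T\<close> by blast
qed

lemma factor_nonabelian:
  assumes "U \<in> factors"
  shows "\<not> U \<subseteq> centraliser U"
proof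
  assume ab: "U \<subseteq> centraliser U"
  obtain g where U: "U = conj_by g ` T" using assms by (auto simp: factors_def)
  have "t \<in> centraliser T" if t: "t \<in> T" for t
  proof -
    have "conj_by g t \<in> centraliser U" using ab t U by blast
    from conj_by_centraliser[OF this, of "inverse g"] show ?thesis by (simp add: U)
  qed
  then show False using T_nonabelian by blast
qed

lemma factor_centreless:
  assumes U: "U \<in> factors"
  shows "U \<inter> centraliser U = {1}"
proof (rule ccontr)
  note U' = min_normalD[OF factor_min[OF U]]
  assume "U \<inter> centraliser U \<noteq> {1}"
  moreover have eq: "U \<inter> centraliser U = U \<inter> (N \<inter> centraliser U)" using U'(4) by blast
  moreover have "normal_sub (U \<inter> (N \<inter> centraliser U)) N"
    using U'(1) normal_sub_centraliser[OF U'(1) N(3)] by (rule normal_sub_Int)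
  ultimately have "U \<inter> centraliser U = U" using U'(5) by (metis Int_lower1)
  then show False using factor_nonabelian[OF U] by blast
qed

lemma centralising_factors_eq_one:
  assumes "n \<in> N" "\<And>U. U \<in> factors \<Longrightarrow> n \<in> centraliser U"
  shows "n = 1"
proof (rule ccontr)
  let ?K = "{n \<in> N. \<forall>U\<in>factors. n \<in> centraliser U}"
  assume "n \<noteq> 1"
  then have "?K \<noteq> {1}" using assms by blast
  moreover have "?K \<subseteq> N" by blast
  ultimately have "?K = N" using N(5)[OF normal_Int_centralisers] by blast
  then show False using T_nonabelian T_factor T(4) by blast
qed

text \<open>The elements of \<open>N\<close> that act on every factor as an inner automorphism of
  that factor form a normal subgroup of \<open>G\<close>. It contains \<open>T\<close>, which acts
  trivially on the other factors, so minimality makes it all of \<open>N\<close>.\<close>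

lemma factor_decomp:
  assumes n: "n \<in> N" and U: "U \<in> factors"
  shows "\<exists>u\<in>U. inverse u * n \<in> centraliser U"
proof -
  define M where "M = {n \<in> N. \<forall>U\<in>factors. \<exists>u\<in>U. inverse u * n \<in> centraliser U}"
  have "\<exists>u\<in>U. inverse u * 1 \<in> centraliser U" if "U \<in> factors" for U
    using subgrp_one[OF factor_subgrp[OF that]] subgrp_one[OF subgrp_centraliser] by (intro bexI[of _ 1]) auto
  then have M1: "1 \<in> M" using subgrp_one[OF N(3)] by (auto simp: M_def)
  have "normal_sub M G"
  proof (intro normal_subI subgrpI M1)
    show "M \<subseteq> G" using N(4) by (auto simp: M_def)
  next
    fix x y assume x: "x \<in> M" and y: "y \<in> M"
    have "\<exists>u\<in>V. inverse u * (x * y) \<in> centraliser V" if V: "V \<in> factors" for V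
    proof -
      obtain u v where uv: "u \<in> V" "inverse u * x \<in> centraliser V" "v \<in> V" "inverse v * y \<in> centraliser V"
        using x y V unfolding M_def by blast
      have iv: "inverse v \<in> V" using uv factor_subgrp[OF V] subgrp_inverse by blast
      have "inverse v * (inverse u * x) = (inverse u * x) * inverse v"
        using centraliserD[OF uv(2) iv] by (simp add: conj_by_eq_self_iff)
      then have "inverse (u * v) * (x * y) = (inverse u * x) * (inverse v * y)"
        by (simp add: mult.assoc) (simp flip: mult.assoc)
      then have "inverse (u * v) * (x * y) \<in> centraliser V"
        using subgrp_mult[OF subgrp_centraliser uv(2,4)] by simp
      then show ?thesis using uv factor_subgrp[OF V] subgrp_mult by blast
    qed
    then show "x * y \<in> M" using x y N(3) subgrp_mult unfolding M_def by blast
  next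
    fix x assume x: "x \<in> M"
    have "\<exists>u\<in>V. inverse u * inverse x \<in> centraliser V" if V: "V \<in> factors" for V
    proof -
      obtain u where u: "u \<in> V" "inverse u * x \<in> centraliser V" using x V unfolding M_def by blast
      have "inverse (inverse u * x) \<in> centraliser V" using subgrp_inverse[OF subgrp_centraliser u(2)] .
      moreover have "u * (inverse u * x) = (inverse u * x) * u"
        using centraliserD[OF u(2,1)] by (simp add: conj_by_eq_self_iff)
      then have "inverse (inverse u * x) = inverse (inverse u) * inverse x"
        by (metis inverse_mult_cancel(2) mult.assoc perm.inverse_distrib_swap perm.inverse_inverse)
      ultimately show ?thesis using subgrp_inverse[OF factor_subgrp[OF V] u(1)] by metis
    qed
    then show "inverse x \<in> M" using x N(3) subgrp_inverse unfolding M_def by blast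
  next
    fix g x assume g: "g \<in> G" and x: "x \<in> M"
    have "\<exists>u\<in>V. inverse u * conj_by g x \<in> centraliser V" if V: "V \<in> factors" for V
    proof -
      have "conj_by (inverse g) ` V \<in> factors" using V g subgrp_inverse[OF subgrp_G] conj_factor by blast
      then obtain u where u: "u \<in> conj_by (inverse g) ` V" "inverse u * x \<in> centraliser (conj_by (inverse g) ` V)"
        using x unfolding M_def by blast
      have "conj_by g (inverse u * x) \<in> centraliser V" using conj_by_centraliser[OF u(2), of g] by simp
      then have "inverse (conj_by g u) * conj_by g x \<in> centraliser V" by (simp add: conj_by_mult conj_by_inverse)
      moreover have "conj_by g u \<in> V" using u(1) by auto
      ultimately show ?thesis by blast
    qed
    then show "conj_by g x \<in> M" using normal_sub_conj[OF N(1) g] x unfolding M_def by blast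
  qed
  moreover have "T \<subseteq> M"
  proof
    fix t assume t: "t \<in> T"
    have "\<exists>u\<in>V. inverse u * t \<in> centraliser V" if V: "V \<in> factors" for V
    proof (cases "V = T")
      case True
      then show ?thesis using t subgrp_one[OF subgrp_centraliser] by (metis perm.left_inverse)
    next
      case False
      then have "t \<in> centraliser V" using factors_commute[OF V T_factor] t by blast
      then show ?thesis using subgrp_one[OF factor_subgrp[OF V]]
        by (metis mult_1 perm.inverse_neutral)
    qed
    then show "t \<in> M" using t T(4) unfolding M_def by blast
  qed
  moreover have "M \<subseteq> N" by (auto simp: M_def)
  ultimately have "M = N" using N(5)[of M] T(2) M1 subgrp_one[OF T(3)] by blast
  then show ?thesis using assms unfolding M_def by blast
qed

text \<open>The projection of the direct product \<open>N\<close> to its factor \<open>U\<close>,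
  read off from the conjugation action of \<open>n\<close> on \<open>U\<close>. It is well defined
  because \<open>U\<close> has trivial centre.\<close>

definition pr :: "'a perm set \<Rightarrow> 'a perm \<Rightarrow> 'a perm" where
  "pr U n = (THE u. u \<in> U \<and> inverse u * n \<in> centraliser U)"

lemma pr_unique:
  assumes U: "U \<in> factors" and u: "u \<in> U" "inverse u * n \<in> centraliser U"
  shows "pr U n = u"
  unfolding pr_def
proof (rule the_equality)
  fix v assume v: "v \<in> U \<and> inverse v * n \<in> centraliser U"
  have "(inverse v * n) * inverse (inverse u * n) \<in> centraliser U"
    using v u subgrp_centraliser by (blast intro: subgrp_mult subgrp_inverse)
  moreover have "(inverse v * n) * inverse (inverse u * n) = inverse v * u" by (simp add: mult.assoc)
  moreover have "inverse v * u \<in> U" using v u factor_subgrp[OF U] by (blast intro: subgrp_mult subgrp_inverse)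
  ultimately have "inverse v * u = 1" using factor_centreless[OF U] by auto
  then show "v = u" by (metis inverse_mult_cancel(2) mult_1_right)
qed (use u in simp)

lemma pr:
  assumes "n \<in> N" "U \<in> factors"
  shows "pr U n \<in> U" "inverse (pr U n) * n \<in> centraliser U"
  using factor_decomp[OF assms] pr_unique[OF assms(2)] by auto

lemma pr_conj_self:
  assumes "n \<in> N" "U \<in> factors" "s \<in> U"
  shows "conj_by n s = conj_by (pr U n) s"
proof -
  have "n = pr U n * (inverse (pr U n) * n)" by simp
  then have "conj_by n s = conj_by (pr U n) (conj_by (inverse (pr U n) * n) s)"
    by (metis conj_by_by_mult)
  then show ?thesis using centraliserD[OF pr(2)[OF assms(1,2)] assms(3)] by simp
qed

lemma pr_self: "U \<in> factors \<Longrightarrow> u \<in> U \<Longrightarrow> pr U u = u"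
  by (rule pr_unique) (auto simp: subgrp_one[OF subgrp_centraliser])

lemma pr_centraliser: "U \<in> factors \<Longrightarrow> n \<in> centraliser U \<Longrightarrow> pr U n = 1"
  by (rule pr_unique) (auto simp: subgrp_one factor_subgrp)

lemma pr_other: "U \<in> factors \<Longrightarrow> V \<in> factors \<Longrightarrow> V \<noteq> U \<Longrightarrow> v \<in> V \<Longrightarrow> pr U v = 1"
  using factors_commute pr_centraliser by blast

lemma pr_mult:
  assumes "n \<in> N" "m \<in> N" "U \<in> factors"
  shows "pr U (n * m) = pr U n * pr U m"
proof (rule pr_unique[OF assms(3)])
  let ?u = "pr U n" and ?v = "pr U m"
  have uv: "?u \<in> U" "inverse ?u * n \<in> centraliser U" "?v \<in> U" "inverse ?v * m \<in> centraliser U"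
    using pr assms by auto
  then have iv: "inverse ?v \<in> U" using factor_subgrp[OF assms(3)] subgrp_inverse by blast
  show "?u * ?v \<in> U" using uv factor_subgrp[OF assms(3)] subgrp_mult by blast
  have "inverse ?v * (inverse ?u * n) = (inverse ?u * n) * inverse ?v"
    using centraliserD[OF uv(2) iv] by (simp add: conj_by_eq_self_iff)
  then have "inverse (?u * ?v) * (n * m) = (inverse ?u * n) * (inverse ?v * m)"
    by (simp add: mult.assoc) (simp flip: mult.assoc)
  then show "inverse (?u * ?v) * (n * m) \<in> centraliser U"
    using subgrp_mult[OF subgrp_centraliser uv(2,4)] by simp
qed

lemma pr_one: "U \<in> factors \<Longrightarrow> pr U 1 = 1"
  by (simp add: pr_self subgrp_one factor_subgrp)

lemma pr_inverse:
  assumes "n \<in> N" "U \<in> factors"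
  shows "pr U (inverse n) = inverse (pr U n)"
proof -
  have "pr U (inverse n) * pr U n = 1"
    using pr_mult[of "inverse n" n U] assms pr_one subgrp_inverse[OF N(3)] by simp
  then show ?thesis by (metis perm.inverse_unique perm.inverse_inverse)
qed

lemma pr_conj:
  assumes g: "g \<in> G" and n: "n \<in> N" and U: "U \<in> factors"
  shows "pr (conj_by g ` U) (conj_by g n) = conj_by g (pr U n)"
proof (rule pr_unique[OF conj_factor[OF g U]])
  show "conj_by g (pr U n) \<in> conj_by g ` U" using pr(1)[OF n U] by simp
  show "inverse (conj_by g (pr U n)) * conj_by g n \<in> centraliser (conj_by g ` U)"
    using conj_by_centraliser[OF pr(2)[OF n U], of g] by (simp add: conj_by_mult conj_by_inverse)
qed

lemma pr_eqI:
  assumes "n \<in> N" "m \<in> N" "\<And>U. U \<in> factors \<Longrightarrow> pr U n = pr U m"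
  shows "n = m"
proof -
  have mem: "inverse n * m \<in> N" using assms N(3) by (blast intro: subgrp_mult subgrp_inverse)
  have "inverse n * m = 1"
  proof (rule centralising_factors_eq_one[OF mem])
    fix U assume U: "U \<in> factors"
    have "pr U (inverse n * m) = 1"
      using assms U N(3) by (simp add: pr_mult pr_inverse subgrp_inverse)
    then show "inverse n * m \<in> centraliser U" using pr(2)[OF mem U] by simp
  qed
  then show ?thesis by (metis inverse_mult_cancel(2) mult_1_right)
qed

text \<open>Together with \<open>pr_eqI\<close> this says that \<open>N\<close> is the direct
  product of the factors. Multiplying by \<open>f V\<close> changes only the projection to
  \<open>V\<close>, so the family is built up one factor at a time.\<close>

lemma pr_family:
  assumes f: "\<And>U. U \<in> factors \<Longrightarrow> f U \<in> U"
  shows "\<exists>n\<in>N. \<forall>U\<in>factors. pr U n = f U"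
proof -
  have "\<exists>n\<in>N. \<forall>U\<in>factors. pr U n = (if U \<in> F then f U else 1)" if "F \<subseteq> factors" for F
    using finite_subset[OF that finite_factors] that
  proof (induction F rule: finite_induct)
    case empty
    then show ?case using subgrp_one[OF N(3)] pr_one by auto
  next
    case (insert V F)
    then obtain n where n: "n \<in> N" "\<forall>U\<in>factors. pr U n = (if U \<in> F then f U else 1)" by auto
    have V: "V \<in> factors" "f V \<in> V" "f V \<in> N" using insert.prems f factor_sub by auto
    have "pr U (n * f V) = (if U \<in> insert V F then f U else 1)" if U: "U \<in> factors" for U
    proof (cases "U = V")
      case True
      then show ?thesis using pr_mult[OF n(1) V(3) U] n(2) U V insert.hyps by (simp add: pr_self)
    next
      case False
      then show ?thesis using pr_mult[OF n(1) V(3) U] n(2) U V pr_other[OF U V(1) _ V(2)] by simp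
    qed
    then show ?case using subgrp_mult[OF N(3) n(1) V(3)] by blast
  qed
  from this[OF subset_refl] show ?thesis by simp
qed

text \<open>\<open>N\<close> acts on \<open>T\<close> through inner automorphisms of
  \<open>T\<close>, so a normal subgroup of \<open>T\<close> is normal in \<open>N\<close>.\<close>

lemma T_simple:
  assumes M: "normal_sub M T"
  shows "M = {1} \<or> M = T"
proof -
  have "normal_sub M N"
  proof (rule normal_subI)
    show "subgrp M" "M \<subseteq> N" using M T(4) by (auto simp: normal_sub_def)
    fix g m assume g: "g \<in> N" and m: "m \<in> M"
    have "conj_by g m = conj_by (pr T g) m"
      using M m by (intro pr_conj_self[OF g T_factor]) (auto simp: normal_sub_def)
    then show "conj_by g m \<in> M" using normal_sub_conj[OF M pr(1)[OF g T_factor] m] by simp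
  qed
  moreover have "M \<subseteq> T" using M by (simp add: normal_sub_def)
  ultimately show ?thesis using T(5) by blast
qed

lemma N_transitive: "x \<in> \<Omega> \<Longrightarrow> y \<in> \<Omega> \<Longrightarrow> \<exists>n\<in>N. n \<langle>$\<rangle> x = y"
  using normal_transitive[OF N(1,2)] .

text \<open>That \<open>p\<close> divides an order is known at first only for \<open>N\<close>, by
  transitivity. A nontrivial element of a \<open>p\<close>-subgroup of \<open>N\<close> has a
  nontrivial projection to some factor; conjugated into \<open>T\<close>, the projected subgroup
  still has order a power of \<open>p\<close>. Were all class sizes prime to \<open>p\<close>, it
  would lie in the trivial centre of \<open>T\<close>.\<close>

lemma class_size_dvd: "\<exists>t\<in>T. p dvd card ((\<lambda>s. conj_by s t) ` T)"
proof (rule ccontr)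
  assume "\<not> ?thesis"
  then have cls: "\<not> p dvd card ((\<lambda>s. conj_by s t) ` T)" if "t \<in> T" for t using that by blast
  have "orb N a = \<Omega>" using N_transitive[OF a] apply_in a N(4) by (auto simp: orb_def)
  then have "p dvd card N" using orbit_stabiliser[OF N(3) finite_sub[OF N(4)], of a] p(2) by simp
  then obtain P b where P: "subgrp P" "P \<subseteq> N" "card P = p ^ b" "P \<noteq> {1}"
    using exists_prime_power_subgrp[OF N(3) finite_sub[OF N(4)] p(1)] by metis
  then obtain y where y: "y \<in> P" "y \<noteq> 1" using subgrp_one by blast
  then obtain U where U: "U \<in> factors" "pr U y \<noteq> 1"
    using pr_eqI[of y 1] P(2) subgrp_one[OF N(3)] pr_one by auto
  then obtain g where g: "g \<in> G" "U = conj_by g ` T" by (auto simp: factors_def)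
  define h where "h = (\<lambda>n. conj_by (inverse g) (pr U n))"
  have hT: "h n \<in> T" if "n \<in> N" for n
    using pr(1)[OF that U(1)] by (auto simp: h_def g(2))
  have h_mult: "h (m * n) = h m * h n" if "m \<in> N" "n \<in> N" for m n
    using that U(1) by (simp add: h_def pr_mult conj_by_mult)
  have hP: "h (m * n) = h m * h n" if "m \<in> P" "n \<in> P" for m n
    using that P(2) by (blast intro: h_mult)
  have sub: "subgrp (h ` P)" using P(1) hP by (rule subgrp_hom_image)
  have finP: "finite P" using P(2) finite_sub[OF N(4)] finite_subset by blast
  have "card (h ` P) dvd p ^ b" using card_hom_image_dvd[OF P(1) finP hP] P(3) by simp
  then obtain c where c: "card (h ` P) = p ^ c" using p(1) by (auto simp: divides_primepow_nat)
  have "h ` P \<subseteq> T" using hT P(2) by auto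
  then have "h y \<in> T \<inter> centraliser T"
    using prime_power_subgrp_central[OF T(3) finite_sub[OF T_sub] sub _ c p(1) cls] y
    by (auto simp: centraliser_def)
  then have "h y = 1" using factor_centreless[OF T_factor] by auto
  then show False using U(2) by (simp add: h_def)
qed

section \<open>Maximality of the point stabiliser\<close>

definition N_stab :: "'a perm set" where
  "N_stab = N \<inter> stab a"

lemma N_stab_iff: "n \<in> N_stab \<longleftrightarrow> n \<in> N \<and> n \<langle>$\<rangle> a = a"
  using N(4) by (auto simp: N_stab_def stab_def)

lemma subgrp_N_stab: "subgrp N_stab"
  unfolding N_stab_def using N(3) subgrp_stab by (rule subgrp_Int)

text \<open>The Frattini argument for the transitive subgroup \<open>N\<close>.\<close>

lemma stab_factorisation:
  assumes g: "g \<in> G"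
  obtains n v where "n \<in> N" "v \<in> stab a" "g = n * v"
proof -
  obtain n where n: "n \<in> N" "n \<langle>$\<rangle> a = g \<langle>$\<rangle> a" using N_transitive[OF a apply_in[OF g a]] by blast
  then have "inverse n * g \<in> stab a"
    using N(4) g subgrp_G by (auto simp: stab_def subgrp_mult subgrp_inverse simp flip: n(2))
  moreover have "g = n * (inverse n * g)" by simp
  ultimately show thesis using that n(1) by blast
qed

lemma normal_N_stab: "normal_sub N_stab (stab a)"
proof (rule normal_subI[OF subgrp_N_stab])
  show "N_stab \<subseteq> stab a" by (auto simp: N_stab_def)
  fix g m assume g: "g \<in> stab a" and m: "m \<in> N_stab"
  have "g \<in> G" using g stab_sub by blast
  then show "conj_by g m \<in> N_stab"
    using normal_sub_conj[OF N(1)] conj_by_in[OF subgrp_stab g] m by (auto simp: N_stab_def)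
qed

text \<open>Maximality of the point stabiliser: the orbit of \<open>a\<close> under \<open>X\<close> is a block.\<close>

lemma stab_invariant_subgrp:
  assumes X: "subgrp X" "X \<subseteq> N" "N_stab \<subseteq> X"
    and inv: "\<And>v x. v \<in> stab a \<Longrightarrow> x \<in> X \<Longrightarrow> conj_by v x \<in> X"
  shows "X = N_stab \<or> X = N"
proof -
  have "orb X a = {} \<or> card (orb X a) = 1 \<or> orb X a = \<Omega>"
  proof (rule block)
    show "orb X a \<subseteq> \<Omega>" using X N(4) apply_in a by (auto simp: orb_def)
    fix g assume g: "g \<in> G"
    obtain n v where nv: "n \<in> N" "v \<in> stab a" "g = n * v" using stab_factorisation[OF g] .
    have im: "g \<langle>$\<rangle> (x \<langle>$\<rangle> a) = n \<langle>$\<rangle> (conj_by v x \<langle>$\<rangle> a)" for x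
      using nv conj_by_apply[of v x a] by (simp add: stab_def)
    show "apply g ` orb X a = orb X a \<or> apply g ` orb X a \<inter> orb X a = {}"
    proof (rule disjCI)
      assume "apply g ` orb X a \<inter> orb X a \<noteq> {}"
      then obtain x y where xy: "x \<in> X" "y \<in> X" "g \<langle>$\<rangle> (x \<langle>$\<rangle> a) = y \<langle>$\<rangle> a" by (auto simp: orb_def)
      have cx: "conj_by v x \<in> X" using inv nv xy by blast
      \<comment> \<open>This element fixes \<open>a\<close>, hence lies in \<open>X\<close>, and so
        does \<open>n\<close>. As \<open>v\<close> normalises \<open>X\<close> and fixes
        \<open>a\<close>, the product \<open>g = n * v\<close> preserves the orbit of
        \<open>a\<close> under \<open>X\<close>.\<close>
      have "inverse y * (n * conj_by v x) \<in> N_stab"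
        using xy(3) X(2) nv(1) xy(2) cx N(3) unfolding im
        by (auto simp: N_stab_iff intro!: subgrp_mult subgrp_inverse)
      then have "y * (inverse y * (n * conj_by v x)) \<in> X" using X(3) xy(2) subgrp_mult[OF X(1)] by blast
      then have "n * conj_by v x * inverse (conj_by v x) \<in> X"
        using subgrp_mult[OF X(1)] subgrp_inverse[OF X(1) cx] by simp
      then have "n \<in> X" by (simp add: mult.assoc)
      then have "apply g ` orb X a \<subseteq> orb X a"
        using inv[OF nv(2)] im subgrp_mult[OF X(1)] by (fastforce simp: orb_def simp flip: apply_mult)
      moreover have "finite (orb X a)" using finite_sub X(2) N(4) by (auto simp: orb_def)
      ultimately show "apply g ` orb X a = orb X a"
        by (intro card_subset_eq) (auto simp: card_image inj_on_def apply_inj)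
    qed
  qed
  then consider "card (orb X a) = 1" | "orb X a = \<Omega>" using orb_self[OF X(1), of a] by auto
  then show ?thesis
  proof cases
    case 1
    then have "orb X a = {a}" using orb_self[OF X(1), of a] by (auto simp: card_1_singleton_iff)
    then have "X \<subseteq> N_stab" using X(2) unfolding orb_def N_stab_iff subset_eq by blast
    then show ?thesis using X(3) by blast
  next
    case 2
    have "n \<in> X" if n: "n \<in> N" for n
    proof -
      have "n \<langle>$\<rangle> a \<in> orb X a" using 2 n N(4) apply_in a by auto
      then obtain x where x: "x \<in> X" "n \<langle>$\<rangle> a = x \<langle>$\<rangle> a" by (auto simp: orb_def)
      then have "inverse x * n \<in> N_stab" using n X(2) N(3) by (auto simp: N_stab_iff intro!: subgrp_mult subgrp_inverse)
      then have "x * (inverse x * n) \<in> X" using X(1,3) x(1) subgrp_mult by blast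
      then show ?thesis by simp
    qed
    then show ?thesis using X(2) by blast
  qed
qed

text \<open>The elements of \<open>N\<close> with all projections in \<open>X\<close> form a
  subgroup between \<open>N_stab\<close> and \<open>N\<close>. Equivariance of the projections makes
  it invariant under the stabiliser, so \<open>stab_invariant_subgrp\<close> leaves only the two
  extremes.\<close>

lemma stab_invariant_family:
  assumes X: "\<And>U. U \<in> factors \<Longrightarrow> subgrp (X U)" "\<And>U. U \<in> factors \<Longrightarrow> X U \<subseteq> U"
    and inv: "\<And>U v x. U \<in> factors \<Longrightarrow> v \<in> stab a \<Longrightarrow> x \<in> X U \<Longrightarrow> conj_by v x \<in> X (conj_by v ` U)"
    and N_stab: "\<And>U n. U \<in> factors \<Longrightarrow> n \<in> N_stab \<Longrightarrow> pr U n \<in> X U"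
  shows "(\<forall>n\<in>N. (\<forall>U\<in>factors. pr U n \<in> X U) \<longrightarrow> n \<in> N_stab) \<or> (\<forall>U\<in>factors. X U = U)"
proof -
  define Y where "Y = {n \<in> N. \<forall>U\<in>factors. pr U n \<in> X U}"
  have "Y = N_stab \<or> Y = N"
  proof (rule stab_invariant_subgrp)
    show "subgrp Y"
      by (rule subgrpI) (use N(3) X(1) in \<open>auto simp: Y_def pr_one pr_mult pr_inverse
          intro: subgrp_one subgrp_mult subgrp_inverse\<close>)
    show "Y \<subseteq> N" by (auto simp: Y_def)
    show "N_stab \<subseteq> Y" using N_stab by (auto simp: Y_def N_stab_def)
    fix v x assume v: "v \<in> stab a" and x: "x \<in> Y"
    have vG: "v \<in> G" using v stab_sub by blast
    have "pr U (conj_by v x) \<in> X U" if U: "U \<in> factors" for U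
    proof -
      have V: "conj_by (inverse v) ` U \<in> factors" using U vG subgrp_inverse[OF subgrp_G] conj_factor by blast
      then have "conj_by v (pr (conj_by (inverse v) ` U) x) \<in> X (conj_by v ` conj_by (inverse v) ` U)"
        using x v unfolding Y_def by (intro inv) auto
      moreover have "pr (conj_by v ` conj_by (inverse v) ` U) (conj_by v x) = conj_by v (pr (conj_by (inverse v) ` U) x)"
        using x by (intro pr_conj[OF vG _ V]) (simp add: Y_def)
      ultimately show ?thesis by simp
    qed
    then show "conj_by v x \<in> Y" using x normal_sub_conj[OF N(1) vG] by (auto simp: Y_def)
  qed
  then show ?thesis
  proof
    assume "Y = N_stab"
    then show ?thesis by (auto simp: Y_def)
  next
    assume Y: "Y = N"
    have "U \<subseteq> X U" if U: "U \<in> factors" for U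
    proof
      fix u assume u: "u \<in> U"
      then have "u \<in> Y" using Y factor_sub[OF U] by blast
      then have "pr U u \<in> X U" using U by (simp add: Y_def)
      then show "u \<in> X U" using pr_self[OF U u] by simp
    qed
    then show ?thesis using X(2) by blast
  qed
qed

text \<open>By simplicity the alternative is that \<open>T\<close> fixes \<open>a\<close>. But
  \<open>T\<close> is normal in the transitive group \<open>N\<close>, so it would then fix every
  point.\<close>

lemma T_Int_N_stab:
  assumes "\<And>t s. t \<in> T \<Longrightarrow> s \<in> T \<inter> N_stab \<Longrightarrow> conj_by t s \<in> N_stab"
  shows "T \<inter> N_stab = {1}"
proof -
  have "normal_sub (T \<inter> N_stab) T"
    using assms conj_by_in[OF T(3)] subgrp_Int[OF T(3) subgrp_N_stab] by (auto simp: normal_sub_def)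
  moreover have "\<not> T \<subseteq> N_stab"
  proof
    assume TN: "T \<subseteq> N_stab"
    have "t = 1" if t: "t \<in> T" for t
    proof (rule eq_oneI)
      show "t \<in> G" using t T_sub by blast
      fix x assume "x \<in> \<Omega>"
      then obtain n where n: "n \<in> N" "n \<langle>$\<rangle> a = x" using N_transitive[OF a] by blast
      have "conj_by (inverse n) t \<in> T" using normal_sub_conj[OF T(1)] subgrp_inverse[OF N(3) n(1)] t by blast
      then have "conj_by (inverse n) t \<langle>$\<rangle> a = a" using TN by (auto simp: N_stab_iff)
      then have "n \<langle>$\<rangle> (conj_by (inverse n) t \<langle>$\<rangle> a) = n \<langle>$\<rangle> a" by simp
      then show "t \<langle>$\<rangle> x = x" using n(2) by (simp add: conj_by_def)
    qed
    then show False using T(2) subgrp_one[OF T(3)] by blast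
  qed
  ultimately show ?thesis using T_simple by (metis Int_lower2)
qed

lemma inj_on_T_orbit:
  assumes "T \<inter> N_stab = {1}"
  shows "inj_on (\<lambda>t. t \<langle>$\<rangle> a) T"
proof (rule inj_onI)
  fix s t assume st: "s \<in> T" "t \<in> T" "s \<langle>$\<rangle> a = t \<langle>$\<rangle> a"
  have "inverse s * t \<in> T \<inter> N_stab"
    using st subgrp_mult[OF T(3) subgrp_inverse[OF T(3) st(1)] st(2)] T(4) by (auto simp: N_stab_iff simp flip: st(3))
  then have "inverse s * t = 1" using assms by blast
  then show "s = t" by (metis inverse_mult_cancel(2) mult_1_right)
qed

text \<open>If a normal subgroup of the stabiliser, or of its subgroup normalising \<open>T\<close>, induces all inner
  automorphisms of \<open>T\<close>, then its orbits on the points \<open>t a\<close> have the sizes of the conjugacy classes.\<close>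

lemma inner_orbits_False:
  assumes D: "D \<subseteq> stab a" "\<And>d. d \<in> D \<Longrightarrow> \<exists>s\<in>T. \<forall>t\<in>T. conj_by d t = conj_by s t"
    and ind: "\<And>s. s \<in> T \<Longrightarrow> \<exists>d\<in>D. \<forall>t\<in>T. conj_by d t = conj_by s t"
    and orbits: "\<And>t. t \<in> T \<Longrightarrow> \<not> p dvd card (orb D (t \<langle>$\<rangle> a))"
  shows False
proof -
  \<comment> \<open>Every inner automorphism of \<open>T\<close> is induced by an element of the
    stabiliser, and these normalise \<open>N_stab\<close>; so the intersection is normal in
    \<open>T\<close>.\<close>
  have "T \<inter> N_stab = {1}"
  proof (rule T_Int_N_stab)
    fix t s assume t: "t \<in> T" and s: "s \<in> T \<inter> N_stab"
    obtain d where "d \<in> D" "\<forall>s\<in>T. conj_by d s = conj_by t s" using ind[OF t] by blast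
    then show "conj_by t s \<in> N_stab" using normal_sub_conj[OF normal_N_stab, of d s] D(1) s by auto
  qed
  then have inj: "inj_on (\<lambda>t. t \<langle>$\<rangle> a) T" by (rule inj_on_T_orbit)
  obtain t where t: "t \<in> T" "p dvd card ((\<lambda>s. conj_by s t) ` T)" using class_size_dvd by blast
  have act: "d \<langle>$\<rangle> (t \<langle>$\<rangle> a) = conj_by d t \<langle>$\<rangle> a" if "d \<in> D" for d
  proof -
    have "d \<langle>$\<rangle> a = a" using D(1) that by (auto simp: stab_def)
    then show ?thesis using conj_by_apply[of d t a] by simp
  qed
  have "orb D (t \<langle>$\<rangle> a) = (\<lambda>t. t \<langle>$\<rangle> a) ` (\<lambda>s. conj_by s t) ` T"
  proof (intro equalityI subsetI)
    fix x assume "x \<in> orb D (t \<langle>$\<rangle> a)"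
    then obtain d where "d \<in> D" "x = conj_by d t \<langle>$\<rangle> a" using act by (auto simp: orb_def)
    then show "x \<in> (\<lambda>t. t \<langle>$\<rangle> a) ` (\<lambda>s. conj_by s t) ` T" using D(2)[of d] t(1) by auto
  next
    fix x assume "x \<in> (\<lambda>t. t \<langle>$\<rangle> a) ` (\<lambda>s. conj_by s t) ` T"
    then obtain s where s: "s \<in> T" "x = conj_by s t \<langle>$\<rangle> a" by auto
    then obtain d where "d \<in> D" "conj_by d t = conj_by s t" using ind[of s] t(1) by blast
    then show "x \<in> orb D (t \<langle>$\<rangle> a)" using act[of d] s(2) unfolding orb_def by (metis imageI)
  qed
  moreover have "(\<lambda>s. conj_by s t) ` T \<subseteq> T" using conj_by_in[OF T(3)] t(1) by blast
  ultimately have "card (orb D (t \<langle>$\<rangle> a)) = card ((\<lambda>s. conj_by s t) ` T)"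
    using card_image[OF inj_on_subset[OF inj]] by metis
  then show False using orbits[OF t(1)] t(2) by simp
qed

text \<open>The dichotomy for the projections of \<open>N_stab\<close>. Either \<open>N_stab\<close>
  contains the product of its projections, or it projects onto every factor. In the latter case it
  induces all inner automorphisms of \<open>T\<close>, which the subdegrees forbid.\<close>

lemma N_stab_product:
  assumes U: "U \<in> factors" and n: "n \<in> N_stab"
  shows "pr U n \<in> N_stab"
proof -
  have NsN: "N_stab \<subseteq> N" by (auto simp: N_stab_def)
  have "(\<forall>n\<in>N. (\<forall>U\<in>factors. pr U n \<in> pr U ` N_stab) \<longrightarrow> n \<in> N_stab) \<or>
      (\<forall>U\<in>factors. pr U ` N_stab = U)"
  proof (rule stab_invariant_family)
    fix U assume U: "U \<in> factors"
    show "subgrp (pr U ` N_stab)"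
      using subgrp_N_stab by (rule subgrp_hom_image) (use NsN U in \<open>blast intro: pr_mult\<close>)
    show "pr U ` N_stab \<subseteq> U" using pr(1)[OF _ U] NsN by blast
    fix v x assume v: "v \<in> stab a" and "x \<in> pr U ` N_stab"
    then obtain n where n: "n \<in> N_stab" "x = pr U n" by blast
    have "conj_by v x = pr (conj_by v ` U) (conj_by v n)"
      using n v NsN stab_sub U by (auto intro!: pr_conj[symmetric])
    then show "conj_by v x \<in> pr (conj_by v ` U) ` N_stab"
      using normal_sub_conj[OF normal_N_stab v n(1)] by blast
  qed blast
  then show ?thesis
  proof
    assume *: "\<forall>n\<in>N. (\<forall>U\<in>factors. pr U n \<in> pr U ` N_stab) \<longrightarrow> n \<in> N_stab"
    have prU: "pr U n \<in> U" using pr(1)[OF _ U] n NsN by blast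
    have "pr V (pr U n) \<in> pr V ` N_stab" if V: "V \<in> factors" for V
    proof (cases "V = U")
      case True
      then show ?thesis using pr_self[OF U prU] n by simp
    next
      case False
      then have "pr V (pr U n) = pr V 1" using pr_other[OF V U _ prU] pr_one[OF V] by simp
      then show ?thesis using subgrp_one[OF subgrp_N_stab] by simp
    qed
    then show ?thesis using * prU factor_sub[OF U] by blast
  next
    assume *: "\<forall>U\<in>factors. pr U ` N_stab = U"
    have False
    proof (rule inner_orbits_False[of N_stab])
      show "N_stab \<subseteq> stab a" by (auto simp: N_stab_def)
      show "\<exists>s\<in>T. \<forall>t\<in>T. conj_by d t = conj_by s t" if "d \<in> N_stab" for d
        using that NsN pr_conj_self[OF _ T_factor] pr(1)[OF _ T_factor] by blast
      show "\<exists>d\<in>N_stab. \<forall>t\<in>T. conj_by d t = conj_by s t" if "s \<in> T" for s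
      proof -
        have "s \<in> pr T ` N_stab" using * T_factor that by blast
        then show ?thesis using NsN pr_conj_self[OF _ T_factor] by blast
      qed
      fix t assume "t \<in> T"
      then have "t \<langle>$\<rangle> a \<in> \<Omega>" using T_sub a apply_in by blast
      then show "\<not> p dvd card (orb N_stab (t \<langle>$\<rangle> a))"
        using card_orb_normal_dvd[OF normal_N_stab subgrp_stab finite_sub[OF stab_sub]] subdegree dvd_trans by blast
    qed
    then show ?thesis ..
  qed
qed

text \<open>The dichotomy for the intersections with the factors, where the second alternative would
  place \<open>T\<close> inside \<open>N_stab\<close>. With \<open>N_stab_product\<close> this makes
  \<open>N_stab\<close> the direct product of the subgroups
  \<open>U \<inter> N_stab\<close>.\<close>

lemma N_stabI:
  assumes n: "n \<in> N" and prs: "\<And>U. U \<in> factors \<Longrightarrow> pr U n \<in> N_stab"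
  shows "n \<in> N_stab"
proof -
  have Int: "subgrp (U \<inter> N_stab)" if "U \<in> factors" for U
    using that factor_subgrp subgrp_N_stab subgrp_Int by blast
  have "(\<forall>n\<in>N. (\<forall>U\<in>factors. pr U n \<in> U \<inter> N_stab) \<longrightarrow> n \<in> N_stab) \<or> (\<forall>U\<in>factors. U \<inter> N_stab = U)"
    using Int
  proof (rule stab_invariant_family)
    fix U v x assume "U \<in> factors" "v \<in> stab a" "x \<in> U \<inter> N_stab"
    then show "conj_by v x \<in> conj_by v ` U \<inter> N_stab" using normal_sub_conj[OF normal_N_stab] by blast
  next
    fix U n assume U: "U \<in> factors" and n: "n \<in> N_stab"
    then show "pr U n \<in> U \<inter> N_stab"
      using N_stab_product pr(1)[OF _ U] by (auto simp: N_stab_iff)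
  qed auto
  then show ?thesis
  proof
    assume "\<forall>n\<in>N. (\<forall>U\<in>factors. pr U n \<in> U \<inter> N_stab) \<longrightarrow> n \<in> N_stab"
    then show ?thesis using n prs pr(1)[OF n] by blast
  next
    assume "\<forall>U\<in>factors. U \<inter> N_stab = U"
    then have TN: "T \<subseteq> N_stab" using T_factor by blast
    have "T \<inter> N_stab = {1}"
    proof (rule T_Int_N_stab)
      fix t s assume "t \<in> T" "s \<in> T \<inter> N_stab"
      then show "conj_by t s \<in> N_stab" using conj_by_in[OF T(3), of t s] TN by auto
    qed
    then have "T = {1}" using TN by (simp add: Int_absorb2)
    then show ?thesis using T(2) by blast
  qed
qed

end

section \<open>The product action\<close>

lemma prod_act_nth:
  assumes "\<sigma> permutes {..<k}" "i < k"
  shows "prod_act k h \<sigma> xs ! \<sigma> i = h i (xs ! i)"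
proof -
  have "\<sigma> i < k" using assms permutes_in_image by fastforce
  then show ?thesis using assms(1) by (simp add: prod_act_def permutes_inverses)
qed

text \<open>\<open>top_group\<close> and \<open>prim_component\<close> range over all
  representations of an element; uniqueness allows them to be computed from a single one. Two
  distinct points of \<open>\<Delta>\<close> are needed for the coordinate permutation to be
  visible.\<close>

lemma represents_unique:
  assumes bij: "bij_betw \<phi> \<Omega> (cube \<Delta> k)" and d: "d \<in> \<Delta>" "e \<in> \<Delta>" "d \<noteq> e"
    and rep: "represents \<Omega> \<Delta> k \<phi> g h \<sigma>" "represents \<Omega> \<Delta> k \<phi> g h' \<sigma>'"
  shows "\<sigma> = \<sigma>'" and "i < k \<Longrightarrow> h i = h' i"
proof -
  have perm: "\<sigma> permutes {..<k}" "\<sigma>' permutes {..<k}"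
    and hperm: "\<And>i. i < k \<Longrightarrow> h i permutes \<Delta>" "\<And>i. i < k \<Longrightarrow> h' i permutes \<Delta>"
    using rep by (auto simp: represents_def wr_elt_def)
  have eq: "prod_act k h \<sigma> xs = prod_act k h' \<sigma>' xs" if xs: "xs \<in> cube \<Delta> k" for xs
  proof -
    have "xs \<in> \<phi> ` \<Omega>" using bij_betw_imp_surj_on[OF bij] xs by simp
    then obtain x where "x \<in> \<Omega>" "\<phi> x = xs" by (elim imageE) simp
    then show ?thesis using rep unfolding represents_def by metis
  qed
  have \<sigma>: "\<sigma> i = \<sigma>' i" if i: "i < k" for i
  proof (rule ccontr)
    assume ne: "\<sigma> i \<noteq> \<sigma>' i"
    have "\<sigma> i \<in> {..<k}" using permutes_in_image[OF perm(1)] i by simp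
    then obtain j where j: "j < k" "\<sigma>' j = \<sigma> i"
      using permutes_image[OF perm(2)] by (metis imageE lessThan_iff)
    have "j \<noteq> i" using ne j by auto
    have *: "h i (xs ! i) = h' j (xs ! j)" if "xs \<in> cube \<Delta> k" for xs
      using eq[OF that] prod_act_nth[OF perm(1) i, of h xs] prod_act_nth[OF perm(2) j(1), of h' xs] j(2) by simp
    \<comment> \<open>The output entry at \<open>\<sigma> i\<close> depends on entry
      \<open>i\<close> in one representation and on entry \<open>j\<close> in the other. Changing
      entry \<open>i\<close> of a constant tuple affects only the former.\<close>
    have "replicate k d \<in> cube \<Delta> k" "(replicate k d)[i := e] \<in> cube \<Delta> k"
      using d set_update_subset_insert[of "replicate k d" i e] by (auto simp: cube_def)
    then have "h i d = h' j d" "h i e = h' j d"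
      using *[of "replicate k d"] *[of "(replicate k d)[i := e]"] i j \<open>j \<noteq> i\<close> by simp_all
    then have "h i d = h i e" by simp
    then show False using d(3) permutes_inj[OF hperm(1)[OF i]] by (auto dest: injD)
  qed
  then show "\<sigma> = \<sigma>'"
    using perm by (metis ext lessThan_iff permutes_not_in)
  assume i: "i < k"
  show "h i = h' i"
  proof
    fix x
    show "h i x = h' i x"
    proof (cases "x \<in> \<Delta>")
      case True
      then have "replicate k x \<in> cube \<Delta> k" by (auto simp: cube_def)
      then show ?thesis
        using eq[of "replicate k x"] prod_act_nth[OF perm(1) i, of h "replicate k x"]
          prod_act_nth[OF perm(2) i, of h' "replicate k x"] \<sigma>[OF i] i by simp
    next
      case False
      then show ?thesis using hperm i permutes_not_in by metis
    qed
  qed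
qed

text \<open>\<open>c\<close> labels the orbits of the centraliser of \<open>T\<close> in
  \<open>N\<close>; on these orbits \<open>N\<close> acts through its projection to
  \<open>T\<close>. The elements \<open>\<gamma> i\<close> identify the other coordinates with the
  first one. Taking them in \<open>stab a\<close> gives \<open>a\<close> equal coordinates, and
  \<open>\<gamma> 0 = 1\<close> makes \<open>c\<close> itself the first coordinate.\<close>

locale product_socle = nonabelian_socle +
  fixes k :: nat and \<tau> :: "nat \<Rightarrow> 'a perm set" and \<gamma> :: "nat \<Rightarrow> 'a perm" and c :: "'a \<Rightarrow> nat"
  assumes k: "k \<ge> 2"
    and bij_\<tau>: "bij_betw \<tau> {..<k} factors" and \<tau>_0: "\<tau> 0 = T"
    and \<gamma>_stab: "i < k \<Longrightarrow> \<gamma> i \<in> stab a" and \<gamma>_conj: "i < k \<Longrightarrow> conj_by (\<gamma> i) ` T = \<tau> i"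
    and \<gamma>_0: "\<gamma> 0 = 1"
    and c_eq_iff: "x \<in> \<Omega> \<Longrightarrow> y \<in> \<Omega> \<Longrightarrow> c x = c y \<longleftrightarrow> (\<exists>z \<in> N \<inter> centraliser T. y = z \<langle>$\<rangle> x)"
begin

section \<open>Coordinates and the action on the first one\<close>

definition \<Delta> :: "nat set" where "\<Delta> = c ` \<Omega>"

definition \<phi> :: "'a \<Rightarrow> nat list" where
  "\<phi> x = map (\<lambda>i. c (inverse (\<gamma> i) \<langle>$\<rangle> x)) [0..<k]"

definition norm_T :: "'a perm set" where
  "norm_T = {u \<in> G. conj_by u ` T = T}"

text \<open>The permutation of the first coordinate induced by an element normalising \<open>T\<close>.\<close>

definition bar :: "'a perm \<Rightarrow> nat \<Rightarrow> nat" where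
  "bar u d = (if d \<in> \<Delta> then c (u \<langle>$\<rangle> (SOME x. x \<in> \<Omega> \<and> c x = d)) else d)"

definition sig :: "'a perm \<Rightarrow> nat \<Rightarrow> nat" where
  "sig g i = (if i < k then inv_into {..<k} \<tau> (conj_by g ` \<tau> i) else i)"

lemma norm_T_sub: "norm_T \<subseteq> G"
  by (auto simp: norm_T_def)

lemma subgrp_norm_T: "subgrp norm_T"
proof (rule subgrpI)
  fix x assume "x \<in> norm_T"
  then have x: "x \<in> G" "conj_by x ` T = T" by (auto simp: norm_T_def)
  have "conj_by (inverse x) ` conj_by x ` T = T" by (rule conj_by_image_cancel)
  then have "conj_by (inverse x) ` T = T" by (simp only: x(2))
  then show "inverse x \<in> norm_T" using subgrp_inverse[OF subgrp_G x(1)] by (simp add: norm_T_def)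
qed (auto simp: norm_T_def conj_by_image_mult subgrp_one[OF subgrp_G] subgrp_mult[OF subgrp_G])

lemma N_sub_norm_T: "N \<subseteq> norm_T"
  using N(4) normal_sub_conj_image[OF T(1) N(3)] by (auto simp: norm_T_def)

text \<open>An element normalising \<open>T\<close> normalises the centraliser of \<open>T\<close>
  in \<open>N\<close>, so it permutes the orbits labelled by \<open>c\<close>. Hence
  \<open>bar\<close> is independent of the representative chosen in its definition.\<close>

lemma norm_T_coord:
  assumes u: "u \<in> norm_T" and xy: "x \<in> \<Omega>" "y \<in> \<Omega>" "c x = c y"
  shows "c (u \<langle>$\<rangle> x) = c (u \<langle>$\<rangle> y)"
proof -
  obtain z where z: "z \<in> N \<inter> centraliser T" "y = z \<langle>$\<rangle> x" using c_eq_iff xy by blast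
  have uG: "u \<in> G" "conj_by u ` T = T" using u by (auto simp: norm_T_def)
  have "conj_by u z \<in> N \<inter> centraliser T"
    using conj_by_centraliser[of z T u] normal_sub_conj[OF N(1) uG(1)] z uG(2) by auto
  moreover have "u \<langle>$\<rangle> y = conj_by u z \<langle>$\<rangle> (u \<langle>$\<rangle> x)" using z(2) by simp
  ultimately show ?thesis using c_eq_iff apply_in[OF uG(1)] xy(1,2) by blast
qed

lemma bar_coord:
  assumes u: "u \<in> norm_T" and x: "x \<in> \<Omega>"
  shows "bar u (c x) = c (u \<langle>$\<rangle> x)"
proof -
  let ?y = "SOME y. y \<in> \<Omega> \<and> c y = c x"
  have "?y \<in> \<Omega> \<and> c ?y = c x" using x by (intro someI[of "\<lambda>y. y \<in> \<Omega> \<and> c y = c x" x]) simp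
  then have "c (u \<langle>$\<rangle> ?y) = c (u \<langle>$\<rangle> x)" using norm_T_coord[OF u] x by blast
  then show ?thesis using x by (simp add: bar_def \<Delta>_def)
qed

lemma bar_mult:
  assumes "u \<in> norm_T" "v \<in> norm_T"
  shows "bar (u * v) = bar u \<circ> bar v"
proof
  fix d
  show "bar (u * v) d = (bar u \<circ> bar v) d"
  proof (cases "d \<in> \<Delta>")
    case True
    then obtain x where x: "x \<in> \<Omega>" "d = c x" by (auto simp: \<Delta>_def)
    have "v \<langle>$\<rangle> x \<in> \<Omega>" using assms x apply_in by (auto simp: norm_T_def)
    then show ?thesis using assms x by (simp add: bar_coord subgrp_mult[OF subgrp_norm_T])
  qed (simp add: bar_def)
qed

lemma bar_one: "bar 1 = id"
proof
  fix d
  show "bar 1 d = id d"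
  proof (cases "d \<in> \<Delta>")
    case True
    then obtain x where "x \<in> \<Omega>" "d = c x" by (auto simp: \<Delta>_def)
    then show ?thesis using bar_coord[OF subgrp_one[OF subgrp_norm_T]] by simp
  qed (simp add: bar_def)
qed

sublocale bar: perm_hom norm_T bar
  by unfold_locales (auto simp: subgrp_norm_T bar_mult bar_one)

lemma bar_permutes:
  assumes "u \<in> norm_T"
  shows "bar u permutes \<Delta>"
proof -
  have "bij (bar u)" using bar.hom_inverse[OF assms] by (intro o_bij)
  then show ?thesis by (simp add: permutes_def bar_def[of u] bij_iff)
qed

lemma bar_in: "u \<in> norm_T \<Longrightarrow> d \<in> \<Delta> \<Longrightarrow> bar u d \<in> \<Delta>"
  using permutes_in_image[OF bar_permutes] by simp

lemma bar_inj: "u \<in> norm_T \<Longrightarrow> bar u d = bar u e \<longleftrightarrow> d = e"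
  using permutes_inj[OF bar_permutes] by (simp add: inj_eq)

lemma bar_centraliser:
  assumes z: "z \<in> N \<inter> centraliser T"
  shows "bar z = id"
proof
  fix d
  have zn: "z \<in> norm_T" using z N_sub_norm_T by blast
  show "bar z d = id d"
  proof (cases "d \<in> \<Delta>")
    case True
    then obtain x where x: "x \<in> \<Omega>" "d = c x" by (auto simp: \<Delta>_def)
    have "c x = c (z \<langle>$\<rangle> x)" using c_eq_iff[of x "z \<langle>$\<rangle> x"] x z N(4) apply_in by blast
    then show ?thesis using x bar_coord[OF zn x(1)] by simp
  qed (simp add: bar_def)
qed

text \<open>\<open>n\<close> differs from its projection by an element of \<open>N\<close>
  centralising \<open>T\<close>, which fixes every label. So \<open>N\<close> acts on
  \<open>\<Delta>\<close> through \<open>T\<close>.\<close>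

lemma bar_pr:
  assumes n: "n \<in> N"
  shows "bar n = bar (pr T n)"
proof -
  have z: "inverse (pr T n) * n \<in> N \<inter> centraliser T"
    using pr[OF n T_factor] T(4) n N(3) by (auto intro: subgrp_mult subgrp_inverse)
  have "bar n = bar (pr T n * (inverse (pr T n) * n))" by simp
  also have "\<dots> = bar (pr T n) \<circ> bar (inverse (pr T n) * n)"
    using z pr(1)[OF n T_factor] T(4) N_sub_norm_T by (intro bar_mult) auto
  finally show ?thesis using bar_centraliser[OF z] by simp
qed

lemma \<gamma>_G: "i < k \<Longrightarrow> \<gamma> i \<in> G" and \<gamma>_a: "i < k \<Longrightarrow> \<gamma> i \<langle>$\<rangle> a = a"
  using \<gamma>_stab by (auto simp: stab_def)

lemma inverse_\<gamma>_a: "i < k \<Longrightarrow> inverse (\<gamma> i) \<langle>$\<rangle> a = a"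
  using \<gamma>_a by (metis apply_inverse_cancel(1))

lemma inverse_\<gamma>_in: "i < k \<Longrightarrow> x \<in> \<Omega> \<Longrightarrow> inverse (\<gamma> i) \<langle>$\<rangle> x \<in> \<Omega>"
  using \<gamma>_G subgrp_inverse[OF subgrp_G] apply_in by blast

lemma inverse_\<gamma>_conj: "i < k \<Longrightarrow> conj_by (inverse (\<gamma> i)) ` \<tau> i = T"
  using \<gamma>_conj[of i] conj_by_image_cancel(1)[of "\<gamma> i" T] by simp

lemma \<tau>_factor: "i < k \<Longrightarrow> \<tau> i \<in> factors"
  using bij_\<tau> by (auto simp: bij_betw_def)

lemma \<tau>_eq_iff: "i < k \<Longrightarrow> j < k \<Longrightarrow> \<tau> i = \<tau> j \<longleftrightarrow> i = j"
  using bij_\<tau> by (auto simp: bij_betw_def inj_on_def)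

lemma factor_\<tau>:
  assumes "U \<in> factors"
  obtains i where "i < k" "U = \<tau> i"
  using assms bij_\<tau> by (auto simp: bij_betw_def)

lemma \<phi>_nth: "i < k \<Longrightarrow> \<phi> x ! i = c (inverse (\<gamma> i) \<langle>$\<rangle> x)"
  and \<phi>_length: "length (\<phi> x) = k"
  by (simp_all add: \<phi>_def)

text \<open>For points \<open>x\<close>, \<open>y\<close> reached from \<open>a\<close> by
  \<open>n\<close>, \<open>m\<close>, equality in coordinate \<open>i\<close> supplies
  \<open>w \<in> N\<close> centralising \<open>\<tau> i\<close> and sending \<open>x\<close> to
  \<open>y\<close>. Inserting \<open>w\<close> into \<open>inverse m * n\<close> gives an element of
  \<open>N_stab\<close> without changing the projection to \<open>\<tau> i\<close>. All projections
  of \<open>inverse m * n\<close> thus lie in \<open>N_stab\<close>, and \<open>N_stabI\<close>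
  applies.\<close>

lemma \<phi>_inj:
  assumes xy: "x \<in> \<Omega>" "y \<in> \<Omega>" and eq: "\<And>i. i < k \<Longrightarrow> c (inverse (\<gamma> i) \<langle>$\<rangle> x) = c (inverse (\<gamma> i) \<langle>$\<rangle> y)"
  shows "x = y"
proof -
  obtain n m where nm: "n \<in> N" "n \<langle>$\<rangle> a = x" "m \<in> N" "m \<langle>$\<rangle> a = y"
    using N_transitive[OF a] xy by blast
  have imN: "inverse m \<in> N" using nm(3) N(3) subgrp_inverse by blast
  have "inverse m * n \<in> N_stab"
  proof (rule N_stabI)
    show "inverse m * n \<in> N" using imN nm(1) N(3) subgrp_mult by blast
    fix U assume U: "U \<in> factors"
    obtain i where i: "i < k" "U = \<tau> i" using factor_\<tau>[OF U] .
    obtain z where z: "z \<in> N \<inter> centraliser T" "inverse (\<gamma> i) \<langle>$\<rangle> y = z \<langle>$\<rangle> (inverse (\<gamma> i) \<langle>$\<rangle> x)"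
      using c_eq_iff eq[OF i(1)] inverse_\<gamma>_in[OF i(1)] xy by blast
    define w where "w = conj_by (\<gamma> i) z"
    have w: "w \<in> N" "w \<in> centraliser U"
      using z(1) normal_sub_conj[OF N(1) \<gamma>_G[OF i(1)]] conj_by_centraliser[of z T "\<gamma> i"] \<gamma>_conj[OF i(1)] i(2)
      by (auto simp: w_def)
    have "\<gamma> i \<langle>$\<rangle> (inverse (\<gamma> i) \<langle>$\<rangle> y) = \<gamma> i \<langle>$\<rangle> (z \<langle>$\<rangle> (inverse (\<gamma> i) \<langle>$\<rangle> x))"
      by (simp only: z(2))
    then have "y = w \<langle>$\<rangle> x" by (simp add: w_def conj_by_def)
    then have "w \<langle>$\<rangle> x = m \<langle>$\<rangle> a" using nm(4) by simp
    then have "(inverse m * (w * n)) \<langle>$\<rangle> a = a" using nm(2) by simp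
    then have "inverse m * (w * n) \<in> N_stab"
      using imN w(1) nm(1) by (simp add: N_stab_iff subgrp_mult[OF N(3)])
    then have "pr U (inverse m * (w * n)) \<in> N_stab" by (rule N_stab_product[OF U])
    moreover have "pr U (inverse m * (w * n)) = pr U (inverse m * n)"
      using imN w nm(1) U by (simp add: pr_mult subgrp_mult[OF N(3)] pr_centraliser)
    ultimately show "pr U (inverse m * n) \<in> N_stab" by simp
  qed
  then have "m \<langle>$\<rangle> ((inverse m * n) \<langle>$\<rangle> a) = m \<langle>$\<rangle> a" by (simp only: N_stab_iff)
  then show ?thesis using nm by simp
qed

lemma bij_\<phi>: "bij_betw \<phi> \<Omega> (cube \<Delta> k)"
proof (rule bij_betw_imageI)
  show "inj_on \<phi> \<Omega>"
    using \<phi>_inj by (intro inj_onI) (metis \<phi>_nth)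
  show "\<phi> ` \<Omega> = cube \<Delta> k"
  proof (intro equalityI subsetI)
    fix xs assume "xs \<in> \<phi> ` \<Omega>"
    then show "xs \<in> cube \<Delta> k" using inverse_\<gamma>_in by (auto simp: cube_def \<phi>_def \<Delta>_def)
  next
    fix xs assume "xs \<in> cube \<Delta> k"
    then have xs: "length xs = k" "\<And>i. i < k \<Longrightarrow> xs ! i \<in> \<Delta>" by (auto simp: cube_def)
    have "\<exists>n\<in>N. xs ! i = c (inverse (\<gamma> i) \<langle>$\<rangle> (n \<langle>$\<rangle> a))" if i: "i < k" for i
    proof -
      obtain y where y: "y \<in> \<Omega>" "xs ! i = c y" using xs(2)[OF i] by (auto simp: \<Delta>_def)
      obtain n where "n \<in> N" "n \<langle>$\<rangle> a = \<gamma> i \<langle>$\<rangle> y" using N_transitive[OF a apply_in[OF \<gamma>_G[OF i] y(1)]] by blast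
      then show ?thesis using y(2) by (intro bexI[of _ n]) auto
    qed
    then obtain m where m: "\<And>i. i < k \<Longrightarrow> m i \<in> N" "\<And>i. i < k \<Longrightarrow> xs ! i = c (inverse (\<gamma> i) \<langle>$\<rangle> (m i \<langle>$\<rangle> a))"
      by metis
    \<comment> \<open>Each \<open>m i\<close> realises only entry \<open>i\<close>, and only its
      projection to \<open>\<tau> i\<close> matters for that entry. A single \<open>n\<close> with
      all these projections realises the whole tuple.\<close>
    define f where "f = (\<lambda>U. pr U (m (inv_into {..<k} \<tau> U)))"
    have f_\<tau>: "f (\<tau> i) = pr (\<tau> i) (m i)" if "i < k" for i
      using that bij_\<tau> by (simp add: f_def bij_betw_def)
    have "f U \<in> U" if "U \<in> factors" for U
      using that by (rule factor_\<tau>) (use f_\<tau> pr(1) m(1) \<tau>_factor in auto)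
    then obtain n where n: "n \<in> N" "\<And>U. U \<in> factors \<Longrightarrow> pr U n = f U" using pr_family[of f] by blast
    have xi: "xs ! i = c (inverse (\<gamma> i) \<langle>$\<rangle> (n \<langle>$\<rangle> a))" if i: "i < k" for i
    proof -
      let ?U = "\<tau> i"
      note U = \<tau>_factor[OF i]
      have im: "inverse (m i) \<in> N" using m(1)[OF i] N(3) subgrp_inverse by blast
      then have d: "n * inverse (m i) \<in> N" using n(1) N(3) subgrp_mult by blast
      \<comment> \<open>So \<open>n\<close> and \<open>m i\<close> differ by an element centralising
        \<open>\<tau> i\<close>. Pulled back by \<open>\<gamma> i\<close> it centralises
        \<open>T\<close>, and the label \<open>c\<close> is unchanged.\<close>
      have "pr ?U (n * inverse (m i)) = 1"
        using n(2)[OF U] f_\<tau>[OF i] m(1)[OF i] U n(1) im by (simp add: pr_mult pr_inverse)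
      then have "n * inverse (m i) \<in> centraliser ?U" using pr(2)[OF d U] by simp
      then have "conj_by (inverse (\<gamma> i)) (n * inverse (m i)) \<in> centraliser T"
        using conj_by_centraliser[of _ ?U "inverse (\<gamma> i)"] inverse_\<gamma>_conj[OF i] by simp
      moreover have "conj_by (inverse (\<gamma> i)) (n * inverse (m i)) \<in> N"
        using normal_sub_conj[OF N(1) subgrp_inverse[OF subgrp_G \<gamma>_G[OF i]] d] .
      moreover have "inverse (\<gamma> i) \<langle>$\<rangle> (n \<langle>$\<rangle> a) =
          conj_by (inverse (\<gamma> i)) (n * inverse (m i)) \<langle>$\<rangle> (inverse (\<gamma> i) \<langle>$\<rangle> (m i \<langle>$\<rangle> a))"
        by simp
      moreover have "inverse (\<gamma> i) \<langle>$\<rangle> (n \<langle>$\<rangle> a) \<in> \<Omega>" "inverse (\<gamma> i) \<langle>$\<rangle> (m i \<langle>$\<rangle> a) \<in> \<Omega>"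
        using n(1) m(1)[OF i] N(4) a apply_in inverse_\<gamma>_in[OF i] by blast+
      ultimately have "c (inverse (\<gamma> i) \<langle>$\<rangle> (m i \<langle>$\<rangle> a)) = c (inverse (\<gamma> i) \<langle>$\<rangle> (n \<langle>$\<rangle> a))"
        using c_eq_iff[of "inverse (\<gamma> i) \<langle>$\<rangle> (m i \<langle>$\<rangle> a)" "inverse (\<gamma> i) \<langle>$\<rangle> (n \<langle>$\<rangle> a)"] by blast
      then show ?thesis using m(2)[OF i] by simp
    qed
    have "\<phi> (n \<langle>$\<rangle> a) = xs" using xs(1) xi by (intro nth_equalityI) (auto simp: \<phi>_length \<phi>_nth)
    moreover have "n \<langle>$\<rangle> a \<in> \<Omega>" using n(1) N(4) a apply_in by blast
    ultimately show "xs \<in> \<phi> ` \<Omega>" by blast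
  qed
qed

section \<open>Representation in the wreath product, top group and component\<close>

lemma sig_less: "g \<in> G \<Longrightarrow> i < k \<Longrightarrow> sig g i < k"
  and \<tau>_sig: "g \<in> G \<Longrightarrow> i < k \<Longrightarrow> \<tau> (sig g i) = conj_by g ` \<tau> i"
proof -
  assume g: "g \<in> G" and i: "i < k"
  have "conj_by g ` \<tau> i \<in> \<tau> ` {..<k}"
    using conj_factor[OF g \<tau>_factor[OF i]] bij_\<tau> by (simp add: bij_betw_def)
  then show "sig g i < k" "\<tau> (sig g i) = conj_by g ` \<tau> i"
    using i inv_into_into[of "conj_by g ` \<tau> i" \<tau> "{..<k}"] by (auto simp: sig_def f_inv_into_f)
qed

lemma sig_permutes:
  assumes g: "g \<in> G"
  shows "sig g permutes {..<k}"
proof (rule bij_imp_permutes)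
  have "inj_on (sig g) {..<k}"
  proof (rule inj_onI)
    fix i j assume ij: "i \<in> {..<k}" "j \<in> {..<k}" "sig g i = sig g j"
    then have "conj_by g ` \<tau> i = conj_by g ` \<tau> j" using \<tau>_sig[OF g] by (metis lessThan_iff)
    then have "conj_by (inverse g) ` conj_by g ` \<tau> i = conj_by (inverse g) ` conj_by g ` \<tau> j" by simp
    then show "i = j" using ij \<tau>_eq_iff by (simp only: conj_by_image_cancel lessThan_iff)
  qed
  moreover have "sig g ` {..<k} \<subseteq> {..<k}" using sig_less[OF g] by auto
  ultimately show "bij_betw (sig g) {..<k} {..<k}"
    by (simp add: bij_betw_def endo_inj_surj)
qed (simp add: sig_def)

lemma sig_N:
  assumes n: "n \<in> N" and g: "g \<in> G"
  shows "sig (n * g) = sig g"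
proof
  fix i
  have "conj_by (n * g) ` \<tau> i = conj_by g ` \<tau> i" if i: "i < k"
    using normal_sub_conj_image[OF factor_normal[OF conj_factor[OF g \<tau>_factor[OF i]]] N(3) n]
    by (simp add: conj_by_image_mult)
  then show "sig (n * g) i = sig g i" by (simp add: sig_def)
qed

lemma sig_0_iff:
  assumes "g \<in> G"
  shows "sig g 0 = 0 \<longleftrightarrow> g \<in> norm_T"
  using \<tau>_sig[OF assms, of 0] sig_less[OF assms, of 0] \<tau>_eq_iff[of "sig g 0" 0] k assms
  by (auto simp: \<tau>_0 norm_T_def)

text \<open>The base group component of \<open>g\<close> at coordinate \<open>i\<close>. Conjugation
  carries \<open>T\<close> to \<open>\<tau> i\<close>, then to \<open>\<tau> (sig g i)\<close>, then
  back to \<open>T\<close>, so the element acts on the common space \<open>\<Delta>\<close>.\<close>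

definition twist :: "'a perm \<Rightarrow> nat \<Rightarrow> 'a perm" where
  "twist g i = inverse (\<gamma> (sig g i)) * (g * \<gamma> i)"

lemma twist_norm_T:
  assumes g: "g \<in> G" and i: "i < k"
  shows "twist g i \<in> norm_T"
proof -
  have "twist g i \<in> G"
    using g \<gamma>_G[OF i] \<gamma>_G[OF sig_less[OF g i]] subgrp_G by (auto simp: twist_def intro!: subgrp_mult subgrp_inverse)
  moreover have "conj_by (twist g i) ` T = T"
    unfolding twist_def conj_by_image_mult \<gamma>_conj[OF i]
    using \<tau>_sig[OF g i] inverse_\<gamma>_conj[OF sig_less[OF g i]] by simp
  ultimately show ?thesis by (simp add: norm_T_def)
qed

lemma coord_apply:
  assumes g: "g \<in> G" and i: "i < k" and x: "x \<in> \<Omega>"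
  shows "c (inverse (\<gamma> (sig g i)) \<langle>$\<rangle> (g \<langle>$\<rangle> x)) = bar (twist g i) (c (inverse (\<gamma> i) \<langle>$\<rangle> x))"
  using bar_coord[OF twist_norm_T[OF g i] inverse_\<gamma>_in[OF i x]] by (simp add: twist_def)

lemma represents_sig:
  assumes g: "g \<in> G"
  shows "represents \<Omega> \<Delta> k \<phi> (apply g) (\<lambda>i. bar (twist g i)) (sig g)"
  unfolding represents_def wr_elt_def
proof (intro conjI allI impI ballI)
  show "bar (twist g i) permutes \<Delta>" if "i < k" for i using bar_permutes twist_norm_T g that by blast
  show "sig g permutes {..<k}" using sig_permutes[OF g] .
  fix x assume x: "x \<in> \<Omega>"
  show "\<phi> (g \<langle>$\<rangle> x) = prod_act k (\<lambda>i. bar (twist g i)) (sig g) (\<phi> x)"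
  proof (rule nth_equalityI)
    show "length (\<phi> (g \<langle>$\<rangle> x)) = length (prod_act k (\<lambda>i. bar (twist g i)) (sig g) (\<phi> x))"
      by (simp add: \<phi>_length prod_act_def)
    fix j assume "j < length (\<phi> (g \<langle>$\<rangle> x))"
    then have "j \<in> {..<k}" by (simp add: \<phi>_length)
    then obtain i where i: "i < k" "j = sig g i"
      using permutes_image[OF sig_permutes[OF g]] by (metis imageE lessThan_iff)
    then show "\<phi> (g \<langle>$\<rangle> x) ! j = prod_act k (\<lambda>i. bar (twist g i)) (sig g) (\<phi> x) ! j"
      using prod_act_nth[OF sig_permutes[OF g] i(1), of "\<lambda>i. bar (twist g i)" "\<phi> x"] sig_less[OF g i(1)] coord_apply[OF g i(1) x]
      by (simp add: \<phi>_nth)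
  qed
qed

lemma in_product_action: "in_product_action \<Omega> (apply ` G) \<Delta> k \<phi>"
  unfolding in_product_action_def using bij_\<phi> represents_sig by blast

lemma c_a_in: "c a \<in> \<Delta>"
  using a by (simp add: \<Delta>_def)

lemma exists_coord: obtains d where "d \<in> \<Delta>" "d \<noteq> c a"
proof -
  have "\<Omega> \<noteq> {a}" using p by auto
  then obtain x where x: "x \<in> \<Omega>" "x \<noteq> a" using a by blast
  then obtain i where i: "i < k" "c (inverse (\<gamma> i) \<langle>$\<rangle> x) \<noteq> c (inverse (\<gamma> i) \<langle>$\<rangle> a)" using \<phi>_inj[OF x(1) a] by blast
  then show thesis using that inverse_\<gamma>_a inverse_\<gamma>_in[OF i(1) x(1)] by (auto simp: \<Delta>_def)
qed

text \<open>By uniqueness of representations, fixing coordinate \<open>0\<close> means normalising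
  \<open>T\<close>. For such \<open>g\<close>, the choice \<open>\<gamma> 0 = 1\<close> makes
  \<open>twist g 0\<close> equal to \<open>g\<close>.\<close>

lemma prim_component_eq: "prim_component \<Omega> (apply ` G) \<Delta> k \<phi> = bar ` norm_T"
proof (intro equalityI subsetI)
  obtain d where d: "d \<in> \<Delta>" "d \<noteq> c a" by (rule exists_coord)
  fix h assume "h \<in> prim_component \<Omega> (apply ` G) \<Delta> k \<phi>"
  then obtain f g \<sigma> where fg: "g \<in> G" "represents \<Omega> \<Delta> k \<phi> (apply g) f \<sigma>" "\<sigma> 0 = 0" "h = f 0"
    by (auto simp: prim_component_def)
  note uniq = represents_unique[OF bij_\<phi> d(1) c_a_in d(2) fg(2) represents_sig[OF fg(1)]]
  have "g \<in> norm_T" using uniq(1) fg(3) sig_0_iff[OF fg(1)] by simp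
  moreover have "h = bar g" using uniq(2)[of 0] uniq(1) fg k by (simp add: twist_def \<gamma>_0)
  ultimately show "h \<in> bar ` norm_T" by blast
next
  fix h assume "h \<in> bar ` norm_T"
  then obtain u where u: "u \<in> norm_T" "h = bar u" by blast
  then have uG: "u \<in> G" "sig u 0 = 0" using sig_0_iff norm_T_sub by auto
  then have "h = bar (twist u 0)" using u by (simp add: twist_def \<gamma>_0)
  then show "h \<in> prim_component \<Omega> (apply ` G) \<Delta> k \<phi>"
    unfolding prim_component_def mem_Collect_eq using represents_sig[OF uG(1)] uG
    by (intro exI[of _ "\<lambda>i. bar (twist u i)"]) blast
qed

lemma top_group_eq: "top_group \<Omega> (apply ` G) \<Delta> k \<phi> = sig ` G"
proof (intro equalityI subsetI)
  obtain d where d: "d \<in> \<Delta>" "d \<noteq> c a" by (rule exists_coord)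
  fix \<sigma> assume "\<sigma> \<in> top_group \<Omega> (apply ` G) \<Delta> k \<phi>"
  then obtain g h where g: "g \<in> G" "represents \<Omega> \<Delta> k \<phi> (apply g) h \<sigma>" by (auto simp: top_group_def)
  then show "\<sigma> \<in> sig ` G"
    using represents_unique(1)[OF bij_\<phi> d(1) c_a_in d(2) g(2) represents_sig[OF g(1)]] by blast
next
  fix \<sigma> assume "\<sigma> \<in> sig ` G"
  then show "\<sigma> \<in> top_group \<Omega> (apply ` G) \<Delta> k \<phi>" unfolding top_group_def using represents_sig by blast
qed

section \<open>Supports and the orbits of the point stabiliser\<close>

definition supp :: "'a \<Rightarrow> nat set" where
  "supp x = {i. i < k \<and> c (inverse (\<gamma> i) \<langle>$\<rangle> x) \<noteq> c a}"

text \<open>\<open>v\<close> and all \<open>\<gamma> i\<close> fix \<open>a\<close>, hence so do the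
  twists of \<open>v\<close>. An entry therefore equals \<open>c a\<close> exactly when its image
  does.\<close>

lemma supp_apply:
  assumes v: "v \<in> stab a" and x: "x \<in> \<Omega>"
  shows "supp (v \<langle>$\<rangle> x) = sig v ` supp x"
proof -
  have vG: "v \<in> G" using v stab_sub by blast
  have iff: "sig v i \<in> supp (v \<langle>$\<rangle> x) \<longleftrightarrow> i \<in> supp x" if i: "i < k" for i
  proof -
    let ?w = "twist v i"
    have w: "?w \<in> norm_T" using twist_norm_T[OF vG i] .
    have "?w \<langle>$\<rangle> a = a"
      using v \<gamma>_a[OF i] inverse_\<gamma>_a[OF sig_less[OF vG i]] by (simp add: twist_def stab_def)
    then have "bar ?w (c a) = c a" using bar_coord[OF w a] by simp
    then have "bar ?w (c (inverse (\<gamma> i) \<langle>$\<rangle> x)) = c a \<longleftrightarrow> c (inverse (\<gamma> i) \<langle>$\<rangle> x) = c a"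
      using bar_inj[OF w] by metis
    then show ?thesis using coord_apply[OF vG i x] sig_less[OF vG i] i by (simp add: supp_def)
  qed
  show ?thesis
  proof (intro equalityI subsetI)
    fix j assume j: "j \<in> supp (v \<langle>$\<rangle> x)"
    then have "j \<in> {..<k}" by (simp add: supp_def)
    then obtain i where "i < k" "j = sig v i"
      using permutes_image[OF sig_permutes[OF vG]] by (metis imageE lessThan_iff)
    then show "j \<in> sig v ` supp x" using iff j by blast
  next
    fix j assume "j \<in> sig v ` supp x"
    then obtain i where i: "i \<in> supp x" "j = sig v i" by blast
    then show "j \<in> supp (v \<langle>$\<rangle> x)" using iff[of i] by (simp add: supp_def)
  qed
qed

lemma orb_stab_sub: "x \<in> \<Omega> \<Longrightarrow> orb (stab a) x \<subseteq> \<Omega>"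
  using stab_sub apply_in by (auto simp: orb_def)

text \<open>Splits a suborbit size into two divisors: the first controls orbits of the top group on
  subsets, the second, for supports inside \<open>{0}\<close>, the subdegrees of the
  component.\<close>

lemma card_supp_fibres:
  assumes x: "x \<in> \<Omega>"
  shows "card (orb (stab a) x) =
    card (supp ` orb (stab a) x) * card {y \<in> orb (stab a) x. supp y = supp x}"
proof (rule card_orb_fibres[OF subgrp_stab finite_sub[OF stab_sub]])
  fix q y z assume "q \<in> stab a" "y \<in> orb (stab a) x" "z \<in> orb (stab a) x" "supp y = supp z"
  moreover from this have "y \<in> \<Omega>" "z \<in> \<Omega>" using orb_stab_sub[OF x] by blast+
  ultimately show "supp (q \<langle>$\<rangle> y) = supp (q \<langle>$\<rangle> z)" by (simp only: supp_apply)
qed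

lemma exists_point:
  assumes "\<And>i. i < k \<Longrightarrow> f i \<in> \<Delta>"
  shows "\<exists>x\<in>\<Omega>. \<forall>i<k. c (inverse (\<gamma> i) \<langle>$\<rangle> x) = f i"
proof -
  have "map f [0..<k] \<in> \<phi> ` \<Omega>" using assms bij_\<phi> by (auto simp: bij_betw_def cube_def)
  then obtain x where x: "x \<in> \<Omega>" "\<phi> x = map f [0..<k]" by auto
  have "c (inverse (\<gamma> i) \<langle>$\<rangle> x) = f i" if "i < k" for i using \<phi>_nth[OF that, of x] x(2) that by simp
  then show ?thesis using x(1) by blast
qed

text \<open>The point \<open>x\<close> with entry \<open>d\<close> on \<open>S\<close> and
  \<open>c a\<close> elsewhere has support \<open>S\<close>. Since \<open>N\<close> lies in the
  kernel of \<open>sig\<close>, the stabiliser of \<open>a\<close> has the same image as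
  \<open>G\<close>, and the orbit of \<open>S\<close> is the set of supports occurring in the
  suborbit of \<open>x\<close>.\<close>

lemma top_orbit_coprime:
  assumes S: "S \<subseteq> {..<k}"
  shows "coprime (card ((\<lambda>\<sigma>. \<sigma> ` S) ` sig ` G)) p"
proof -
  obtain d where d: "d \<in> \<Delta>" "d \<noteq> c a" by (rule exists_coord)
  obtain x where x: "x \<in> \<Omega>" "\<And>i. i < k \<Longrightarrow> c (inverse (\<gamma> i) \<langle>$\<rangle> x) = (if i \<in> S then d else c a)"
    using exists_point[of "\<lambda>i. if i \<in> S then d else c a"] d c_a_in by (metis (full_types))
  have supp: "supp x = S" using x(2) S d(2) by (auto simp: supp_def split: if_splits)
  have "(\<lambda>\<sigma>. \<sigma> ` S) ` sig ` G = supp ` orb (stab a) x"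
  proof (intro equalityI subsetI)
    fix R assume "R \<in> (\<lambda>\<sigma>. \<sigma> ` S) ` sig ` G"
    then obtain g where g: "g \<in> G" "R = sig g ` S" by blast
    obtain n v where nv: "n \<in> N" "v \<in> stab a" "g = n * v" using stab_factorisation[OF g(1)] .
    then have "sig g = sig v" using sig_N[OF nv(1)] stab_sub by blast
    then have "R = supp (v \<langle>$\<rangle> x)" using g(2) supp_apply[OF nv(2) x(1)] supp by simp
    then show "R \<in> supp ` orb (stab a) x" using nv(2) by (auto simp: orb_def)
  next
    fix R assume "R \<in> supp ` orb (stab a) x"
    then obtain v where v: "v \<in> stab a" "R = supp (v \<langle>$\<rangle> x)" by (auto simp: orb_def)
    then have "R = sig v ` S" using supp_apply[OF v(1) x(1)] supp by simp
    then show "R \<in> (\<lambda>\<sigma>. \<sigma> ` S) ` sig ` G" using v(1) stab_sub by blast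
  qed
  moreover have "card (supp ` orb (stab a) x) dvd card (orb (stab a) x)"
    using card_supp_fibres[OF x(1)] by simp
  ultimately have "\<not> p dvd card ((\<lambda>\<sigma>. \<sigma> ` S) ` sig ` G)" using subdegree[OF x(1)] dvd_trans by metis
  then show ?thesis using p(1) prime_imp_coprime coprime_commute by blast
qed

section \<open>Subdegrees of the component\<close>

definition stab_T :: "'a perm set" where
  "stab_T = stab a \<inter> norm_T"

lemma subgrp_stab_T: "subgrp stab_T"
  unfolding stab_T_def using subgrp_stab subgrp_norm_T by (rule subgrp_Int)

lemma finite_stab_T: "finite stab_T"
  using stab_sub by (intro finite_sub) (auto simp: stab_T_def)

text \<open>For support \<open>{0}\<close>, an element of the stabiliser preserves the support
  exactly when it normalises \<open>T\<close>. The \<open>stab_T\<close>-orbit is thus one fibre of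
  \<open>supp\<close>, and its size divides a subdegree. Empty support means
  \<open>x = a\<close>.\<close>

lemma stab_T_orbit:
  assumes x: "x \<in> \<Omega>" and supp: "supp x \<subseteq> {0}"
  shows "\<not> p dvd card (orb stab_T x)"
proof (cases "supp x = {}")
  case True
  have "x = a"
  proof (rule \<phi>_inj[OF x a])
    fix i assume i: "i < k"
    then show "c (inverse (\<gamma> i) \<langle>$\<rangle> x) = c (inverse (\<gamma> i) \<langle>$\<rangle> a)" using True inverse_\<gamma>_a[OF i] by (auto simp: supp_def)
  qed
  then have "orb stab_T x = {a}" using orb_self[OF subgrp_stab_T, of a] by (auto simp: orb_def stab_T_def stab_def)
  then show ?thesis using p(1) by auto
next
  case False
  then have supp: "supp x = {0}" using supp by blast
  have "{y \<in> orb (stab a) x. supp y = supp x} = orb stab_T x"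
  proof (intro equalityI subsetI)
    fix y assume "y \<in> {y \<in> orb (stab a) x. supp y = supp x}"
    then obtain v where v: "v \<in> stab a" "y = v \<langle>$\<rangle> x" "supp (v \<langle>$\<rangle> x) = supp x" by (auto simp: orb_def)
    then have "sig v 0 = 0" using supp_apply[OF v(1) x] supp by simp
    then have "v \<in> stab_T" using sig_0_iff v(1) stab_sub by (auto simp: stab_T_def)
    then show "y \<in> orb stab_T x" using v(2) by (auto simp: orb_def)
  next
    fix y assume "y \<in> orb stab_T x"
    then obtain v where v: "v \<in> stab a" "v \<in> norm_T" "y = v \<langle>$\<rangle> x" by (auto simp: orb_def stab_T_def)
    then have "sig v 0 = 0" using sig_0_iff stab_sub by blast
    then have "supp y = supp x" using supp_apply[OF v(1) x] supp v(3) by simp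
    then show "y \<in> {y \<in> orb (stab a) x. supp y = supp x}" using v by (auto simp: orb_def)
  qed
  then have "card (orb stab_T x) dvd card (orb (stab a) x)" using card_supp_fibres[OF x] by simp
  then show ?thesis using subdegree[OF x] dvd_trans by blast
qed

text \<open>An element of \<open>norm_T\<close> whose image fixes \<open>c a\<close> can be
  corrected to fix \<open>a\<close> itself, by an element of \<open>N\<close> centralising
  \<open>T\<close>, which is invisible on \<open>\<Delta>\<close>. So the suborbit of
  \<open>d\<close> is the image under \<open>c\<close> of a \<open>stab_T\<close>-orbit, with fibres
  of equal size.\<close>

lemma component_subdegree_base:
  assumes d: "d \<in> \<Delta>"
  shows "\<not> p dvd card (stab_orbit (bar ` norm_T) (c a) d)"
proof -
  obtain x where x: "x \<in> \<Omega>" "\<And>i. i < k \<Longrightarrow> c (inverse (\<gamma> i) \<langle>$\<rangle> x) = (if i = 0 then d else c a)"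
    using exists_point[of "\<lambda>i. if i = 0 then d else c a"] d c_a_in by (metis (full_types))
  have cx: "c x = d" using x(2)[of 0] k by (simp add: \<gamma>_0)
  have supp: "supp x \<subseteq> {0}" using x(2) by (auto simp: supp_def split: if_splits)
  have "stab_orbit (bar ` norm_T) (c a) d = c ` orb stab_T x"
  proof (intro equalityI subsetI)
    fix y assume "y \<in> stab_orbit (bar ` norm_T) (c a) d"
    then obtain u where u: "u \<in> norm_T" "bar u (c a) = c a" "y = bar u d" by (auto simp: stab_orbit_def)
    have uG: "u \<in> G" using u(1) norm_T_sub by blast
    have "c (u \<langle>$\<rangle> a) = c a" using u(2) bar_coord[OF u(1) a] by simp
    then obtain z where z: "z \<in> N \<inter> centraliser T" "a = z \<langle>$\<rangle> (u \<langle>$\<rangle> a)"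
      using c_eq_iff[OF apply_in[OF uG a] a] by blast
    have zn: "z \<in> norm_T" using z(1) N_sub_norm_T by blast
    have zu: "z * u \<in> norm_T" using subgrp_mult[OF subgrp_norm_T zn u(1)] .
    then have "z * u \<in> stab_T" using z(2) norm_T_sub by (auto simp: stab_T_def stab_def)
    moreover have "y = c ((z * u) \<langle>$\<rangle> x)"
      using bar_coord[OF zu x(1)] bar_mult[OF zn u(1)] bar_centraliser[OF z(1)] u(3) cx by simp
    ultimately show "y \<in> c ` orb stab_T x" unfolding orb_def by blast
  next
    fix y assume "y \<in> c ` orb stab_T x"
    then obtain v where v: "v \<in> stab a" "v \<in> norm_T" "y = c (v \<langle>$\<rangle> x)" by (auto simp: orb_def stab_T_def)
    have "bar v (c a) = c a" using bar_coord[OF v(2) a] v(1) by (simp add: stab_def)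
    moreover have "y = bar v d" using bar_coord[OF v(2) x(1)] cx v(3) by simp
    ultimately show "y \<in> stab_orbit (bar ` norm_T) (c a) d" using v(2) by (auto simp: stab_orbit_def)
  qed
  moreover have "card (orb stab_T x) = card (c ` orb stab_T x) * card {y \<in> orb stab_T x. c y = c x}"
  proof (rule card_orb_fibres[OF subgrp_stab_T finite_stab_T])
    fix q y z assume "q \<in> stab_T" "y \<in> orb stab_T x" "z \<in> orb stab_T x" "c y = c z"
    moreover have "orb stab_T x \<subseteq> \<Omega>" using x(1) norm_T_sub apply_in by (auto simp: orb_def stab_T_def)
    ultimately show "c (q \<langle>$\<rangle> y) = c (q \<langle>$\<rangle> z)" by (intro norm_T_coord) (auto simp: stab_T_def)
  qed
  ultimately show ?thesis using stab_T_orbit[OF x(1) supp] by (metis dvd_mult2)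
qed

text \<open>\<open>N\<close> is transitive on \<open>\<Delta>\<close>, and conjugating by a suitable
  \<open>n\<close> moves the base point \<open>e\<close> to \<open>c a\<close> without changing
  suborbit sizes.\<close>

lemma component_subdegree: "\<not> has_subdegree_div \<Delta> (bar ` norm_T) p"
proof -
  have "\<not> p dvd card (stab_orbit (bar ` norm_T) e d)" if ed: "e \<in> \<Delta>" "d \<in> \<Delta>" for e d
  proof -
    obtain b where b: "b \<in> \<Omega>" "e = c b" using ed(1) by (auto simp: \<Delta>_def)
    obtain n where n: "n \<in> N" "n \<langle>$\<rangle> a = b" using N_transitive[OF a b(1)] by blast
    have nn: "n \<in> norm_T" using n(1) N_sub_norm_T by blast
    have inn: "inverse n \<in> norm_T" using subgrp_inverse[OF subgrp_norm_T nn] .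
    have ne: "bar n (c a) = e" using bar_coord[OF nn a] n(2) b(2) by simp
    have cancel: "bar n (bar (inverse n) y) = y" "bar (inverse n) (bar n y) = y" for y
      using bar.hom_inverse[OF nn] by (auto simp: fun_eq_iff)
    have ine: "bar (inverse n) e = c a" using cancel(2)[of "c a"] ne by simp
    have "stab_orbit (bar ` norm_T) e d = bar n ` stab_orbit (bar ` norm_T) (c a) (bar (inverse n) d)"
    proof (intro equalityI subsetI)
      fix y assume "y \<in> stab_orbit (bar ` norm_T) e d"
      then obtain u where u: "u \<in> norm_T" "bar u e = e" "y = bar u d" by (auto simp: stab_orbit_def)
      let ?v = "inverse n * (u * n)"
      have un: "u * n \<in> norm_T" using subgrp_mult[OF subgrp_norm_T u(1) nn] .
      have v: "?v \<in> norm_T" using subgrp_mult[OF subgrp_norm_T inn un] .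
      have bv: "bar ?v = bar (inverse n) \<circ> (bar u \<circ> bar n)" using bar_mult[OF inn un] bar_mult[OF u(1) nn] by simp
      have "bar ?v (c a) = c a" using bv ne u(2) ine by simp
      moreover have "y = bar n (bar ?v (bar (inverse n) d))" using bv cancel u(3) by simp
      ultimately show "y \<in> bar n ` stab_orbit (bar ` norm_T) (c a) (bar (inverse n) d)"
        using v unfolding stab_orbit_def by blast
    next
      fix y assume "y \<in> bar n ` stab_orbit (bar ` norm_T) (c a) (bar (inverse n) d)"
      then obtain v where v: "v \<in> norm_T" "bar v (c a) = c a" "y = bar n (bar v (bar (inverse n) d))"
        by (auto simp: stab_orbit_def)
      let ?u = "n * (v * inverse n)"
      have vn: "v * inverse n \<in> norm_T" using subgrp_mult[OF subgrp_norm_T v(1) inn] .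
      have u: "?u \<in> norm_T" using subgrp_mult[OF subgrp_norm_T nn vn] .
      have bu: "bar ?u = bar n \<circ> (bar v \<circ> bar (inverse n))" using bar_mult[OF nn vn] bar_mult[OF v(1) inn] by simp
      have "bar ?u e = e" "y = bar ?u d" using bu ne ine v by simp_all
      then show "y \<in> stab_orbit (bar ` norm_T) e d" using u unfolding stab_orbit_def by blast
    qed
    moreover have "inj_on (bar n) A" for A using bar_inj[OF nn] by (simp add: inj_on_def)
    ultimately show ?thesis
      using component_subdegree_base[OF bar_in[OF inn ed(2)]] by (simp add: card_image)
  qed
  then show ?thesis by (auto simp: has_subdegree_div_def)
qed

text \<open>\<open>t\<close> centralises the other factors, so the remaining coordinates do not see
  it. This brings the points used in \<open>inner_orbits_False\<close> within reach of
  \<open>stab_T_orbit\<close>.\<close>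

lemma supp_T:
  assumes t: "t \<in> T"
  shows "supp (t \<langle>$\<rangle> a) \<subseteq> {0}"
proof
  fix i assume i: "i \<in> supp (t \<langle>$\<rangle> a)"
  show "i \<in> {0}"
  proof (rule ccontr)
    assume "i \<notin> {0}"
    have ik: "i < k" using i by (simp add: supp_def)
    have "\<tau> i \<noteq> T" using \<tau>_eq_iff[OF ik, of 0] \<open>i \<notin> {0}\<close> k \<tau>_0 by simp
    then have "t \<in> centraliser (\<tau> i)" using factors_commute[OF \<tau>_factor[OF ik] T_factor] t by blast
    then have "conj_by (inverse (\<gamma> i)) t \<in> centraliser T"
      using conj_by_centraliser[of t "\<tau> i" "inverse (\<gamma> i)"] inverse_\<gamma>_conj[OF ik] by simp
    moreover have "conj_by (inverse (\<gamma> i)) t \<in> N"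
      using normal_sub_conj[OF N(1) subgrp_inverse[OF subgrp_G \<gamma>_G[OF ik]]] t T(4) by blast
    moreover have "inverse (\<gamma> i) \<langle>$\<rangle> (t \<langle>$\<rangle> a) = conj_by (inverse (\<gamma> i)) t \<langle>$\<rangle> a"
      using inverse_\<gamma>_a[OF ik] conj_by_apply[of "inverse (\<gamma> i)" t a] by simp
    moreover have "inverse (\<gamma> i) \<langle>$\<rangle> (t \<langle>$\<rangle> a) \<in> \<Omega>" using inverse_\<gamma>_in[OF ik] apply_in t T_sub a by blast
    ultimately have "c a = c (inverse (\<gamma> i) \<langle>$\<rangle> (t \<langle>$\<rangle> a))" using c_eq_iff[OF a] by blast
    then show False using i by (simp add: supp_def)
  qed
qed

text \<open>An element \<open>u\<close> centralising \<open>T\<close> and moving the coordinate of \<open>a\<close> yields an element of the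
  stabiliser inducing an inner automorphism of \<open>T\<close> by some \<open>t \<notin> N_stab\<close>. By maximality the
  stabiliser then induces all inner automorphisms of \<open>T\<close>, and suborbits are divisible by \<open>p\<close>.\<close>

lemma bar_centraliser_T:
  assumes u: "u \<in> norm_T" "u \<in> centraliser T"
  shows "bar u = id"
proof -
  \<comment> \<open>The elements of \<open>U\<close> whose inner automorphism of \<open>U\<close> is
    induced by the stabiliser. Projections of \<open>N_stab\<close> belong to it because
    \<open>n\<close> and \<open>pr U n\<close> act alike on \<open>U\<close>.\<close>
  define X where "X = (\<lambda>U. {t \<in> U. \<exists>v\<in>stab a. \<forall>s\<in>U. conj_by v s = conj_by t s})"
  have "(\<forall>n\<in>N. (\<forall>U\<in>factors. pr U n \<in> X U) \<longrightarrow> n \<in> N_stab) \<or> (\<forall>U\<in>factors. X U = U)"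
  proof (rule stab_invariant_family)
    fix U assume U: "U \<in> factors"
    show "X U \<subseteq> U" by (auto simp: X_def)
    show "subgrp (X U)"
    proof (rule subgrpI)
      show "1 \<in> X U" using subgrp_one[OF factor_subgrp[OF U]] subgrp_one[OF subgrp_stab, of a]
        by (auto simp: X_def intro!: bexI[of _ 1])
    next
      fix x y assume x: "x \<in> X U" and y: "y \<in> X U"
      obtain v where v: "v \<in> stab a" "\<forall>s\<in>U. conj_by v s = conj_by x s" using x by (auto simp: X_def)
      obtain w where w: "w \<in> stab a" "\<forall>s\<in>U. conj_by w s = conj_by y s" using y by (auto simp: X_def)
      have xy: "x \<in> U" "y \<in> U" using x y by (auto simp: X_def)
      have "\<forall>s\<in>U. conj_by (v * w) s = conj_by (x * y) s"
        using v w xy conj_by_in[OF factor_subgrp[OF U]] by (simp add: conj_by_by_mult)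
      then show "x * y \<in> X U"
        using subgrp_mult[OF subgrp_stab v(1) w(1)] subgrp_mult[OF factor_subgrp[OF U] xy] by (auto simp: X_def)
    next
      fix x assume x: "x \<in> X U"
      obtain v where v: "v \<in> stab a" "\<forall>s\<in>U. conj_by v s = conj_by x s" using x by (auto simp: X_def)
      have xU: "x \<in> U" "inverse x \<in> U" using x subgrp_inverse[OF factor_subgrp[OF U]] by (auto simp: X_def)
      have "conj_by (inverse v) s = conj_by (inverse x) s" if s: "s \<in> U" for s
      proof -
        have "conj_by (inverse x) s \<in> U" using conj_by_in[OF factor_subgrp[OF U] xU(2) s] .
        then have "conj_by v (conj_by (inverse x) s) = s" using v(2) by simp
        then show ?thesis by (metis conj_by_cancel(1))
      qed
      then show "inverse x \<in> X U" using subgrp_inverse[OF subgrp_stab v(1)] xU(2) by (auto simp: X_def)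
    qed
    fix v x assume v: "v \<in> stab a" and x: "x \<in> X U"
    obtain w where w: "w \<in> stab a" "\<forall>s\<in>U. conj_by w s = conj_by x s" using x by (auto simp: X_def)
    have "conj_by (conj_by v w) (conj_by v s) = conj_by (conj_by v x) (conj_by v s)" if "s \<in> U" for s
    proof -
      have "conj_by (conj_by v y) (conj_by v s) = conj_by v (conj_by y s)" for y
        by (simp add: conj_by_def mult.assoc)
      then show ?thesis using w(2) that by simp
    qed
    then show "conj_by v x \<in> X (conj_by v ` U)"
      using x conj_by_in[OF subgrp_stab v w(1)] by (auto simp: X_def)
  next
    fix U n assume U: "U \<in> factors" and n: "n \<in> N_stab"
    then show "pr U n \<in> X U"
      using pr(1)[of n U] pr_conj_self[of n U] by (auto simp: X_def N_stab_def)
  qed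
  then show ?thesis
  proof
    assume N_stab: "\<forall>n\<in>N. (\<forall>U\<in>factors. pr U n \<in> X U) \<longrightarrow> n \<in> N_stab"
    have X_sub: "t \<in> N_stab" if t: "t \<in> X T" for t
    proof -
      have tT: "t \<in> T" using t by (simp add: X_def)
      have "pr U t \<in> X U" if U: "U \<in> factors" for U
      proof (cases "U = T")
        case True
        then show ?thesis using t pr_self[OF T_factor tT] by simp
      next
        case False
        then have "pr U t = 1" using pr_other[OF U T_factor _ tT] by simp
        then show ?thesis
          using subgrp_one[OF factor_subgrp[OF U]] subgrp_one[OF subgrp_stab, of a]
          by (auto simp: X_def intro!: bexI[of _ 1])
      qed
      then show ?thesis using N_stab tT T(4) by blast
    qed
    have uG: "u \<in> G" using u(1) norm_T_sub by blast
    \<comment> \<open>\<open>inverse m * u\<close> fixes \<open>a\<close>. As \<open>u\<close>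
      centralises \<open>T\<close>, it acts on \<open>T\<close> like \<open>inverse m\<close>, that
      is, like the inverse of the projection \<open>s\<close>.\<close>
    obtain m where m: "m \<in> N" "m \<langle>$\<rangle> a = u \<langle>$\<rangle> a" using N_transitive[OF a apply_in[OF uG a]] by blast
    define s where "s = pr T m"
    have s: "s \<in> T" "inverse s \<in> T"
      using pr(1)[OF m(1) T_factor] subgrp_inverse[OF T(3)] by (auto simp: s_def)
    have imN: "inverse m \<in> N" using m(1) N(3) subgrp_inverse by blast
    have "inverse m * u \<in> stab a"
      using imN N(4) uG subgrp_mult[OF subgrp_G] by (auto simp: stab_def simp flip: m(2))
    moreover have "conj_by (inverse m * u) t = conj_by (inverse s) t" if t: "t \<in> T" for t
      using centraliserD[OF u(2) t] pr_conj_self[OF imN T_factor t] pr_inverse[OF m(1) T_factor]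
      by (simp add: conj_by_by_mult s_def)
    ultimately have "inverse s \<in> X T" using s(2) by (auto simp: X_def)
    then have "inverse s \<in> N_stab" by (rule X_sub)
    then have "s \<in> N_stab" using subgrp_inverse[OF subgrp_N_stab] by fastforce
    then have sa: "s \<langle>$\<rangle> a = a" by (simp add: N_stab_iff)
    have sn: "s \<in> norm_T" "m \<in> norm_T" using s(1) m(1) T(4) N_sub_norm_T by auto
    have "bar u (c a) = c a"
      using bar_coord[OF u(1) a] bar_coord[OF sn(2) a] m(2) bar_pr[OF m(1)] bar_coord[OF sn(1) a] sa
      by (simp add: s_def)
    \<comment> \<open>Every \<open>d\<close> is the image of \<open>c a\<close> under some element
      of \<open>T\<close>, and \<open>bar u\<close> commutes with the action of \<open>T\<close>.
      Fixing \<open>c a\<close> therefore forces fixing \<open>d\<close>.\<close>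
    have "bar u d = d" if d: "d \<in> \<Delta>" for d
    proof -
      obtain x where x: "x \<in> \<Omega>" "d = c x" using d by (auto simp: \<Delta>_def)
      obtain n where n: "n \<in> N" "n \<langle>$\<rangle> a = x" using N_transitive[OF a x(1)] by blast
      have nn: "n \<in> norm_T" "pr T n \<in> norm_T" using n(1) pr(1)[OF n(1) T_factor] T(4) N_sub_norm_T by auto
      have dn: "d = bar (pr T n) (c a)" using bar_coord[OF nn(1) a] n(2) x(2) bar_pr[OF n(1)] by simp
      have "u * pr T n = pr T n * u"
        using centraliserD[OF u(2) pr(1)[OF n(1) T_factor]] by (simp add: conj_by_eq_self_iff)
      then have "bar u \<circ> bar (pr T n) = bar (pr T n) \<circ> bar u"
        using bar_mult[OF u(1) nn(2)] bar_mult[OF nn(2) u(1)] by simp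
      then show ?thesis using dn \<open>bar u (c a) = c a\<close> by (metis comp_apply)
    qed
    then show ?thesis by (auto simp: bar_def fun_eq_iff)
  next
    assume "\<forall>U\<in>factors. X U = U"
    then have X: "X T = T" using T_factor by blast
    \<comment> \<open>The stabiliser may permute the factors, so invariance of \<open>D\<close> is
      sought only under \<open>stab_T\<close>. The required orbit sizes are controlled there, since
      the points in question have support inside \<open>{0}\<close>.\<close>
    define D where "D = {v \<in> stab_T. \<exists>s\<in>T. \<forall>t\<in>T. conj_by v t = conj_by s t}"
    have D: "normal_sub D stab_T"
    proof (intro normal_subI subgrpI)
      show "1 \<in> D" using subgrp_one[OF subgrp_stab_T] subgrp_one[OF T(3)]
        by (auto simp: D_def intro!: bexI[of _ 1])
    next
      fix x y assume x: "x \<in> D" and y: "y \<in> D"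
      obtain r where r: "r \<in> T" "\<forall>t\<in>T. conj_by x t = conj_by r t" using x by (auto simp: D_def)
      obtain s where s: "s \<in> T" "\<forall>t\<in>T. conj_by y t = conj_by s t" using y by (auto simp: D_def)
      have "\<forall>t\<in>T. conj_by (x * y) t = conj_by (r * s) t"
        using r s conj_by_in[OF T(3)] by (simp add: conj_by_by_mult)
      then show "x * y \<in> D" using x y subgrp_mult[OF subgrp_stab_T] subgrp_mult[OF T(3) r(1) s(1)]
        unfolding D_def by blast
    next
      fix x assume x: "x \<in> D"
      obtain r where r: "r \<in> T" "\<forall>t\<in>T. conj_by x t = conj_by r t" using x by (auto simp: D_def)
      have ir: "inverse r \<in> T" using r(1) T(3) subgrp_inverse by blast
      have "conj_by (inverse x) t = conj_by (inverse r) t" if t: "t \<in> T" for t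
      proof -
        have "conj_by x (conj_by (inverse r) t) = t" using r(2) conj_by_in[OF T(3) ir t] by simp
        then show ?thesis by (metis conj_by_cancel(1))
      qed
      then show "inverse x \<in> D" using x ir subgrp_inverse[OF subgrp_stab_T] unfolding D_def by blast
    next
      fix g x assume g: "g \<in> stab_T" and x: "x \<in> D"
      obtain r where r: "r \<in> T" "\<forall>t\<in>T. conj_by x t = conj_by r t" using x by (auto simp: D_def)
      have gT: "conj_by g ` T = T" using g by (simp add: stab_T_def norm_T_def)
      have dist: "conj_by (conj_by g y) (conj_by g s) = conj_by g (conj_by y s)" for y s
        by (simp add: conj_by_def mult.assoc)
      have "conj_by (conj_by g x) t = conj_by (conj_by g r) t" if t: "t \<in> T" for t
      proof -
        have "t \<in> conj_by g ` T" using gT t by simp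
        then obtain s where "s \<in> T" "t = conj_by g s" by (elim imageE) simp
        then show ?thesis using r(2) dist by simp
      qed
      moreover have "conj_by g r \<in> T" using gT r(1) by blast
      moreover have "conj_by g x \<in> stab_T" using g x conj_by_in[OF subgrp_stab_T] by (simp add: D_def)
      ultimately show "conj_by g x \<in> D" unfolding D_def by blast
    qed (auto simp: D_def)
    have False
    proof (rule inner_orbits_False[of D])
      show "D \<subseteq> stab a" by (auto simp: D_def stab_T_def)
      show "\<exists>s\<in>T. \<forall>t\<in>T. conj_by d t = conj_by s t" if "d \<in> D" for d using that by (simp add: D_def)
      show "\<exists>d\<in>D. \<forall>t\<in>T. conj_by d t = conj_by s t" if s: "s \<in> T" for s
      proof -
        obtain v where v: "v \<in> stab a" "\<forall>t\<in>T. conj_by v t = conj_by s t" using s X by (auto simp: X_def)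
        have "conj_by v ` T = conj_by s ` T" using v(2) by (intro image_cong) auto
        also have "\<dots> = T" using normal_sub_conj_image[OF T(1) N(3)] s T(4) by blast
        finally have "v \<in> stab_T" using v(1) stab_sub by (auto simp: stab_T_def norm_T_def)
        then show ?thesis using v(2) s unfolding D_def by blast
      qed
      fix t assume t: "t \<in> T"
      then have "t \<langle>$\<rangle> a \<in> \<Omega>" using T_sub a apply_in by blast
      then show "\<not> p dvd card (orb D (t \<langle>$\<rangle> a))"
        using stab_T_orbit[OF _ supp_T[OF t]] card_orb_normal_dvd[OF D subgrp_stab_T finite_stab_T] dvd_trans by blast
    qed
    then show ?thesis ..
  qed
qed

lemma component_almost_simple: "almost_simple (bar ` norm_T)"
proof (rule bar.almost_simple_image)
  show "normal_sub T norm_T"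
    using T(3,4) N_sub_norm_T by (intro normal_subI) (auto simp: norm_T_def)
  show "finite T" using finite_sub[OF T_sub] .
  show "\<not> T \<subseteq> centraliser T" by (rule T_nonabelian)
  show "M = {1} \<or> M = T" if "normal_sub M T" for M using that by (rule T_simple)
  show "bar u = id" if "u \<in> norm_T" "u \<in> centraliser T" for u using that by (rule bar_centraliser_T)
  have T_norm: "T \<subseteq> norm_T" using T(4) N_sub_norm_T by blast
  \<comment> \<open>The kernel of \<open>bar\<close> on \<open>T\<close>. It is normal in the simple
    group \<open>T\<close>, and it is not \<open>T\<close> because \<open>N\<close> moves
    \<open>c a\<close> to a second label and acts on labels through \<open>T\<close>.\<close>
  define K where "K = {t \<in> T. bar t = id}"
  have "normal_sub K T"
  proof (intro normal_subI subgrpI)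
    fix g m assume g: "g \<in> T" and m: "m \<in> K"
    have gm: "g \<in> norm_T" "m \<in> norm_T" "m \<in> T" "bar m = id" using g m T_norm by (auto simp: K_def)
    have "bar (conj_by g m) = bar g \<circ> bar m \<circ> bar (inverse g)" using bar.conj_image[OF gm(1,2)] by simp
    also have "\<dots> = id" using bar.hom_inverse(2)[OF gm(1)] gm(4) by simp
    finally show "conj_by g m \<in> K" using conj_by_in[OF T(3) g gm(3)] by (simp add: K_def)
  next
    fix x assume x: "x \<in> K"
    then have "x \<in> norm_T" "bar x = id" using T_norm by (auto simp: K_def)
    then have "bar (inverse x) = id" using bar.hom_inverse(1)[of x] by simp
    then show "inverse x \<in> K" using x subgrp_inverse[OF T(3)] by (simp add: K_def)
  next
    fix x y assume xy: "x \<in> K" "y \<in> K"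
    then have "x \<in> norm_T" "y \<in> norm_T" using T_norm by (auto simp: K_def)
    then show "x * y \<in> K" using xy subgrp_mult[OF T(3)] by (simp add: K_def bar_mult)
  qed (auto simp: K_def bar_one subgrp_one[OF T(3)])
  moreover have "K \<noteq> T"
  proof
    assume KT: "K = T"
    obtain d where d: "d \<in> \<Delta>" "d \<noteq> c a" by (rule exists_coord)
    then obtain x where x: "x \<in> \<Omega>" "d = c x" by (auto simp: \<Delta>_def)
    obtain n where n: "n \<in> N" "n \<langle>$\<rangle> a = x" using N_transitive[OF a x(1)] by blast
    have "pr T n \<in> K" using pr(1)[OF n(1) T_factor] KT by simp
    then have "bar n = id" using bar_pr[OF n(1)] by (simp add: K_def)
    moreover have "n \<in> norm_T" using n(1) N_sub_norm_T by blast
    ultimately have "c x = c a" using bar_coord[OF _ a, of n] n(2) by simp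
    then show False using d(2) x(2) by simp
  qed
  ultimately have "K = {1}" using T_simple by blast
  then show "t = 1" if "t \<in> T" "bar t = id" for t using that unfolding K_def by blast
qed

end

section \<open>Construction of the coordinate data\<close>

lemma (in nonabelian_socle) exists_product_socle:
  assumes "factors \<noteq> {T}"
  obtains k \<tau> \<gamma> c where "product_socle \<Omega> G N T a p k \<tau> \<gamma> c"
proof -
  define k where "k = card factors"
  have "k \<ge> 2"
  proof (rule ccontr)
    assume "\<not> k \<ge> 2"
    then have "card factors \<le> card {T}" by (simp add: k_def)
    then have "{T} = factors" using T_factor finite_factors by (intro card_seteq) auto
    then show False using assms by simp
  qed
  have "card (factors - {T}) = card {1..<k}"
    using T_factor finite_factors by (simp add: k_def)
  then obtain \<tau>' where \<tau>': "bij_betw \<tau>' {1..<k} (factors - {T})"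
    using finite_same_card_bij[of "{1..<k}" "factors - {T}"] finite_factors by auto
  define \<tau> where "\<tau> = \<tau>'(0 := T)"
  have "bij_betw \<tau> {1..<k} (factors - {T})"
    using \<tau>' by (rule bij_betw_cong[THEN iffD1, rotated]) (simp add: \<tau>_def)
  moreover have "bij_betw \<tau> {0} {T}" by (simp add: \<tau>_def bij_betw_def)
  ultimately have "bij_betw \<tau> ({1..<k} \<union> {0}) (factors - {T} \<union> {T})"
    by (rule bij_betw_combine) auto
  moreover have "{1..<k} \<union> {0} = {..<k}" "factors - {T} \<union> {T} = factors" using \<open>k \<ge> 2\<close> T_factor by auto
  ultimately have bij: "bij_betw \<tau> {..<k} factors" by simp
  \<comment> \<open>In a factorisation of \<open>inverse g\<close> into \<open>n\<close> and
    \<open>v\<close>, the part from \<open>N\<close> normalises \<open>T\<close>. So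
    \<open>inverse v\<close>, which fixes \<open>a\<close>, already carries \<open>T\<close> to
    \<open>U\<close>.\<close>
  have "\<exists>v\<in>stab a. conj_by v ` T = U" if U: "U \<in> factors" for U
  proof -
    obtain g where g: "g \<in> G" "U = conj_by g ` T" using U by (auto simp: factors_def)
    have ig: "inverse g \<in> G" using g(1) subgrp_G subgrp_inverse by blast
    obtain n v where nv: "n \<in> N" "v \<in> stab a" "inverse g = n * v" using stab_factorisation[OF ig] .
    have "g = inverse (n * v)" using nv(3) by (metis perm.inverse_inverse)
    then have "g = inverse v * inverse n" by simp
    moreover have "conj_by (inverse n) ` T = T"
      using normal_sub_conj_image[OF T(1) N(3) subgrp_inverse[OF N(3) nv(1)]] .
    ultimately have "conj_by (inverse v) ` T = U" using g(2) by (simp add: conj_by_image_mult)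
    then show ?thesis using subgrp_inverse[OF subgrp_stab nv(2)] by blast
  qed
  then obtain \<delta> where \<delta>: "\<And>U. U \<in> factors \<Longrightarrow> \<delta> U \<in> stab a" "\<And>U. U \<in> factors \<Longrightarrow> conj_by (\<delta> U) ` T = U"
    by metis
  define \<gamma> where "\<gamma> = (\<lambda>i. if i = 0 then 1 else \<delta> (\<tau> i))"
  have \<tau>_0: "\<tau> 0 = T" by (simp add: \<tau>_def)
  have \<tau>f: "\<tau> i \<in> factors" if "i < k" for i using bij that by (auto simp: bij_betw_def)
  let ?Z = "N \<inter> centraliser T"
  have Z: "subgrp ?Z" using N(3) subgrp_centraliser by (rule subgrp_Int)
  have "finite (orb ?Z ` \<Omega>)" using finite_space by simp
  then obtain e :: "'a set \<Rightarrow> nat" where e: "inj_on e (orb ?Z ` \<Omega>)"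
    using finite_imp_inj_to_nat_seg[of "orb ?Z ` \<Omega>"] by metis
  \<comment> \<open>The natural coordinate is an orbit, a set of points; a finite injection encodes
    these sets as the natural numbers that \<open>\<Delta>\<close> has to consist of.\<close>
  define c where "c = (\<lambda>x. e (orb ?Z x))"
  have c: "c x = c y \<longleftrightarrow> (\<exists>z \<in> ?Z. y = z \<langle>$\<rangle> x)" if xy: "x \<in> \<Omega>" "y \<in> \<Omega>" for x y
  proof -
    have "c x = c y \<longleftrightarrow> orb ?Z x = orb ?Z y" unfolding c_def using e xy by (auto dest: inj_onD)
    also have "\<dots> \<longleftrightarrow> y \<in> orb ?Z x" using orb_eq[OF Z] orb_self[OF Z] by metis
    finally show ?thesis by (auto simp: orb_def)
  qed
  have "product_socle \<Omega> G N T a p k \<tau> \<gamma> c"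
    by unfold_locales
      (use \<open>k \<ge> 2\<close> bij \<tau>_0 \<delta> \<tau>f c subgrp_one[OF subgrp_stab] in \<open>auto simp: \<gamma>_def\<close>)
  then show thesis by (rule that)
qed

section \<open>Passage to the given permutation group and conclusion\<close>

lemma prim_groupI:
  assumes fin: "finite \<Omega>" and prim: "primitive \<Omega> G"
  shows "prim_group \<Omega> {g. apply g \<in> G}" and "apply ` {g. apply g \<in> G} = G"
proof -
  have perm: "\<And>g. g \<in> G \<Longrightarrow> g permutes \<Omega>" and grp: "group (pgrp G)"
    using prim by (auto simp: primitive_def perm_group_def)
  interpret group "pgrp G" by (fact grp)
  \<comment> \<open>A permutation of the finite set \<open>\<Omega>\<close> moves only finitely many
    points, so it comes from the type of finitely supported permutations.\<close>
  have Perm: "apply (Perm g) = g" if "g \<in> G" for g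
  proof (rule Perm_inverse)
    have "finite {x. g x \<noteq> x}"
      by (rule finite_subset[OF _ fin]) (use permutes_not_in[OF perm[OF that]] in blast)
    then show "g \<in> {f. bij f \<and> finite {x. f x \<noteq> x}}" using permutes_bij[OF perm[OF that]] by simp
  qed
  show im: "apply ` {g. apply g \<in> G} = G"
  proof (intro equalityI subsetI)
    fix g assume "g \<in> G"
    then show "g \<in> apply ` {g. apply g \<in> G}" using Perm by (intro image_eqI[of _ _ "Perm g"]) auto
  qed auto
  have tr: "transitive_on \<Omega> G" using prim by (simp add: primitive_def)
  show "prim_group \<Omega> {g. apply g \<in> G}"
  proof
    show "finite \<Omega>" by (fact fin)
    show "subgrp {g. apply g \<in> G}"
    proof (rule subgrpI)
      show "1 \<in> {g. apply g \<in> G}" using one_closed by (simp add: pgrp_def)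
    next
      fix x y assume "x \<in> {g. apply g \<in> G}" "y \<in> {g. apply g \<in> G}"
      then show "x * y \<in> {g. apply g \<in> G}" using m_closed[of "apply x" "apply y"] by (simp add: pgrp_def apply_times)
    next
      fix x assume x: "x \<in> {g. apply g \<in> G}"
      let ?y = "inv\<^bsub>pgrp G\<^esub> (apply x)"
      have y: "?y \<in> G" "?y \<circ> apply x = id"
        using inv_closed[of "apply x"] l_inv[of "apply x"] x by (auto simp: pgrp_def)
      \<comment> \<open>The inverse in \<open>pgrp G\<close> is so far only a left inverse under
        composition; composing with the permutation inverse on the right shows that the two
        agree.\<close>
      have "apply (inverse x) = ?y \<circ> (apply x \<circ> apply (inverse x))"
        using y(2) by (simp flip: comp_assoc)
      also have "\<dots> = ?y" by (simp flip: apply_times)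
      finally show "inverse x \<in> {g. apply g \<in> G}" using y(1) by simp
    qed
    show "affected g \<subseteq> \<Omega>" if "g \<in> {g. apply g \<in> G}" for g
    proof
      fix x assume "x \<in> affected g"
      then show "x \<in> \<Omega>" using permutes_not_in[OF perm, of "apply g" x] that by (auto simp: in_affected)
    qed
    show "\<exists>g\<in>{g. apply g \<in> G}. g \<langle>$\<rangle> x = y" if xy: "x \<in> \<Omega>" "y \<in> \<Omega>" for x y
    proof -
      obtain g where "g \<in> G" "g x = y" using tr xy unfolding transitive_on_def by blast
      then show ?thesis using Perm by (intro bexI[of _ "Perm g"]) auto
    qed
    fix B assume B: "B \<subseteq> \<Omega>"
      "\<And>g. g \<in> {g. apply g \<in> G} \<Longrightarrow> apply g ` B = B \<or> apply g ` B \<inter> B = {}"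
    have "g ` B = B \<or> g ` B \<inter> B = {}" if "g \<in> G" for g
      using B(2)[of "Perm g"] Perm[OF that] that by simp
    then have "is_block \<Omega> G B" using B(1) by (simp add: is_block_def)
    then show "B = {} \<or> card B = 1 \<or> B = \<Omega>" using prim by (simp add: primitive_def)
  qed
qed

theorem theorem3p4:
  fixes \<Omega> :: "'a set" and G :: "('a \<Rightarrow> 'a) set" and p :: nat
  assumes "finite \<Omega>"
    and "primitive \<Omega> G"
    and "prime p"
    and "p dvd card \<Omega>"
  shows "has_subdegree_div \<Omega> G p
      \<or> almost_simple G \<or> affine \<Omega> G
      \<or> (\<exists>(\<Delta>::nat set) k \<phi>. k \<ge> 2 \<and> in_product_action \<Omega> G \<Delta> k \<phi> \<and>
            almost_simple (prim_component \<Omega> G \<Delta> k \<phi>) \<and>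
            \<not> has_subdegree_div \<Delta> (prim_component \<Omega> G \<Delta> k \<phi>) p \<and>
            (\<forall>r\<le>k. \<forall>S. S \<subseteq> {..<k} \<and> card S = r \<longrightarrow>
               coprime (card ((\<lambda>\<sigma>. \<sigma> ` S) ` top_group \<Omega> G \<Delta> k \<phi>)) p))"
proof (cases "has_subdegree_div \<Omega> G p")
  case False
  define \<Gamma> where "\<Gamma> = {g. apply g \<in> G}"
  interpret prim_group \<Omega> \<Gamma> unfolding \<Gamma>_def using assms(1,2) by (rule prim_groupI)
  have G: "apply ` \<Gamma> = G" unfolding \<Gamma>_def using assms(1,2) by (rule prim_groupI)
  obtain a where a: "a \<in> \<Omega>" using assms(2) by (auto simp: primitive_def transitive_on_def)
  have sub: "\<not> p dvd card (orb (stab a) x)" if x: "x \<in> \<Omega>" for x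
  proof -
    have "orb (stab a) x = stab_orbit G a x"
      unfolding orb_def stab_def stab_orbit_def G[symmetric] by auto
    then show ?thesis using False a x by (auto simp: has_subdegree_div_def)
  qed
  have "\<Gamma> \<noteq> {1}"
  proof
    assume "\<Gamma> = {1}"
    then have "x = a" if "x \<in> \<Omega>" for x using transitive[OF a that] by auto
    then have "\<Omega> = {a}" using a by blast
    then show False using assms(3,4) by simp
  qed
  then obtain N where N: "min_normal N \<Gamma>" using exists_min_normal[OF subgrp_G finite_G] by blast
  note N' = min_normalD[OF N]
  show ?thesis
  proof (cases "N \<subseteq> centraliser N")
    case True
    then show ?thesis using abelian_affine[OF N] a G by auto
  next
    case nonab: False
    have cent: "\<Gamma> \<inter> centraliser N = {1}"
      using centraliser_trivial[OF N nonab a assms(3,4)] sub by blast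
    obtain T where T: "min_normal T N"
      using exists_min_normal[OF N'(3) finite_sub[OF N'(4)] N'(2)] by blast
    interpret nonabelian_socle \<Omega> \<Gamma> N T a p
      by unfold_locales (use N T cent a assms(3,4) sub in auto)
    show ?thesis
    proof (cases "factors = {T}")
      case True
      \<comment> \<open>With a single factor, \<open>T\<close> is invariant under the whole group
        and minimality of \<open>N\<close> gives \<open>T = N\<close>. Its trivial centraliser then
        makes the group almost simple.\<close>
      have "normal_sub T \<Gamma>"
      proof (rule normal_subI)
        show "subgrp T" "T \<subseteq> \<Gamma>" using T(3) T_sub by auto
        fix g t assume "g \<in> \<Gamma>" "t \<in> T"
        then show "conj_by g t \<in> T" using conj_factor[OF _ T_factor] True by blast
      qed
      then have TN: "T = N" using N'(5) T(2,4) by blast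
      interpret perm_hom \<Gamma> "apply" by unfold_locales (auto simp: subgrp_G apply_times)
      have "almost_simple (apply ` \<Gamma>)"
      proof (rule almost_simple_image[OF N'(1) finite_sub[OF N'(4)] _ nonab])
        show "M = {1} \<or> M = N" if "normal_sub M N" for M using T_simple that TN by blast
        show "apply u = id" if "u \<in> \<Gamma>" "u \<in> centraliser N" for u using cent that by auto
      qed simp
      then show ?thesis using G by simp
    next
      case False
      then obtain k \<tau> \<gamma> c where "product_socle \<Omega> \<Gamma> N T a p k \<tau> \<gamma> c"
        by (rule exists_product_socle)
      then interpret product_socle \<Omega> \<Gamma> N T a p k \<tau> \<gamma> c .
      have "k \<ge> 2 \<and> in_product_action \<Omega> G \<Delta> k \<phi> \<and>
          almost_simple (prim_component \<Omega> G \<Delta> k \<phi>) \<and>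
          \<not> has_subdegree_div \<Delta> (prim_component \<Omega> G \<Delta> k \<phi>) p \<and>
          (\<forall>r\<le>k. \<forall>S. S \<subseteq> {..<k} \<and> card S = r \<longrightarrow>
             coprime (card ((\<lambda>\<sigma>. \<sigma> ` S) ` top_group \<Omega> G \<Delta> k \<phi>)) p)"
        using k in_product_action component_almost_simple component_subdegree top_orbit_coprime
        unfolding prim_component_eq[unfolded G] top_group_eq[unfolded G] G by blast
      then show ?thesis by blast
    qed
  qed
qed simp

end
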